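(* Let $T>0$. Let $F_0$ and $F_1$ be spectral measures on $\mathbb{R}^d\setminus\{0\}$ having positive densities $f_0$ and $f_1$ with respect to Lebesgue measure, and suppose that there exist constants $c,k_0,\eta>0$ such that $f_0(\lambda)\ge c\,|\lambda|^{-\eta}$ for all $|\lambda|>k_0$. Let $K_T^0$ be the reproducing kernel of $\mathcal{L}_{\Pi_T}(F_0)$. If there exists a finite constant $C>0$ such that $\|\phi\|_{F_0}\le C\|\phi\|_{F_1}$ for all $\phi\in\mathcal{L}^e_{\Pi_T}$, and $$\int_{|\lambda|>k}\left(\frac{f_1(\lambda)-f_0(\lambda)}{f_0(\lambda)}\right)^2K_T^0(\lambda,\lambda)f_0(\lambda)\,d\lambda<\infty$$ for some $k>0$, then the centered Gaussian random fields with stationary increments and spectral measures $F_0$ and $F_1$ are equivalent on $\Pi_T$.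
   Context: A spectral measure is a non-negative symmetric Borel measure $F$ on $\mathbb{R}^d\setminus\{0\}$ with $\int_{\mathbb{R}^d}\frac{|\lambda|^2}{1+|\lambda|^2}F(d\lambda)<\infty$. The centered Gaussian random field (GRF) with stationary increments and spectral measure $F$ is the real-valued centered Gaussian field $X=\{X_t:t\in\mathbb{R}^d\}$ with $X_0=0$ and $$\mathbf{E}(X_tX_s)=\int_{\mathbb{R}^d}\big(e^{i\langle t,\lambda\rangle}-1\big)\big(e^{-i\langle s,\lambda\rangle}-1\big)F(d\lambda).$$ For $D\subseteq\mathbb{R}^d$, two GRFs are equivalent on $D$ if they induce mutually absolutely continuous measures on $(\mathbb{R}^D,\mathcal{B}(\mathbb{R}^D))$, where $\mathcal{B}(\mathbb{R}^D)$ is the $\sigma$-field generated by the cylinder subsets of $\mathbb{R}^D$. $\Pi_T=[-T,T]^d$, $e_t(\lambda)=e^{i\langle t,\lambda\rangle}-1$, and $\mathcal{L}^e_{\Pi_T}$ is the complex linear span of $\{e_t:t\in\Pi_T\}$. For a spectral measure $F$, $\langle\phi,\chi\rangle_F=\int\phi\,\overline{\chi}\,dF$ and $\|\phi\|_F^2=\langle\phi,\phi\rangle_F$; $\mathcal{L}_{\Pi_T}(F)$ is the closure of $\mathcal{L}^e_{\Pi_T}$ in $L^2(F)$. If $F$ has a density $f$ satisfying $f(\lambda)\ge c|\lambda|^{-\eta}$ for all $|\lambda|>k_0$ (some $c,k_0,\eta>0$), every element of $\mathcal{L}_{\Pi_T}(F)$ is identified with its version that is the restriction to $\mathbb{R}^d$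 of an entire function on $\mathbb{C}^d$ (the locally uniform limit of any sequence from $\mathcal{L}^e_{\Pi_T}$ approximating it in $L^2(F)$). With this identification point evaluations are bounded and $\mathcal{L}_{\Pi_T}(F)$ is a reproducing kernel Hilbert space; its reproducing kernel $K_T:\mathbb{R}^d\times\mathbb{R}^d\to\mathbb{C}$ is the function with $K_T(\omega,\cdot)\in\mathcal{L}_{\Pi_T}(F)$ and $\langle\phi,K_T(\omega,\cdot)\rangle_F=\phi(\omega)$ for all $\omega\in\mathbb{R}^d$, $\phi\in\mathcal{L}_{\Pi_T}(F)$. *)

theory Defs
  imports "HOL-Probability.Probability"
begin

text \<open>A Borel measure on \<open>\<real>\<^sup>d - {0}\<close> is represented by the Borel measure on \<open>\<real>\<^sup>d\<close> that
  extends it and gives no mass to the origin.\<close>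

definition spectral_measure :: "(real^'d) measure \<Rightarrow> bool" where
  "spectral_measure F \<longleftrightarrow>
     sets F = sets borel \<and>
     emeasure F {0} = 0 \<and>
     distr F borel uminus = F \<and>
     (\<integral>\<^sup>+ x. ennreal ((norm x)\<^sup>2 / (1 + (norm x)\<^sup>2)) \<partial>F) < \<infinity>"

text \<open>The Dirac mass at 0 counts as a (degenerate) centered Gaussian distribution.\<close>

definition centered_gaussian :: "'w measure \<Rightarrow> ('w \<Rightarrow> real) \<Rightarrow> bool" where
  "centered_gaussian M Y \<longleftrightarrow>
     Y \<in> borel_measurable M \<and>
     ((AE w in M. Y w = 0) \<or> (\<exists>\<sigma>>0. distributed M lborel Y (normal_density 0 \<sigma>)))"

definition centered_gaussian_field :: "'w measure \<Rightarrow> ('i \<Rightarrow> 'w \<Rightarrow> real) \<Rightarrow> bool" where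
  "centered_gaussian_field M X \<longleftrightarrow>
     prob_space M \<and>
     (\<forall>S a. finite S \<longrightarrow> centered_gaussian M (\<lambda>w. \<Sum>t\<in>S. a t * X t w))"

definition e_fun :: "real^'d \<Rightarrow> real^'d \<Rightarrow> complex" where
  "e_fun t x = exp (\<i> * complex_of_real (t \<bullet> x)) - 1"

text \<open>Since \<open>\<langle>s, x\<rangle>\<close> is real, \<open>exp (-\<i>\<langle>s, x\<rangle>) - 1\<close> is the conjugate of \<open>e_fun s x\<close>.\<close>

definition stationary_increments_grf ::
  "(real^'d) measure \<Rightarrow> 'w measure \<Rightarrow> (real^'d \<Rightarrow> 'w \<Rightarrow> real) \<Rightarrow> bool" where
  "stationary_increments_grf F M X \<longleftrightarrow>
     centered_gaussian_field M X \<and>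
     (AE w in M. X 0 w = 0) \<and>
     (\<forall>t s. complex_of_real (\<integral>w. X t w * X s w \<partial>M) = (\<integral>x. e_fun t x * cnj (e_fun s x) \<partial>F))"

definition field_law :: "'i set \<Rightarrow> 'w measure \<Rightarrow> ('i \<Rightarrow> 'w \<Rightarrow> real) \<Rightarrow> ('i \<Rightarrow> real) measure" where
  "field_law D M X = distr M (\<Pi>\<^sub>M t\<in>D. borel) (\<lambda>w. \<lambda>t\<in>D. X t w)"

definition equivalent_on ::
  "'i set \<Rightarrow> 'v measure \<Rightarrow> ('i \<Rightarrow> 'v \<Rightarrow> real) \<Rightarrow> 'w measure \<Rightarrow> ('i \<Rightarrow> 'w \<Rightarrow> real) \<Rightarrow> bool" where
  "equivalent_on D M X N Y \<longleftrightarrow>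
     absolutely_continuous (field_law D M X) (field_law D N Y) \<and>
     absolutely_continuous (field_law D N Y) (field_law D M X)"

definition Pi_cube :: "real \<Rightarrow> (real^'d) set" where
  "Pi_cube T = cbox (\<chi> i. - T) (\<chi> i. T)"

definition e_span :: "(real^'d) set \<Rightarrow> (real^'d \<Rightarrow> complex) set" where
  "e_span D = {\<lambda>x. \<Sum>t\<in>S. a t * e_fun t x | S a. finite S \<and> S \<subseteq> D}"

definition L2_inner :: "'a measure \<Rightarrow> ('a \<Rightarrow> complex) \<Rightarrow> ('a \<Rightarrow> complex) \<Rightarrow> complex" where
  "L2_inner F \<phi> \<psi> = (\<integral>x. \<phi> x * cnj (\<psi> x) \<partial>F)"

text \<open>Meaningful only for functions in \<open>L2_fun F\<close>; elements of \<open>e_span D\<close> lie there whenever \<open>F\<close>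
  is a spectral measure.\<close>

definition L2_norm :: "'a measure \<Rightarrow> ('a \<Rightarrow> complex) \<Rightarrow> real" where
  "L2_norm F \<phi> = sqrt (Re (L2_inner F \<phi> \<phi>))"

definition L2_fun :: "'a measure \<Rightarrow> ('a \<Rightarrow> complex) set" where
  "L2_fun F = {\<phi> \<in> borel_measurable F. integrable F (\<lambda>x. (norm (\<phi> x))\<^sup>2)}"

text \<open>Holomorphic on all of \<open>\<complex>\<^sup>d\<close>: everywhere differentiable with complex linear derivative.\<close>

definition entire :: "(complex^'d \<Rightarrow> complex) \<Rightarrow> bool" where
  "entire \<Phi> \<longleftrightarrow>
     (\<forall>z. \<exists>\<Phi>'. (\<Phi> has_derivative \<Phi>') (at z) \<and> (\<forall>c v. \<Phi>' (c *s v) = c * \<Phi>' v))"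

definition restricts_entire :: "(real^'d \<Rightarrow> complex) \<Rightarrow> bool" where
  "restricts_entire \<phi> \<longleftrightarrow>
     (\<exists>\<Phi>. entire \<Phi> \<and> (\<forall>x. \<phi> x = \<Phi> (\<chi> i. complex_of_real (x $ i))))"

text \<open>The closure of \<open>e_span D\<close> in \<open>L\<^sup>2(F)\<close>, each class being represented by its version that
  extends to an entire function. This version is unique as soon as \<open>F\<close> has a density that is
  positive on a nonempty open set.\<close>

definition L_space :: "(real^'d) set \<Rightarrow> (real^'d) measure \<Rightarrow> (real^'d \<Rightarrow> complex) set" where
  "L_space D F =
     {\<phi> \<in> L2_fun F. restricts_entire \<phi> \<and>
        (\<forall>\<epsilon>>0. \<exists>\<psi>\<in>e_span D. L2_norm F (\<lambda>x. \<phi> x - \<psi> x) < \<epsilon>)}"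

definition reproducing_kernel ::
  "(real^'d) set \<Rightarrow> (real^'d) measure \<Rightarrow> (real^'d \<Rightarrow> real^'d \<Rightarrow> complex) \<Rightarrow> bool" where
  "reproducing_kernel D F K \<longleftrightarrow>
     (\<forall>\<omega>. K \<omega> \<in> L_space D F \<and> (\<forall>\<phi>\<in>L_space D F. L2_inner F \<phi> (K \<omega>) = \<phi> \<omega>))"

end

theory Submission
  imports Defs
begin

text \<open>For a finite set of times, diagonalize the two covariance forms simultaneously. In the
  resulting coordinates the laws are products of centered normal laws with variances \<open>1\<close> and
  \<open>\<lambda>\<^sub>i\<close>, whose symmetrized Kullback-Leibler divergence is \<open>\<Sum>\<^sub>i (\<lambda>\<^sub>i - 1)\<^sup>2 / (2 \<lambda>\<^sub>i)\<close>. As Hajek observed,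
  a bound on this quantity that is uniform in the finite set makes the two laws uniformly absolutely
  continuous on cylinder sets, hence equivalent.

  Here \<open>\<lambda>\<^sub>i - 1\<close> is the integral of \<open>\<bar>\<phi>\<^sub>i\<bar>\<^sup>2 (f1 - f0)\<close> for an \<open>F0\<close>-orthonormal system \<open>\<phi>\<^sub>i\<close> of the span of
  the exponentials, and \<open>\<lambda>\<^sub>i\<close> is bounded away from \<open>0\<close> by the comparison of norms. At high frequencies
  Bessel's inequality gives \<open>\<Sum>\<^sub>i \<bar>\<phi>\<^sub>i x\<bar>\<^sup>2 \<le> K x x\<close>, so by Cauchy-Schwarz the squares of the contributions
  sum to at most the integral in the hypothesis. At low frequencies \<open>\<Sum>\<^sub>i \<bar>\<phi>\<^sub>i x\<bar>\<^sup>2 \<le> C \<bar>x\<bar>\<^sup>2\<close>, because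
  \<open>\<bar>\<phi> x\<bar> \<le> C \<bar>x\<bar> \<parallel>\<phi>\<parallel>\<close> on compact sets. The latter bound follows from a convolution formula reproducing \<open>\<phi>\<close>;
  the part of the convolution over the bounded set where \<open>f0\<close> is small is absorbed into the left-hand
  side, that set having small measure since \<open>f0\<close> is positive.\<close>

section \<open>The de la Vallee Poussin kernel\<close>

text \<open>Spectral measures may have infinite mass near the origin and integrate only |x|^2 there.
  The factor |x| in the bound on compact sets is therefore essential; it arises because every \<phi>
  vanishes at 0 and the convolution kernel is Lipschitz. The two frequency ranges are summed
  differently. At low frequencies the densities are unrelated, so \<open>f0\<close> and
  \<open>f1\<close> enter separately, without cancellation, and the contributions to the deviations
  are absolutely summable. At high frequencies they are only square summable. Both suffice, because
  with \<lambda> bounded below each term of the divergence is at most a multiple of the squared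
  deviation. The covariance form is real while the span is complex. A system orthonormal for the
  real form remains orthonormal in complex L^2, so Bessel's inequality is available for complex
  evaluations.\<close>

lemma has_bochner_integral_one_minus_cos:
  fixes s :: real
  shows "has_bochner_integral lborel (\<lambda>x. (1 - cos (s * x)) / x\<^sup>2) (pi * \<bar>s\<bar>)"
proof -
  have pos: "has_bochner_integral lborel (\<lambda>x. (1 - cos (s * x)) / x\<^sup>2) (pi * s)" if s: "s > 0" for s :: real
  proof -
    let ?f = "\<lambda>x::real. (1 - cos (s * x)) / x\<^sup>2"
    \<comment> \<open>Antiderivative by parts: \<open>Si\<close> tends to \<open>pi / 2\<close> at
      infinity and the boundary term vanishes at both ends, so the half line contributes
      \<open>s * (pi / 2)\<close>.\<close>
    let ?F = "\<lambda>x::real. s * Si (s * x) - (1 - cos (s * x)) / x"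
    have D: "DERIV ?F x :> ?f x" if "x > 0" for x
      using that s
      by (auto intro!: derivative_eq_intros DERIV_chain2[OF DERIV_Si] simp: field_simps power2_eq_square)
    have lim: "((\<lambda>x. (1 - cos (s * x)) / x) \<longlongrightarrow> 0) (at 0)"
    proof -
      have "DERIV (\<lambda>x. 1 - cos (s * x)) 0 :> 0"
        by (auto intro!: derivative_eq_intros)
      then show ?thesis
        by (simp add: has_field_derivative_iff)
    qed
    have l0: "((?F \<circ> real_of_ereal) \<longlongrightarrow> 0) (at_right (ereal 0))"
    proof -
      have "(?F \<longlongrightarrow> s * Si (s * 0) - 0) (at_right 0)"
        by (intro tendsto_intros isCont_tendsto_compose[OF isCont_Si]
          filterlim_mono[OF lim order_refl at_le]) auto
      moreover have "Si 0 = 0" by (simp add: Si_def zero_ereal_def)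
      ultimately show ?thesis unfolding ereal_tendsto_simps by simp
    qed
    have l1: "((?F \<circ> real_of_ereal) \<longlongrightarrow> s * (pi/2)) (at_left \<infinity>)"
    proof -
      have "((\<lambda>x. s * Si (s * x)) \<longlongrightarrow> s * (pi/2)) at_top"
        by (intro tendsto_intros filterlim_compose[OF Si_at_top]
             filterlim_tendsto_pos_mult_at_top[OF tendsto_const s filterlim_ident])
      moreover have "((\<lambda>x::real. (1 - cos (s * x)) / x) \<longlongrightarrow> 0) at_top"
      proof (rule Lim_null_comparison)
        show "\<forall>\<^sub>F x in at_top. norm ((1 - cos (s * x)) / x) \<le> 2 / x"
          using eventually_gt_at_top[of 0]
        proof eventually_elim
          case (elim x)
          have "\<bar>1 - cos (s * x)\<bar> \<le> 2" using abs_cos_le_one[of "s*x"] by linarith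
          with elim show ?case by (simp add: divide_right_mono)
        qed
        show "((\<lambda>x::real. 2 / x) \<longlongrightarrow> 0) at_top"
          by (intro tendsto_divide_0[OF tendsto_const] filterlim_at_top_imp_at_infinity filterlim_ident)
      qed
      ultimately have "(?F \<longlongrightarrow> s * (pi/2) - 0) at_top" by (rule tendsto_diff)
      then show ?thesis unfolding ereal_tendsto_simps by simp
    qed
    have ci: "\<And>x. ereal 0 < ereal x \<Longrightarrow> ereal x < \<infinity> \<Longrightarrow> isCont ?f x"
      by (auto intro!: continuous_intros)
    have A: "set_integrable lborel (einterval (ereal 0) \<infinity>) ?f" "(LBINT x=ereal 0..\<infinity>. ?f x) = s * (pi/2) - 0"
      by (rule interval_integral_FTC_nonneg[where F = ?F]; (use D ci l0 l1 in auto))+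
    have e: "einterval (ereal 0) \<infinity> = {0<..}" by (auto simp: einterval_def)
    have B: "has_bochner_integral lborel (\<lambda>x. indicator {0<..} x *\<^sub>R ?f x) (s * (pi/2))"
      using A unfolding has_bochner_integral_iff set_integrable_def e interval_lebesgue_integral_def
       set_lebesgue_integral_def by simp
    \<comment> \<open>Reflection supplies the negative half line, because the integrand is
      even.\<close>
    have C: "has_bochner_integral lborel (\<lambda>x. indicator {0<..} (0 + (-1)*x) *\<^sub>R ?f (0 + (-1) * x)) ((s * (pi/2)) /\<^sub>R \<bar>-1\<bar>)"
      using B by (rule lborel_has_bochner_integral_real_affine_iff[THEN iffD1, rotated]) simp
    have "has_bochner_integral lborel (\<lambda>x. indicator {0<..} x *\<^sub>R ?f x + indicator {0<..} (0 + (-1)*x) *\<^sub>R ?f (0 + (-1) * x)) (s*(pi/2) + (s * (pi/2)) /\<^sub>R \<bar>-1\<bar>)"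
      by (rule has_bochner_integral_add[OF B C])
    also have "(\<lambda>x. indicator {0<..} x *\<^sub>R ?f x + indicator {0<..} (0 + (-1)*x) *\<^sub>R ?f (0 + (-1) * x)) = ?f"
      by (auto simp: fun_eq_iff indicator_def)
    finally show ?thesis by (simp add: mult.commute)
  qed
  show ?thesis
    using pos[of s] pos[of "-s"] by (cases "s > 0"; cases "s = 0") (auto simp: has_bochner_integral_zero)
qed

text \<open>The library's \<open>sinc\<close> abbreviates a conditional, which the simplifier would split.\<close>

definition sn :: "real \<Rightarrow> real" where
  "sn x = sinc x"

lemma sn_measurable [measurable]: "sn \<in> borel_measurable borel"
  unfolding sn_def by measurable

lemma sn_minus: "sn (- x) = sn x"
  by (simp add: sn_def)

text \<open>The inverse Fourier transform of the trapezoid that is \<open>1\<close> on \<open>[-a, a]\<close> and \<open>0\<close> off \<open>[-a-1, a+1]\<close>.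
  The product of sines extends \<open>(cos (a x) - cos ((a + 1) x)) / (\<pi> x\<^sup>2)\<close> continuously to \<open>0\<close>.\<close>

definition vp_kernel :: "real \<Rightarrow> real \<Rightarrow> real" where
  "vp_kernel a x = (a + 1/2) / pi * sn ((a + 1/2) * x) * sn (x / 2)"

lemma vp_kernel_eq:
  assumes "x \<noteq> 0" "a \<ge> 0"
  shows "vp_kernel a x = (cos (a * x) - cos ((a + 1) * x)) / (pi * x\<^sup>2)"
proof -
  define p where "p = a + 1/2"
  have p: "p \<noteq> 0" "a * x = p * x - x/2" "(a + 1) * x = p * x + x/2"
    using assms by (simp_all add: p_def algebra_simps)
  have "cos (a * x) - cos ((a + 1) * x) = 2 * sin (p * x) * sin (x / 2)"
    unfolding p(2,3) by (simp add: cos_add cos_diff)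
  then show ?thesis
    unfolding vp_kernel_def p_def[symmetric] sn_def using assms p(1) by (simp add: power2_eq_square mult_ac)
qed

lemma vp_kernel_even: "vp_kernel a (- x) = vp_kernel a x"
  unfolding vp_kernel_def by (simp add: sn_minus)

lemma vp_kernel_measurable [measurable]: "vp_kernel a \<in> borel_measurable borel"
  unfolding vp_kernel_def by measurable

text \<open>Product formulas reduce the integrand to functions
  \<open>(1 - cos (s * x)) / x^2\<close> with \<open>s\<close> equal to \<open>a + 1 + t\<close>,
  \<open>a + 1 - t\<close>, \<open>a + t\<close> and \<open>a - t\<close>. For |t| at most
  \<open>a\<close> these are all nonnegative, so the absolute values in their integrals drop out and
  the total is independent of \<open>t\<close>: the plateau of the trapezoid.\<close>

lemma vp_kernel_fourier:
  assumes "a \<ge> 0" "\<bar>t\<bar> \<le> a"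
  shows "has_bochner_integral lborel (\<lambda>x. vp_kernel a x * cos (t * x)) 1"
proof -
  let ?g = "\<lambda>s x::real. (1 - cos (s * x)) / x\<^sup>2"
  have "has_bochner_integral lborel
     (\<lambda>x. (1/(2*pi)) * (?g (a+1+t) x + ?g (a+1-t) x - ?g (a+t) x - ?g (a-t) x))
     ((1/(2*pi)) * (pi * \<bar>a+1+t\<bar> + pi * \<bar>a+1-t\<bar> - pi * \<bar>a+t\<bar> - pi * \<bar>a-t\<bar>))"
    by (intro has_bochner_integral_mult_right has_bochner_integral_add has_bochner_integral_diff
        has_bochner_integral_one_minus_cos)
  also have "(1/(2*pi)) * (pi * \<bar>a+1+t\<bar> + pi * \<bar>a+1-t\<bar> - pi * \<bar>a+t\<bar> - pi * \<bar>a-t\<bar>) = 1"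
    using assms by (simp add: field_simps)
  finally have *: "has_bochner_integral lborel
     (\<lambda>x. (1/(2*pi)) * (?g (a+1+t) x + ?g (a+1-t) x - ?g (a+t) x - ?g (a-t) x)) 1" .
  show ?thesis
  proof (rule has_bochner_integralI_AE[OF *])
    have "(1/(2*pi)) * (?g (a+1+t) x + ?g (a+1-t) x - ?g (a+t) x - ?g (a-t) x) = vp_kernel a x * cos (t * x)"
      if "x \<noteq> 0" for x
    proof -
      have *: "cos (a * x) * cos (t * x) - cos ((a + 1) * x) * cos (t * x) =
         (cos ((a+t)*x) + cos ((a-t)*x) - cos ((a+1+t)*x) - cos ((a+1-t)*x)) / 2"
        by (simp add: cos_add cos_diff sin_add algebra_simps)
      have "(1/(2*pi)) * (?g (a+1+t) x + ?g (a+1-t) x - ?g (a+t) x - ?g (a-t) x) =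
        ((cos ((a+t)*x) + cos ((a-t)*x) - cos ((a+1+t)*x) - cos ((a+1-t)*x)) / 2) / (pi * x\<^sup>2)"
        by (simp add: diff_divide_distrib add_divide_distrib mult.commute)
      also have "\<dots> = vp_kernel a x * cos (t * x)"
        unfolding *[symmetric] using that assms by (simp add: vp_kernel_eq left_diff_distrib)
      finally show ?thesis .
    qed
    then show "AE x in lborel. (1/(2*pi)) * (?g (a+1+t) x + ?g (a+1-t) x - ?g (a+t) x - ?g (a-t) x) = vp_kernel a x * cos (t * x)"
      using AE_lborel_singleton[of 0] by auto
  qed (intro borel_measurable_times vp_kernel_measurable, measurable)
qed

text \<open>An average of cosines. It yields the Lipschitz bound without a derivative at 0, and it
  later turns multiplication by \<open>sn\<close> into an average over frequency shifts.\<close>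

lemma sn_eq_integral: "sn x = (LBINT s:{0..1}. cos (s * x))"
proof (cases "x = 0")
  case False
  have "(LBINT s. cos (s * x) * indicator {0..1} s) = sin (1 * x) / x - sin (0 * x) / x"
    by (rule integral_FTC_Icc_real) (auto intro!: derivative_eq_intros continuous_intros simp: False)
  then show ?thesis using False by (simp add: sn_def set_lebesgue_integral_def mult.commute)
qed (simp add: sn_def set_lebesgue_integral_def)

lemma abs_sn_le_one: "\<bar>sn x\<bar> \<le> 1"
  using abs_sin_x_le_abs_x[of x] by (auto simp: sn_def divide_le_eq_1)

lemma sn_lipschitz: "\<bar>sn x - sn y\<bar> \<le> \<bar>x - y\<bar>"
proof -
  have i: "set_integrable lborel {0..1} (\<lambda>s::real. cos (s * x))" for x
    unfolding set_integrable_def by (intro borel_integrable_compact) (auto intro!: continuous_intros)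
  have "\<bar>sn x - sn y\<bar> = norm (LBINT s:{0..1}. cos (s * x) - cos (s * y))"
    by (simp add: sn_eq_integral set_integral_diff i)
  also have "\<dots> \<le> (LBINT s:{0..1::real}. \<bar>x - y\<bar>)"
    unfolding set_lebesgue_integral_def
  proof (rule Bochner_Integration.integral_norm_bound_integral)
    show "integrable lborel (\<lambda>s. indicat_real {0..1} s *\<^sub>R (cos (s * x) - cos (s * y)))"
      using set_integral_diff(1)[OF i[of x] i[of y]] by (simp add: set_integrable_def)
    show "integrable lborel (\<lambda>s::real. indicat_real {0..1} s *\<^sub>R \<bar>x - y\<bar>)"
      by (intro borel_integrable_compact) auto
  next
    fix s :: real
    have "\<bar>cos (s * x) - cos (s * y)\<bar> \<le> \<bar>s * x - s * y\<bar>"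
    proof -
      have "cos (s * x) - cos (s * y) = 2 * sin ((s * x + s * y)/2) * sin ((s * y - s * x)/2)"
        by (rule cos_diff_cos)
      then have "\<bar>cos (s * x) - cos (s * y)\<bar> = 2 * \<bar>sin ((s * x + s * y)/2)\<bar> * \<bar>sin ((s * y - s * x)/2)\<bar>"
        by (simp add: abs_mult)
      also have "\<dots> \<le> 2 * 1 * \<bar>(s * y - s * x)/2\<bar>"
        by (intro mult_mono abs_sin_x_le_abs_x) auto
      finally show ?thesis by simp
    qed
    also have "\<dots> = \<bar>s\<bar> * \<bar>x - y\<bar>" unfolding right_diff_distrib[symmetric] abs_mult ..
    finally have "\<bar>cos (s * x) - cos (s * y)\<bar> \<le> \<bar>s\<bar> * \<bar>x - y\<bar>" .
    moreover have "\<bar>s\<bar> * \<bar>x - y\<bar> \<le> \<bar>x - y\<bar>" if "s \<in> {0..1}"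
      using that by (simp add: mult_left_le_one_le)
    ultimately show "norm (indicat_real {0..1} s *\<^sub>R (cos (s * x) - cos (s * y))) \<le> indicat_real {0..1} s *\<^sub>R \<bar>x - y\<bar>"
      by (cases "s \<in> {0..1}") simp_all
  qed
  also have "\<dots> = \<bar>x - y\<bar>" by (simp add: set_lebesgue_integral_def)
  finally show ?thesis .
qed

lemma vp_kernel_bounded: "a \<ge> 0 \<Longrightarrow> \<bar>vp_kernel a x\<bar> \<le> a + 1"
proof -
  assume a: "a \<ge> 0"
  have "\<bar>vp_kernel a x\<bar> = (a + 1/2) / pi * (\<bar>sn ((a + 1/2) * x)\<bar> * \<bar>sn (x / 2)\<bar>)"
    using a by (simp add: vp_kernel_def abs_mult)
  also have "\<dots> \<le> (a + 1/2) / 1 * (1 * 1)"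
    using a pi_gt3 by (intro mult_mono abs_sn_le_one frac_le) auto
  finally show ?thesis using a by simp
qed

lemma vp_kernel_lipschitz:
  assumes a: "a \<ge> 0" shows "\<bar>vp_kernel a x - vp_kernel a y\<bar> \<le> (a + 1)\<^sup>2 * \<bar>x - y\<bar>"
proof -
  let ?p = "a + 1/2"
  have "vp_kernel a x - vp_kernel a y = ?p / pi *
     ((sn (?p * x) - sn (?p * y)) * sn (x / 2) + sn (?p * y) * (sn (x/2) - sn (y/2)))"
    by (simp add: vp_kernel_def algebra_simps)
  then have "\<bar>vp_kernel a x - vp_kernel a y\<bar> = ?p / pi *
     \<bar>(sn (?p * x) - sn (?p * y)) * sn (x / 2) + sn (?p * y) * (sn (x/2) - sn (y/2))\<bar>"
    using a by (simp add: abs_mult)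
  also have "\<dots> \<le> ?p / 1 * (\<bar>?p * x - ?p * y\<bar> * 1 + 1 * \<bar>x/2 - y/2\<bar>)"
  proof (intro mult_mono)
    have "\<bar>(sn (?p * x) - sn (?p * y)) * sn (x / 2) + sn (?p * y) * (sn (x/2) - sn (y/2))\<bar>
      \<le> \<bar>sn (?p * x) - sn (?p * y)\<bar> * \<bar>sn (x / 2)\<bar> + \<bar>sn (?p * y)\<bar> * \<bar>sn (x/2) - sn (y/2)\<bar>"
      unfolding abs_mult[symmetric] by (rule abs_triangle_ineq)
    also have "\<dots> \<le> \<bar>?p * x - ?p * y\<bar> * 1 + 1 * \<bar>x/2 - y/2\<bar>"
      by (intro add_mono mult_mono sn_lipschitz abs_sn_le_one) auto
    finally show "\<bar>(sn (?p * x) - sn (?p * y)) * sn (x / 2) + sn (?p * y) * (sn (x/2) - sn (y/2))\<bar> \<le> \<dots>" .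
    show "?p / pi \<le> ?p / 1" using a pi_gt3 by (intro frac_le) auto
  qed (use a in auto)
  also have "\<bar>?p * x - ?p * y\<bar> = ?p * \<bar>x - y\<bar>"
    using a unfolding right_diff_distrib[symmetric] abs_mult by simp
  also have "?p / 1 * (?p * \<bar>x - y\<bar> * 1 + 1 * \<bar>x/2 - y/2\<bar>) = ?p * (?p + 1/2) * \<bar>x - y\<bar>"
    unfolding diff_divide_distrib[symmetric] abs_divide by (simp add: field_simps)
  also have "\<dots> \<le> (a+1)\<^sup>2 * \<bar>x - y\<bar>"
    using a by (intro mult_right_mono) (auto simp: power2_eq_square algebra_simps)
  finally show ?thesis .
qed

section \<open>Reproducing trigonometric sums\<close>

lemma vp_kernel_integrable: "a \<ge> 0 \<Longrightarrow> integrable lborel (vp_kernel a)"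
  using vp_kernel_fourier[of a 0] by (simp add: has_bochner_integral_iff)

lemma iexp_eq: "iexp y = complex_of_real (cos y) + \<i> * complex_of_real (sin y)"
  by (simp add: exp_Euler cos_of_real sin_of_real)

text \<open>The kernel is even, so the sine part of the transform is odd and integrates to
  0.\<close>

lemma vp_kernel_char:
  assumes a: "a \<ge> 0" "\<bar>t\<bar> \<le> a"
  shows "has_bochner_integral lborel (\<lambda>x. iexp (t * x) * complex_of_real (vp_kernel a x)) 1"
proof -
  let ?s = "\<lambda>x. vp_kernel a x * sin (t * x)"
  have i: "integrable lborel ?s"
    by (rule Bochner_Integration.integrable_bound[OF vp_kernel_integrable[OF a(1)]])
       (auto simp: abs_mult intro!: mult_right_le_one_le)
  have "integral\<^sup>L lborel ?s = \<bar>-1\<bar> *\<^sub>R (\<integral>x. ?s (0 + (-1) * x) \<partial>lborel)"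
    by (rule lborel_integral_real_affine) simp
  also have "(\<lambda>x. ?s (0 + (-1) * x)) = (\<lambda>x. - ?s x)"
    by (simp add: vp_kernel_even)
  finally have "integral\<^sup>L lborel ?s = 0" by simp
  with i have s: "has_bochner_integral lborel ?s 0" by (simp add: has_bochner_integral_iff)
  have "has_bochner_integral lborel (\<lambda>x. complex_of_real (vp_kernel a x * cos (t * x)) + \<i> * complex_of_real (?s x))
    (complex_of_real 1 + \<i> * complex_of_real 0)"
    by (intro has_bochner_integral_add has_bochner_integral_mult_right has_bochner_integral_of_real
        vp_kernel_fourier a s)
  also have "(\<lambda>x. complex_of_real (vp_kernel a x * cos (t * x)) + \<i> * complex_of_real (?s x)) =
     (\<lambda>x. iexp (t * x) * complex_of_real (vp_kernel a x))"
    unfolding iexp_eq by (auto simp: fun_eq_iff algebra_simps)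
  finally show ?thesis by simp
qed

text \<open>Induction on \<open>N\<close>. Without the factor this is the Fourier identity,
  translated. Each further \<open>sn\<close> averages the frequency over shifts of size at most
  \<delta>, which stay within the plateau, and Fubini exchanges the average with the
  convolution.\<close>

lemma vp_kernel_reproduces:
  assumes a: "a \<ge> 0" "\<delta> \<ge> 0" and t: "\<bar>t\<bar> + real N * \<delta> \<le> a"
  shows "has_bochner_integral lborel
     (\<lambda>x. iexp (t * x) * complex_of_real (sn (\<delta> * x) ^ N * vp_kernel a (l - x)))
     (iexp (t * l) * complex_of_real (sn (\<delta> * l) ^ N))"
  using t
proof (induction N arbitrary: t)
  case 0
  have "has_bochner_integral lborel (\<lambda>x. iexp ((-t) * x) * complex_of_real (vp_kernel a x)) 1"
    using 0 by (intro vp_kernel_char a) simp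
  then have "has_bochner_integral lborel (\<lambda>x. iexp ((-t) * (l + (-1) * x)) * complex_of_real (vp_kernel a (l + (-1) * x))) (1 /\<^sub>R \<bar>-1\<bar>)"
    by (rule lborel_has_bochner_integral_real_affine_iff[THEN iffD1, rotated]) simp
  from has_bochner_integral_mult_right[OF this, of "iexp (t * l)"]
  have "has_bochner_integral lborel (\<lambda>x. iexp (t * l) * (iexp ((-t) * (l + (-1) * x)) * complex_of_real (vp_kernel a (l + (-1) * x)))) (iexp (t * l) * (1 /\<^sub>R \<bar>-1\<bar>))"
    by simp
  moreover have "iexp (t * l) * (iexp ((-t) * (l + (-1) * x)) * z) = iexp (t * x) * z" for x z
    by (simp add: mult.assoc[symmetric] exp_add[symmetric]) (simp add: algebra_simps)
  ultimately have "has_bochner_integral lborel (\<lambda>x. iexp (t * x) * complex_of_real (vp_kernel a (l + (-1) * x))) (iexp (t * l) * (1 /\<^sub>R \<bar>-1\<bar>))"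
    by (simp only:)
  then show ?case by simp
next
  case (Suc N)
  define W where "W x = vp_kernel a (l - x)" for x
  have Wm[measurable]: "W \<in> borel_measurable borel" unfolding W_def by measurable
  have Wi: "integrable lborel W"
    unfolding W_def using lborel_integrable_real_affine[OF vp_kernel_integrable[OF a(1)], of "-1" l]
    by simp
  \<comment> \<open>The integrand before the average over \<open>s\<close>. It is dominated by
    \<open>|W x|\<close> on the strip where \<open>s\<close> lies between 0 and 1, hence integrable
    on the product.\<close>
  define g where "g x s = indicator {0..1} s *\<^sub>R (complex_of_real (cos (s * (\<delta> * x))) *
      (iexp (t * x) * complex_of_real (sn (\<delta> * x) ^ N * W x)))" for x s :: real
  have gm[measurable]: "case_prod g \<in> borel_measurable (lborel \<Otimes>\<^sub>M lborel)"
    unfolding g_def by measurable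
  have gb: "norm (g x s) \<le> \<bar>W x\<bar> * indicator {0..1} s" for x s
  proof -
    have "\<bar>cos (s * (\<delta> * x))\<bar> * (\<bar>sn (\<delta> * x)\<bar> ^ N * \<bar>W x\<bar>) \<le> 1 * (1 * \<bar>W x\<bar>)"
      by (intro mult_mono power_le_one abs_sn_le_one mult_nonneg_nonneg) auto
    then show ?thesis
      by (auto simp: g_def norm_mult norm_power abs_mult power_abs indicator_def)
  qed
  have fin: "integrable lborel (\<lambda>s::real. indicator {0..1} s *\<^sub>R (1::real))"
    by (intro borel_integrable_compact) auto
  have gi: "integrable lborel (g x)" for x
    by (rule Bochner_Integration.integrable_bound[OF integrable_mult_right[OF fin, of "W x"]])
       (use gb in \<open>auto simp: g_def abs_mult intro: order_trans\<close>)
  have gint: "integrable (lborel \<Otimes>\<^sub>M lborel) (case_prod g)"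
  proof (rule lborel_pair.Fubini_integrable)
    show "integrable lborel (\<lambda>x. \<integral>s. norm (case_prod g (x, s)) \<partial>lborel)"
    proof (rule Bochner_Integration.integrable_bound[OF Wi])
      show "AE x in lborel. norm (\<integral>s. norm (case_prod g (x, s)) \<partial>lborel) \<le> norm (W x)"
      proof (intro AE_I2)
        fix x
        have "norm (\<integral>s. norm (case_prod g (x, s)) \<partial>lborel) = (\<integral>s. norm (g x s) \<partial>lborel)"
          by simp
        also have "\<dots> \<le> (\<integral>s. \<bar>W x\<bar> * (indicator {0..1::real} s *\<^sub>R (1::real)) \<partial>lborel)"
          by (intro Bochner_Integration.integral_mono integrable_norm gi integrable_mult_right fin) (use gb in auto)
        finally show "norm (\<integral>s. norm (case_prod g (x, s)) \<partial>lborel) \<le> norm (W x)"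
          by simp
      qed
    qed measurable
  qed (use gi in auto)
  have inner: "(\<integral>s. g x s \<partial>lborel) = iexp (t * x) * complex_of_real (sn (\<delta> * x) ^ Suc N * W x)" for x
  proof -
    have "(\<integral>s. g x s \<partial>lborel) = (\<integral>s. complex_of_real (indicator {0..1} s * cos (s * (\<delta> * x))) *
      (iexp (t * x) * complex_of_real (sn (\<delta> * x) ^ N * W x)) \<partial>lborel)"
      by (intro Bochner_Integration.integral_cong) (auto simp: g_def indicator_def)
    also have "\<dots> = complex_of_real (\<integral>s. indicator {0..1} s * cos (s * (\<delta> * x)) \<partial>lborel) *
      (iexp (t * x) * complex_of_real (sn (\<delta> * x) ^ N * W x))"
      by (simp del: of_real_mult)
    finally show ?thesis by (simp add: sn_eq_integral set_lebesgue_integral_def)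
  qed
  have outer: "(\<integral>x. g x s \<partial>lborel) = indicator {0..1} s *\<^sub>R (complex_of_real (cos (s * (\<delta> * l))) *
      (iexp (t * l) * complex_of_real (sn (\<delta> * l) ^ N)))" for s
  proof (cases "s \<in> {0..1}")
    case True
    then have "s * \<delta> \<le> \<delta>" "s * \<delta> \<ge> 0" using a by (auto simp: mult_left_le_one_le)
    then have "\<bar>t + s * \<delta>\<bar> + real N * \<delta> \<le> a" "\<bar>t - s * \<delta>\<bar> + real N * \<delta> \<le> a"
      using Suc.prems by (auto simp: algebra_simps)
    note h = this[THEN Suc.IH]
    \<comment> \<open>A cosine factor splits one exponential into two with frequencies
      \<open>t + s * \<delta>\<close> and \<open>t - s * \<delta>\<close>; passing from
      \<open>Suc N\<close> to \<open>N\<close> frees the room for this shift.\<close>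
    have *: "complex_of_real (cos (s * (\<delta> * y))) * (iexp (t * y) * z) =
       (1/2) * (iexp ((t + s * \<delta>) * y) * z + iexp ((t - s * \<delta>) * y) * z)" for y z
      unfolding iexp_eq by (simp add: cos_add sin_add cos_diff sin_diff algebra_simps)
    have "has_bochner_integral lborel (\<lambda>x. complex_of_real (cos (s * (\<delta> * x))) *
        (iexp (t * x) * complex_of_real (sn (\<delta> * x) ^ N * vp_kernel a (l - x))))
       (complex_of_real (cos (s * (\<delta> * l))) * (iexp (t * l) * complex_of_real (sn (\<delta> * l) ^ N)))"
      unfolding * by (intro has_bochner_integral_mult_right has_bochner_integral_add h)
    then show ?thesis using True
      by (simp add: g_def W_def has_bochner_integral_iff)
  qed (simp add: g_def)
  have "(\<integral>x. iexp (t * x) * complex_of_real (sn (\<delta> * x) ^ Suc N * W x) \<partial>lborel) = (\<integral>s. (\<integral>x. g x s \<partial>lborel) \<partial>lborel)"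
    unfolding inner[symmetric] by (rule lborel_pair.Fubini_integral[OF gint, symmetric])
  also have "\<dots> = (\<integral>s. complex_of_real (indicator {0..1} s * cos (s * (\<delta> * l))) *
      (iexp (t * l) * complex_of_real (sn (\<delta> * l) ^ N)) \<partial>lborel)"
    unfolding outer by (intro Bochner_Integration.integral_cong) (auto simp: indicator_def)
  also have "\<dots> = complex_of_real (\<integral>s. indicator {0..1} s * cos (s * (\<delta> * l)) \<partial>lborel) *
      (iexp (t * l) * complex_of_real (sn (\<delta> * l) ^ N))"
    by (simp del: of_real_mult)
  finally have 1: "(\<integral>x. iexp (t * x) * complex_of_real (sn (\<delta> * x) ^ Suc N * W x) \<partial>lborel) =
     iexp (t * l) * complex_of_real (sn (\<delta> * l) ^ Suc N)"
    by (simp add: sn_eq_integral set_lebesgue_integral_def)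
  have "integrable lborel (\<lambda>x. iexp (t * x) * complex_of_real (sn (\<delta> * x) ^ Suc N * W x))"
    unfolding inner[symmetric] by (rule lborel_pair.integrable_fst[OF gint])
  with 1 show ?case by (simp add: has_bochner_integral_iff W_def)
qed

section \<open>Tensor products of the one-dimensional kernels\<close>

lemma has_bochner_integral_lborel_prod:
  fixes f :: "'d::finite \<Rightarrow> real \<Rightarrow> 'b::{real_normed_field,banach,second_countable_topology}"
  assumes f: "\<And>i. has_bochner_integral lborel (f i) (c i)"
  shows "has_bochner_integral lborel (\<lambda>x::real^'d. \<Prod>i\<in>UNIV. f i (x $ i)) (\<Prod>i\<in>UNIV. c i)"
proof -
  interpret product_sigma_finite "\<lambda>_::real^'d. lborel :: real measure"
    by standard
  \<comment> \<open>Lebesgue measure on the vector space is the image of a product measure indexed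
    by \<open>Basis\<close>; the bijection \<open>axis\<close> carries coordinates to basis vectors,
    so that Fubini for products applies.\<close>
  let ?ax = "\<lambda>i::'d. axis i (1::real) :: real^'d"
  have inj: "inj ?ax" by (auto simp: inj_on_def axis_eq_axis)
  have B: "Basis = range ?ax" by (auto simp: Basis_vec_def)
  have invax: "inv ?ax (?ax i) = i" for i by (rule inv_f_f[OF inj])
  define g where "g b = f (inv ?ax b)" for b
  have g: "integrable lborel (g b)" "integral\<^sup>L lborel (g b) = c (inv ?ax b)" for b
    using f by (auto simp: g_def has_bochner_integral_iff)
  have prod_B: "(\<Prod>b\<in>Basis. h b (inv ?ax b)) = (\<Prod>i\<in>UNIV. h (?ax i) i)" for h :: "real^'d \<Rightarrow> 'd \<Rightarrow> 'b"
    unfolding B by (subst prod.reindex) (auto simp: inj invax)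
  have eq: "(\<Prod>i\<in>UNIV. f i (x $ i)) = (\<Prod>b\<in>Basis. g b (x \<bullet> b))" for x :: "real^'d"
    unfolding g_def prod_B[of "\<lambda>b i. f i (x \<bullet> b)"] by (simp add: cart_eq_inner_axis)
  have gm[measurable]: "g b \<in> borel_measurable borel" for b
    using g(1)[of b] by (auto dest: borel_measurable_integrable)
  have inner_eq: "(\<Sum>b\<in>Basis. x b *\<^sub>R b) \<bullet> b = x b" if "b \<in> Basis" for x and b :: "real^'d"
    using that by (simp add: inner_sum_left inner_Basis if_distrib cong: if_cong)
  have prod_eq: "(\<Prod>b\<in>Basis. g b ((\<Sum>b\<in>Basis. x b *\<^sub>R b) \<bullet> b)) = (\<Prod>b\<in>Basis. g b (x b))" for x
    by (intro prod.cong refl) (simp add: inner_eq)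
  have "integrable (Pi\<^sub>M Basis (\<lambda>_::real^'d. lborel)) (\<lambda>x. \<Prod>b\<in>Basis. g b (x b))"
    by (rule product_integrable_prod) (auto simp: g)
  moreover have "(\<integral>x. (\<Prod>b\<in>Basis. g b (x b)) \<partial>Pi\<^sub>M Basis (\<lambda>_::real^'d. lborel)) = (\<Prod>b\<in>Basis. integral\<^sup>L lborel (g b))"
    by (rule product_integral_prod) (auto simp: g)
  ultimately show ?thesis
    unfolding has_bochner_integral_iff eq
    by (subst (1 2) lborel_eq)
       (simp add: integrable_distr_eq integral_distr prod_eq g prod_B[of "\<lambda>b i. c i"])
qed

text \<open>A trigonometric sum becomes integrable against a given power of the norm after multiplication by
  this factor with \<open>N\<close> large, which enlarges its frequency range only by \<open>N \<delta>\<close>; so the kernel need not decay.\<close>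

definition decay_factor :: "real \<Rightarrow> nat \<Rightarrow> real^'d \<Rightarrow> real" where
  "decay_factor \<delta> N x = (\<Prod>i\<in>UNIV. sn (\<delta> * x $ i) ^ N)"

definition vp_kernel_vec :: "real \<Rightarrow> real^'d \<Rightarrow> real" where
  "vp_kernel_vec a x = (\<Prod>i\<in>UNIV. vp_kernel a (x $ i))"

lemma vp_kernel_vec_reproduces_iexp:
  fixes t l :: "real^'d"
  assumes a: "a \<ge> 0" "\<delta> \<ge> 0" and t: "\<And>i. \<bar>t $ i\<bar> + real N * \<delta> \<le> a"
  shows "has_bochner_integral lborel
     (\<lambda>x. iexp (t \<bullet> x) * complex_of_real (decay_factor \<delta> N x * vp_kernel_vec a (l - x)))
     (iexp (t \<bullet> l) * complex_of_real (decay_factor \<delta> N l))"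
proof -
  have *: "iexp (t \<bullet> x) = (\<Prod>i\<in>UNIV. iexp (t $ i * x $ i))" for x
    by (simp add: inner_vec_def exp_sum[symmetric] sum_distrib_left)
  show ?thesis
    using has_bochner_integral_lborel_prod[where f="\<lambda>i y. iexp (t $ i * y) * complex_of_real (sn (\<delta> * y) ^ N * vp_kernel a (l $ i - y))"
       and c = "\<lambda>i. iexp (t $ i * l $ i) * complex_of_real (sn (\<delta> * l $ i) ^ N)", OF vp_kernel_reproduces[OF a t]]
    by (simp add: * decay_factor_def vp_kernel_vec_def prod.distrib)
qed

lemma decay_factor_measurable [measurable]: "decay_factor \<delta> N \<in> borel_measurable borel"
  unfolding decay_factor_def by measurable

lemma vp_kernel_vec_measurable [measurable]: "vp_kernel_vec a \<in> borel_measurable borel"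
  unfolding vp_kernel_vec_def by measurable

lemma vp_kernel_vec_bounded:
  fixes x :: "real^'d"
  assumes a: "a \<ge> 0"
  shows "\<bar>vp_kernel_vec a x\<bar> \<le> (a + 1) ^ CARD('d)"
proof -
  have "\<bar>vp_kernel_vec a x\<bar> \<le> (\<Prod>i\<in>(UNIV::'d set). (a + 1))"
    unfolding vp_kernel_vec_def abs_prod by (intro prod_mono) (auto simp: vp_kernel_bounded a)
  then show ?thesis by simp
qed

lemma vp_kernel_vec_lipschitz:
  fixes x y :: "real^'d" and a :: real
  assumes a: "a \<ge> 0"
  shows "\<bar>vp_kernel_vec a x - vp_kernel_vec a y\<bar> \<le> (a + 1) ^ CARD('d) * (CARD('d) * (a + 1)) * norm (x - y)"
proof -
  \<comment> \<open>Dividing by the bound \<open>a + 1\<close> makes every factor at most 1, as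
    needed to bound a difference of products by the sum of the differences.\<close>
  let ?f = "\<lambda>x i. vp_kernel a (x $ i) / (a + 1)"
  have eq: "vp_kernel_vec a x = (a + 1) ^ CARD('d) * (\<Prod>i\<in>UNIV. ?f x i)" for x :: "real^'d"
    using a by (simp add: vp_kernel_vec_def prod_dividef)
  have "norm ((\<Prod>i\<in>UNIV. ?f x i) - (\<Prod>i\<in>UNIV. ?f y i)) \<le> (\<Sum>i\<in>UNIV. norm (?f x i - ?f y i))"
    using a by (intro norm_prod_diff) (auto simp: vp_kernel_bounded)
  also have "\<dots> \<le> (\<Sum>i\<in>(UNIV::'d set). (a + 1) * norm (x - y))"
  proof (intro sum_mono)
    fix i
    have "norm (?f x i - ?f y i) = \<bar>vp_kernel a (x $ i) - vp_kernel a (y $ i)\<bar> / (a + 1)"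
      using a by (simp add: diff_divide_distrib[symmetric])
    also have "\<dots> \<le> ((a + 1)\<^sup>2 * \<bar>x $ i - y $ i\<bar>) / (a + 1)"
      using a by (intro divide_right_mono vp_kernel_lipschitz) auto
    also have "\<dots> = (a + 1) * \<bar>(x - y) $ i\<bar>" using a by (simp add: power2_eq_square)
    also have "\<dots> \<le> (a + 1) * norm (x - y)"
      using a component_le_norm_cart[of "x - y" i] by (intro mult_left_mono) auto
    finally show "norm (?f x i - ?f y i) \<le> (a + 1) * norm (x - y)" .
  qed
  finally have "\<bar>(\<Prod>i\<in>UNIV. ?f x i) - (\<Prod>i\<in>UNIV. ?f y i)\<bar> \<le> CARD('d) * (a + 1) * norm (x - y)"
    by simp
  then have "(a + 1) ^ CARD('d) * \<bar>(\<Prod>i\<in>UNIV. ?f x i) - (\<Prod>i\<in>UNIV. ?f y i)\<bar> \<le> (a + 1) ^ CARD('d) * (CARD('d) * (a + 1) * norm (x - y))"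
    using a by (intro mult_left_mono) auto
  then show ?thesis
    using a unfolding eq right_diff_distrib[symmetric] by (simp add: abs_mult mult.assoc)
qed

section \<open>Size and decay of the auxiliary factor\<close>

lemma abs_decay_factor_le_one: "\<bar>decay_factor \<delta> N x\<bar> \<le> 1"
  unfolding decay_factor_def abs_prod by (intro prod_le_1) (auto simp: power_abs intro!: power_le_one abs_sn_le_one)

text \<open>Since \<open>sn\<close> is 1-Lipschitz with \<open>sn 0 = 1\<close>, it is at least 1/2
  in each coordinate. This allows division by the factor on a ball.\<close>

lemma decay_factor_lower:
  fixes x :: "real^'d"
  assumes "\<delta> \<ge> 0" "\<delta> * norm x \<le> 1/2"
  shows "decay_factor \<delta> N x \<ge> ((1/2) ^ N) ^ CARD('d)"
proof -
  have "sn (\<delta> * x $ i) \<ge> 1/2" for i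
  proof -
    have "\<bar>\<delta> * x $ i\<bar> \<le> 1/2"
      using assms component_le_norm_cart[of x i] mult_left_mono[of "\<bar>x $ i\<bar>" "norm x" \<delta>] by (simp add: abs_mult)
    moreover have "\<bar>sn (\<delta> * x $ i) - sn 0\<bar> \<le> \<bar>\<delta> * x $ i - 0\<bar>" by (rule sn_lipschitz)
    ultimately show ?thesis by (simp add: sn_def)
  qed
  then have "(\<Prod>i\<in>(UNIV::'d set). (1/2::real) ^ N) \<le> decay_factor \<delta> N x"
    unfolding decay_factor_def by (intro prod_mono) (auto intro!: power_mono)
  then show ?thesis by simp
qed

lemma abs_sn_decay:
  assumes "\<delta> > 0"
  shows "\<bar>sn (\<delta> * x)\<bar> \<le> (1 + 1 / \<delta>) / (1 + \<bar>x\<bar>)"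
proof (cases "x = 0")
  case False
  have "\<bar>x\<bar> * \<bar>sn (\<delta> * x)\<bar> \<le> 1 / \<delta>"
    using assms False by (auto simp: sn_def abs_mult field_simps)
  moreover have "\<bar>sn (\<delta> * x)\<bar> \<le> 1" by (rule abs_sn_le_one)
  ultimately have "(1 + \<bar>x\<bar>) * \<bar>sn (\<delta> * x)\<bar> \<le> 1 + 1 / \<delta>" by (simp add: distrib_right)
  then show ?thesis by (simp add: field_simps)
qed (use assms in \<open>simp add: sn_def\<close>)

text \<open>An integrable majorant, the product of unnormalized Cauchy densities; the product form
  matches the coordinatewise decay of \<open>decay_factor\<close>.\<close>

definition cauchy_weight :: "real^'d \<Rightarrow> real" where
  "cauchy_weight x = (\<Prod>i\<in>UNIV. 1 / (1 + (x $ i)\<^sup>2))"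

lemma cauchy_weight_integrable: "integrable lborel (cauchy_weight :: real^'d \<Rightarrow> real)"
proof -
  have "integrable lborel (\<lambda>x::real. 1 / (1 + x\<^sup>2))"
    using integrable_inverse_1_plus_square by (simp add: set_integrable_def inverse_eq_divide einterval_def)
  then have "has_bochner_integral lborel (\<lambda>x::real. 1 / (1 + x\<^sup>2)) (\<integral>x. 1 / (1 + x\<^sup>2) \<partial>lborel)"
    by (simp add: has_bochner_integral_iff)
  then have "has_bochner_integral lborel (\<lambda>x::real^'d. \<Prod>i\<in>UNIV. 1 / (1 + (x $ i)\<^sup>2))
     (\<Prod>i\<in>(UNIV::'d set). (\<integral>x. 1 / (1 + x\<^sup>2) \<partial>(lborel::real measure)))"
    by (rule has_bochner_integral_lborel_prod)
  then show ?thesis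
    by (simp add: has_bochner_integral_iff cauchy_weight_def[abs_def])
qed

lemma cauchy_weight_nonneg: "cauchy_weight x \<ge> 0"
  unfolding cauchy_weight_def by (intro prod_nonneg) auto

text \<open>Two powers of \<open>1 / (1 + |y|)\<close> in each coordinate pay for the Cauchy weight.
  The square offers \<open>2 * N\<close> powers, so at least \<open>m\<close> remain to cancel
  \<open>norm x ^ m\<close>, the norm being dominated by the product of the
  \<open>1 + |x $ i|\<close>.\<close>

lemma decay_factor_decay:
  fixes x :: "real^'d"
  assumes "\<delta> > 0" and N: "N \<ge> m + 2"
  defines "C \<equiv> ((1 + 1 / \<delta>) ^ (2 * N)) ^ CARD('d)"
  shows "\<bar>decay_factor \<delta> N x\<bar> \<le> C * cauchy_weight x"
    and "(decay_factor \<delta> N x)\<^sup>2 * norm x ^ m \<le> C * cauchy_weight x"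
proof -
  let ?c = "1 + 1 / \<delta>"
  have c: "?c \<ge> 1" using assms by simp
  have w: "1 / (1 + \<bar>y\<bar>) ^ 2 \<le> 1 / (1 + y\<^sup>2)" for y :: real
  proof (rule frac_le)
    show "1 + y\<^sup>2 \<le> (1 + \<bar>y\<bar>)\<^sup>2" by (simp add: power2_sum)
    show "0 < 1 + y\<^sup>2" by (simp add: add_pos_nonneg)
  qed auto
  have C: "C * cauchy_weight x = (\<Prod>i\<in>UNIV. ?c ^ (2 * N) * (1 / (1 + (x $ i)\<^sup>2)))"
    unfolding C_def cauchy_weight_def prod.distrib by simp
  have pw: "\<bar>sn (\<delta> * y)\<bar> ^ k \<le> ?c ^ k * (1 / (1 + \<bar>y\<bar>)) ^ k" for y k
    using power_mono[OF abs_sn_decay[OF assms(1), of y], of k] by (simp add: power_divide power_mult_distrib)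
  show "\<bar>decay_factor \<delta> N x\<bar> \<le> C * cauchy_weight x"
    unfolding C decay_factor_def abs_prod
  proof (intro prod_mono conjI)
    fix i
    have "\<bar>sn (\<delta> * x $ i) ^ N\<bar> \<le> ?c ^ N * (1 / (1 + \<bar>x $ i\<bar>)) ^ N"
      using pw by (simp add: power_abs)
    also have "\<dots> \<le> ?c ^ (2 * N) * (1 / (1 + \<bar>x $ i\<bar>)) ^ 2"
      using c N by (intro mult_mono power_increasing power_decreasing) auto
    also have "\<dots> \<le> ?c ^ (2 * N) * (1 / (1 + (x $ i)\<^sup>2))"
      using c w by (intro mult_left_mono) (auto simp: power_one_over)
    finally show "\<bar>sn (\<delta> * x $ i) ^ N\<bar> \<le> ?c ^ (2 * N) * (1 / (1 + (x $ i)\<^sup>2))" .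
  qed auto
  have "norm x \<le> (\<Prod>i\<in>UNIV. 1 + \<bar>x $ i\<bar>)"
  proof -
    have "norm x \<le> (\<Sum>i\<in>UNIV. \<bar>x $ i\<bar>)" by (rule norm_le_l1_cart)
    also have "\<dots> \<le> (\<Prod>i\<in>UNIV. 1 + \<bar>x $ i\<bar>)" by (rule sum_le_prod) auto
    finally show ?thesis .
  qed
  then have "norm x ^ m \<le> (\<Prod>i\<in>UNIV. 1 + \<bar>x $ i\<bar>) ^ m" by (intro power_mono) auto
  then have "(decay_factor \<delta> N x)\<^sup>2 * norm x ^ m \<le> (decay_factor \<delta> N x)\<^sup>2 * (\<Prod>i\<in>UNIV. 1 + \<bar>x $ i\<bar>) ^ m"
    by (intro mult_left_mono) auto
  also have "\<dots> = (\<Prod>i\<in>UNIV. \<bar>sn (\<delta> * x $ i)\<bar> ^ (2 * N) * (1 + \<bar>x $ i\<bar>) ^ m)"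
    by (simp add: decay_factor_def prod.distrib prod_power_distrib power_mult[symmetric] mult.commute power_even_abs)
  also have "\<dots> \<le> C * cauchy_weight x"
    unfolding C
  proof (intro prod_mono conjI)
    fix i
    let ?z = "1 / (1 + \<bar>x $ i\<bar>)"
    have z: "0 < ?z" "?z \<le> 1" by auto
    have "\<bar>sn (\<delta> * x $ i)\<bar> ^ (2 * N) * (1 + \<bar>x $ i\<bar>) ^ m \<le> (?c ^ (2 * N) * ?z ^ (2 * N)) * (1 + \<bar>x $ i\<bar>) ^ m"
      by (intro mult_right_mono pw) auto
    also have "?z ^ (2 * N) = ?z ^ (2 * N - m) * ?z ^ m"
      using N by (simp add: power_add[symmetric])
    also have "(?c ^ (2 * N) * (?z ^ (2 * N - m) * ?z ^ m)) * (1 + \<bar>x $ i\<bar>) ^ m = ?c ^ (2 * N) * ?z ^ (2 * N - m)"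
      by (simp add: power_one_over)
    also have "\<dots> \<le> ?c ^ (2 * N) * ?z ^ 2"
      using c N z by (intro mult_left_mono power_decreasing) auto
    also have "\<dots> \<le> ?c ^ (2 * N) * (1 / (1 + (x $ i)\<^sup>2))"
      using c w by (intro mult_left_mono) (auto simp: power_one_over)
    finally show "\<bar>sn (\<delta> * x $ i)\<bar> ^ (2 * N) * (1 + \<bar>x $ i\<bar>) ^ m \<le> ?c ^ (2 * N) * (1 / (1 + (x $ i)\<^sup>2))" .
  qed auto
  finally show "(decay_factor \<delta> N x)\<^sup>2 * norm x ^ m \<le> C * cauchy_weight x" .
qed

section \<open>The span of the exponentials\<close>

lemma e_fun_eq: "e_fun t x = iexp (t \<bullet> x) - 1"
  by (simp add: e_fun_def)

lemma continuous_e_fun: "continuous_on A (e_fun t)"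
  unfolding e_fun_def[abs_def] by (intro continuous_intros)

lemma norm_e_fun_le_two: "norm (e_fun t x) \<le> 2"
  unfolding e_fun_eq by (rule order_trans[OF norm_triangle_ineq4]) simp

lemma norm_e_fun_le: "norm (e_fun t x) \<le> norm t * norm x"
proof -
  have "norm (e_fun t x) \<le> \<bar>t \<bullet> x\<bar>"
    using iexp_approx1[of "t \<bullet> x" 0] by (simp add: e_fun_eq)
  also have "\<dots> \<le> norm t * norm x" by (rule Cauchy_Schwarz_ineq2)
  finally show ?thesis .
qed

lemma e_span_continuous: "\<phi> \<in> e_span D \<Longrightarrow> continuous_on A \<phi>"
  unfolding e_span_def by (auto intro!: continuous_intros continuous_on_subset[OF continuous_e_fun[of UNIV]])

lemma e_span_measurable: "\<phi> \<in> e_span D \<Longrightarrow> \<phi> \<in> borel_measurable borel"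
  by (intro borel_measurable_continuous_onI e_span_continuous)

lemma e_span_zero: "\<phi> \<in> e_span D \<Longrightarrow> \<phi> 0 = 0"
  unfolding e_span_def e_fun_def by auto

lemma e_span_bounded:
  assumes "\<phi> \<in> e_span D"
  obtains B where "B > 0" "\<And>x. norm (\<phi> x) \<le> B"
proof -
  obtain S a where S: "\<phi> = (\<lambda>x. \<Sum>t\<in>S. a t * e_fun t x)" using assms by (auto simp: e_span_def)
  have "norm (\<phi> x) \<le> (\<Sum>t\<in>S. norm (a t) * 2) + 1" for x
  proof -
    have "norm (\<phi> x) \<le> (\<Sum>t\<in>S. norm (a t) * 2)"
      unfolding S by (intro sum_norm_le) (auto simp: norm_mult intro!: mult_left_mono norm_e_fun_le_two)
    then show ?thesis by simp
  qed
  moreover have "(\<Sum>t\<in>S. norm (a t) * 2) + 1 > 0" by (intro add_nonneg_pos sum_nonneg) auto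
  ultimately show ?thesis using that by blast
qed

lemma e_span_sum:
  assumes "finite I" "\<And>i. i \<in> I \<Longrightarrow> \<phi> i \<in> e_span D"
  shows "(\<lambda>x. \<Sum>i\<in>I. c i * \<phi> i x) \<in> e_span D"
  using assms
proof (induction I)
  case empty
  show ?case unfolding e_span_def by (intro CollectI exI[of _ "{}"]) auto
next
  case (insert i I)
  from insert.IH insert.prems have "(\<lambda>x. \<Sum>i\<in>I. c i * \<phi> i x) \<in> e_span D" "\<phi> i \<in> e_span D" by auto
  then obtain S a S' a' where 1: "(\<lambda>x. \<Sum>i\<in>I. c i * \<phi> i x) = (\<lambda>x. \<Sum>t\<in>S. a t * e_fun t x)" "finite S" "S \<subseteq> D"
    "\<phi> i = (\<lambda>x. \<Sum>t\<in>S'. a' t * e_fun t x)" "finite S'" "S' \<subseteq> D"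
    unfolding e_span_def by blast
  have "(\<Sum>j\<in>insert i I. c j * \<phi> j x) =
     (\<Sum>t\<in>S \<union> S'. ((if t \<in> S' then c i * a' t else 0) + (if t \<in> S then a t else 0)) * e_fun t x)" for x
  proof -
    have "(\<Sum>j\<in>insert i I. c j * \<phi> j x) = c i * (\<Sum>t\<in>S'. a' t * e_fun t x) + (\<Sum>t\<in>S. a t * e_fun t x)"
      using insert.hyps fun_cong[OF 1(1), of x] fun_cong[OF 1(4), of x] by simp
    also have "(\<Sum>t\<in>S. a t * e_fun t x) = (\<Sum>t\<in>S \<union> S'. (if t \<in> S then a t else 0) * e_fun t x)"
      using 1 by (intro sum.mono_neutral_cong_left) auto
    also have "c i * (\<Sum>t\<in>S'. a' t * e_fun t x) = (\<Sum>t\<in>S \<union> S'. (if t \<in> S' then c i * a' t else 0) * e_fun t x)"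
      unfolding sum_distrib_left using 1 by (intro sum.mono_neutral_cong_left) auto
    finally show ?thesis by (simp add: sum.distrib distrib_right)
  qed
  then show ?case using 1 unfolding e_span_def
    by (intro CollectI exI[of _ "S \<union> S'"] exI[of _ "\<lambda>t. (if t \<in> S' then c i * a' t else 0) + (if t \<in> S then a t else 0)"]) auto
qed

text \<open>The bound |t| |x| is used near the origin and the bound 2 at infinity; together they
  give the weight whose integral is finite for a spectral measure.\<close>

lemma sq_norm_e_fun_le:
  "(norm (e_fun t x))\<^sup>2 \<le> ((norm t)\<^sup>2 + 4) * ((norm x)\<^sup>2 / (1 + (norm x)\<^sup>2))"
proof -
  have 1: "(norm (e_fun t x))\<^sup>2 \<le> 2\<^sup>2" by (intro power_mono norm_e_fun_le_two) auto
  have 2: "(norm (e_fun t x))\<^sup>2 \<le> (norm t * norm x)\<^sup>2" by (intro power_mono norm_e_fun_le) auto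
  have "(norm (e_fun t x))\<^sup>2 * (1 + (norm x)\<^sup>2) \<le> (norm t * norm x)\<^sup>2 + 4 * (norm x)\<^sup>2"
    using add_mono[OF 2 mult_right_mono[OF 1, of "(norm x)\<^sup>2"]] by (simp add: distrib_left)
  also have "\<dots> = ((norm t)\<^sup>2 + 4) * (norm x)\<^sup>2" by (simp add: power_mult_distrib algebra_simps)
  finally show ?thesis
    by (simp add: pos_le_divide_eq add_pos_nonneg)
qed

lemma L2_fun_square_integrable:
  "\<phi> \<in> L2_fun F \<longleftrightarrow> \<phi> \<in> borel_measurable F \<and> (\<integral>\<^sup>+ x. ennreal ((norm (\<phi> x))\<^sup>2) \<partial>F) < \<infinity>"
  by (auto simp: L2_fun_def integrable_iff_bounded)

lemma spectral_e_fun_L2: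
  assumes "spectral_measure F"
  shows "e_fun t \<in> L2_fun F"
proof -
  have s: "sets F = sets borel" and f: "(\<integral>\<^sup>+ x. ennreal ((norm x)\<^sup>2 / (1 + (norm x)\<^sup>2)) \<partial>F) < \<infinity>"
    using assms by (auto simp: spectral_measure_def)
  have [measurable]: "e_fun t \<in> borel_measurable borel"
    by (intro borel_measurable_continuous_onI continuous_e_fun)
  have m: "e_fun t \<in> borel_measurable F" using s by (simp cong: measurable_cong_sets)
  have "(\<integral>\<^sup>+ x. ennreal ((norm (e_fun t x))\<^sup>2) \<partial>F) \<le>
    (\<integral>\<^sup>+ x. ennreal ((norm t)\<^sup>2 + 4) * ennreal ((norm x)\<^sup>2 / (1 + (norm x)\<^sup>2)) \<partial>F)"
    by (intro nn_integral_mono) (simp add: ennreal_mult[symmetric] ennreal_leI sq_norm_e_fun_le del: ennreal_plus times_divide_eq_right)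
  also have "\<dots> = ennreal ((norm t)\<^sup>2 + 4) * (\<integral>\<^sup>+ x. ennreal ((norm x)\<^sup>2 / (1 + (norm x)\<^sup>2)) \<partial>F)"
    using s by (intro nn_integral_cmult) (simp cong: measurable_cong_sets)
  also have "\<dots> < \<infinity>" using f by (simp add: ennreal_mult_less_top del: ennreal_plus)
  finally show ?thesis using m by (simp add: L2_fun_square_integrable)
qed

lemma L2_mult_integrable:
  assumes "\<phi> \<in> L2_fun F" "\<psi> \<in> L2_fun F"
  shows "integrable F (\<lambda>x. \<phi> x * cnj (\<psi> x))"
proof (rule Bochner_Integration.integrable_bound)
  show "integrable F (\<lambda>x. (norm (\<phi> x))\<^sup>2 + (norm (\<psi> x))\<^sup>2)"
    using assms by (auto simp: L2_fun_def)
  show "(\<lambda>x. \<phi> x * cnj (\<psi> x)) \<in> borel_measurable F"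
    using assms by (auto simp: L2_fun_def intro!: borel_measurable_times
      measurable_compose[OF _ borel_measurable_continuous_onI[OF continuous_on_cnj[OF continuous_on_id]]])
  have "a * b \<le> a\<^sup>2 + b\<^sup>2" if "a \<ge> 0" "b \<ge> 0" for a b :: real
    using sum_squares_bound[of a b] that mult_nonneg_nonneg[OF that] by linarith
  then show "AE x in F. norm (\<phi> x * cnj (\<psi> x)) \<le> norm ((norm (\<phi> x))\<^sup>2 + (norm (\<psi> x))\<^sup>2)"
    by (simp add: norm_mult)
qed

lemma L2_fun_sum:
  assumes "finite I" "\<And>i. i \<in> I \<Longrightarrow> \<phi> i \<in> L2_fun F"
  shows "(\<lambda>x. \<Sum>i\<in>I. c i * \<phi> i x) \<in> L2_fun F"
proof -
  have m: "(\<lambda>x. \<Sum>i\<in>I. c i * \<phi> i x) \<in> borel_measurable F"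
    using assms by (intro borel_measurable_sum borel_measurable_times) (auto simp: L2_fun_def)
  have eq: "complex_of_real ((norm (\<Sum>i\<in>I. c i * \<phi> i x))\<^sup>2) = (\<Sum>i\<in>I. \<Sum>j\<in>I. (c i * cnj (c j)) * (\<phi> i x * cnj (\<phi> j x)))" for x
    unfolding complex_norm_square by (simp add: sum_product mult_ac)
  have "integrable F (\<lambda>x. complex_of_real ((norm (\<Sum>i\<in>I. c i * \<phi> i x))\<^sup>2))"
    unfolding eq by (intro Bochner_Integration.integrable_sum integrable_mult_right L2_mult_integrable assms)
  then have "integrable F (\<lambda>x. Re (complex_of_real ((norm (\<Sum>i\<in>I. c i * \<phi> i x))\<^sup>2)))"
    by (rule integrable_Re)
  with m show ?thesis by (simp add: L2_fun_def)
qed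

lemma e_span_L2:
  assumes "spectral_measure F" "\<phi> \<in> e_span D" shows "\<phi> \<in> L2_fun F"
proof -
  obtain S a where S: "\<phi> = (\<lambda>x. \<Sum>t\<in>S. a t * e_fun t x)" "finite S" using assms by (auto simp: e_span_def)
  show ?thesis unfolding S by (intro L2_fun_sum spectral_e_fun_L2 assms S)
qed

lemma L2_inner_self: "L2_inner F \<phi> \<phi> = complex_of_real (\<integral>x. (norm (\<phi> x))\<^sup>2 \<partial>F)"
  unfolding L2_inner_def complex_norm_square[symmetric] by (simp del: of_real_power)

lemma L2_norm_sq: "(L2_norm F \<phi>)\<^sup>2 = (\<integral>x. (norm (\<phi> x))\<^sup>2 \<partial>F)"
  unfolding L2_norm_def L2_inner_self by simp

lemma L2_norm_nonneg: "L2_norm F \<phi> \<ge> 0"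
  unfolding L2_norm_def L2_inner_self by simp

lemma L2_norm_sq_nn:
  assumes "\<phi> \<in> L2_fun F"
  shows "(\<integral>\<^sup>+ x. ennreal ((norm (\<phi> x))\<^sup>2) \<partial>F) = ennreal ((L2_norm F \<phi>)\<^sup>2)"
  unfolding L2_norm_sq using assms by (intro nn_integral_eq_integral) (auto simp: L2_fun_def)

lemma e_span_reproduced:
  assumes \<phi>: "\<phi> \<in> e_span (Pi_cube T)" and a: "\<delta> \<ge> 0" "T + real N * \<delta> \<le> a" "T \<ge> 0"
  shows "has_bochner_integral lborel
     (\<lambda>x. \<phi> x * complex_of_real (decay_factor \<delta> N x * vp_kernel_vec a (l - x)))
     (\<phi> l * complex_of_real (decay_factor \<delta> N l))"
proof -
  obtain S c where S: "\<phi> = (\<lambda>x. \<Sum>t\<in>S. c t * e_fun t x)" "finite S" "S \<subseteq> Pi_cube T" using \<phi> by (auto simp: e_span_def)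
  have a0: "a \<ge> 0" using a by (metis add_nonneg_nonneg mult_nonneg_nonneg of_nat_0_le_iff order_trans)
  have i: "has_bochner_integral lborel
     (\<lambda>x. iexp (t \<bullet> x) * complex_of_real (decay_factor \<delta> N x * vp_kernel_vec a (l - x)))
     (iexp (t \<bullet> l) * complex_of_real (decay_factor \<delta> N l))" if "t \<in> Pi_cube T" for t
  proof (rule vp_kernel_vec_reproduces_iexp[OF a0 a(1)])
    fix i
    have "\<bar>t $ i\<bar> \<le> T" using that by (auto simp: Pi_cube_def mem_box_cart abs_le_iff) (metis minus_le_iff)
    then show "\<bar>t $ i\<bar> + real N * \<delta> \<le> a" using a by linarith
  qed
  \<comment> \<open>The summand \<open>- 1\<close> of each \<open>e_fun\<close> is an exponential of
    frequency 0, which lies in the cube, so the same kernel reproduces it.\<close>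
  have "0 \<in> Pi_cube T" using a by (auto simp: Pi_cube_def mem_box_cart)
  note i0 = i[OF this, simplified]
  have "has_bochner_integral lborel
     (\<lambda>x. \<Sum>t\<in>S. c t * (iexp (t \<bullet> x) * complex_of_real (decay_factor \<delta> N x * vp_kernel_vec a (l - x)) -
         complex_of_real (decay_factor \<delta> N x) * complex_of_real (vp_kernel_vec a (l - x))))
     (\<Sum>t\<in>S. c t * (iexp (t \<bullet> l) * complex_of_real (decay_factor \<delta> N l) - complex_of_real (decay_factor \<delta> N l)))"
    by (intro has_bochner_integral_sum has_bochner_integral_mult_right has_bochner_integral_diff i i0) (use S in auto)
  then show ?thesis
    unfolding S e_fun_eq by (simp add: sum_distrib_right sum_distrib_left right_diff_distrib left_diff_distrib mult_ac)
qed

text \<open>The sublevel sets for \<open>1 / Suc n\<close> decrease to a subset of the null set {0};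
  continuity from above applies because the ball has finite measure.\<close>

lemma small_density_set:
  fixes f :: "real^'d \<Rightarrow> real"
  assumes [measurable]: "f \<in> borel_measurable borel" and pos: "\<And>x. x \<noteq> 0 \<Longrightarrow> f x > 0" and \<kappa>: "\<kappa> > 0"
  obtains \<epsilon> where "\<epsilon> > 0" "measure lborel {x \<in> cball 0 R. f x < \<epsilon>} < \<kappa>"
proof -
  define A where "A n = {x \<in> cball 0 R. f x < 1 / real (Suc n)}" for n
  have Am[measurable]: "A n \<in> sets lborel" for n
    unfolding A_def by measurable
  have fin: "emeasure lborel (A n) < \<infinity>" for n
  proof -
    have "emeasure lborel (A n) \<le> emeasure lborel (cball (0::real^'d) R)"
      unfolding A_def by (intro emeasure_mono) auto
    also have "\<dots> < \<infinity>" by (rule emeasure_lborel_cball_finite)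
    finally show ?thesis .
  qed
  have "decseq A"
    unfolding A_def decseq_def by (auto elim!: less_le_trans intro!: divide_left_mono)
  then have "(\<lambda>n. emeasure lborel (A n)) \<longlonglongrightarrow> emeasure lborel (\<Inter>n. A n)"
    using fin Am by (intro Lim_emeasure_decseq) (auto simp: less_top)
  moreover have "(\<Inter>n. A n) \<subseteq> {0}"
  proof
    fix x assume x: "x \<in> (\<Inter>n. A n)"
    show "x \<in> {0}"
    proof (rule ccontr)
      assume "x \<notin> {0}"
      then have "f x > 0" using pos by simp
      then obtain n where "inverse (real (Suc n)) < f x" using reals_Archimedean by blast
      then show False using x by (auto simp: A_def inverse_eq_divide dest!: spec[of _ n])
    qed
  qed
  then have "emeasure lborel (\<Inter>n. A n) = 0"
    by (metis emeasure_lborel_countable countable_finite finite.emptyI finite_insert finite_subset)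
  ultimately have "(\<lambda>n. emeasure lborel (A n)) \<longlonglongrightarrow> 0" by simp
  then have "eventually (\<lambda>n. emeasure lborel (A n) < ennreal \<kappa>) sequentially"
    using \<kappa> by (intro order_tendstoD) auto
  then obtain n where "emeasure lborel (A n) < ennreal \<kappa>" by (auto simp: eventually_sequentially)
  then have "measure lborel (A n) < \<kappa>"
    using fin[of n] by (simp add: emeasure_eq_ennreal_measure less_top[symmetric] ennreal_less_iff)
  then show ?thesis using that[of "1 / real (Suc n)"] by (simp add: A_def)
qed

section \<open>Pointwise bounds on compact sets\<close>

lemma cauchy_weight_measurable [measurable]: "cauchy_weight \<in> borel_measurable borel"
  unfolding cauchy_weight_def by measurable

text \<open>Let \<open>I\<close> be the integral of |\<phi>| |G|. The convolution formula bounds the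
  maximum \<open>M\<close> of |\<phi>| on a large ball by a multiple of \<open>I\<close>, while
  \<open>I\<close> is at most a small multiple of \<open>M\<close> plus, by Cauchy-Schwarz, a
  multiple of the norm. Eliminating \<open>M\<close> bounds \<open>I\<close>, and the formula at
  \<open>x\<close> minus that at 0 gives the factor |x|.\<close>

lemma e_span_local_bound:
  fixes f :: "real^'d \<Rightarrow> real"
  assumes T: "T \<ge> 0" and F: "F = density lborel (\<lambda>x. ennreal (f x))" "spectral_measure F"
    and fm[measurable]: "f \<in> borel_measurable borel" and pos: "\<And>x. x \<noteq> 0 \<Longrightarrow> f x > 0"
    and c: "c > 0" and low: "\<And>x. norm x > k0 \<Longrightarrow> f x \<ge> c * norm x powr (- \<eta>)"
  shows "\<exists>C\<ge>0. \<forall>\<phi>\<in>e_span (Pi_cube T). \<forall>x\<in>cball 0 R. norm (\<phi> x) \<le> C * norm x * L2_norm F \<phi>"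
proof -
  \<comment> \<open>Large enough to contain the given ball and the region where the power lower
    bound for \<open>f\<close> may fail; the 1 ensures that outside it powers of the norm grow with
    the exponent.\<close>
  define R' where "R' = max R (max k0 1)"
  \<comment> \<open>Keeps \<open>\<delta> * norm x\<close> at most 1/2 on the ball of radius
    \<open>R'\<close>, where \<open>decay_factor_lower\<close> is to apply.\<close>
  define \<delta> where "\<delta> = 1 / (2 * R')"
  define m where "m = nat \<lceil>\<eta>\<rceil>"
  define N where "N = m + 2"
  \<comment> \<open>Half the side of the cube plus the widening of the frequency range by the
    factor.\<close>
  define a where "a = T + real N * \<delta>"
  define g0 :: real where "g0 = ((1/2) ^ N) ^ CARD('d)"
  define v where "v = (a + 1) ^ CARD('d)"
  define L where "L = (a + 1) ^ CARD('d) * (CARD('d) * (a + 1))"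
  define G where "G = (decay_factor \<delta> N :: real^'d \<Rightarrow> real)"
  define V where "V = (vp_kernel_vec a :: real^'d \<Rightarrow> real)"
  define Cd where "Cd = ((1 + 1 / \<delta>) ^ (2 * N)) ^ CARD('d)"
  have R': "R' \<ge> R" "R' \<ge> k0" "R' \<ge> 1" by (auto simp: R'_def)
  have \<delta>: "\<delta> > 0" using R' by (simp add: \<delta>_def)
  have a: "a \<ge> 0" using T \<delta> by (simp add: a_def)
  have g0: "g0 > 0" by (simp add: g0_def)
  have v: "v > 0" using a by (simp add: v_def)
  have L: "L \<ge> 0" using a by (simp add: L_def)
  have Cd: "Cd > 0" using \<delta> by (simp add: Cd_def add_pos_pos)
  have Gm[measurable]: "G \<in> borel_measurable borel" and Vm[measurable]: "V \<in> borel_measurable borel"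
    unfolding G_def V_def by measurable
  have G1: "\<bar>G x\<bar> \<le> 1" for x unfolding G_def by (rule abs_decay_factor_le_one)
  have Glow: "G x \<ge> g0" if "norm x \<le> R'" for x
    unfolding G_def g0_def using that \<delta> R' by (intro decay_factor_lower) (auto simp: \<delta>_def field_simps)
  have Gd: "\<bar>G x\<bar> \<le> Cd * cauchy_weight x" "(G x)\<^sup>2 * norm x ^ m \<le> Cd * cauchy_weight x" for x
    unfolding G_def Cd_def using decay_factor_decay[OF \<delta>, of m N] by (auto simp: N_def)
  have Vb: "\<bar>V x\<bar> \<le> v" for x unfolding V_def v_def by (rule vp_kernel_vec_bounded[OF a])
  have VL: "\<bar>V x - V y\<bar> \<le> L * norm (x - y)" for x y
    unfolding V_def L_def by (rule vp_kernel_vec_lipschitz[OF a])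
  have Gi: "integrable lborel G"
    by (rule Bochner_Integration.integrable_bound[OF integrable_mult_right[OF cauchy_weight_integrable, of Cd]])
       (use Gd(1) Cd in \<open>auto simp: cauchy_weight_nonneg\<close>)
  have "g0 / (2 * v) > 0" using g0 v by simp
  then obtain \<epsilon> where \<epsilon>: "\<epsilon> > 0" "measure lborel {x \<in> cball 0 R'. f x < \<epsilon>} < g0 / (2 * v)"
    using small_density_set[OF fm pos] by metis
  \<comment> \<open>The measure of \<open>B\<close> is so small that \<open>B\<close> accounts for at most half the supremum of a function.\<close>
  define B where "B = {x \<in> cball 0 R'. f x < \<epsilon>}"
  have Bm[measurable]: "B \<in> sets borel" unfolding B_def by measurable
  have Bfin: "emeasure lborel B < \<infinity>"
  proof -
    have "emeasure lborel B \<le> emeasure lborel (cball (0::real^'d) R')"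
      unfolding B_def by (intro emeasure_mono) auto
    also have "\<dots> < \<infinity>" by (rule emeasure_lborel_cball_finite)
    finally show ?thesis .
  qed
  define D where "D = Cd * (1 / \<epsilon> + 1 / c)"
  have D: "D \<ge> 0" using Cd \<epsilon> c by (simp add: D_def)
  \<comment> \<open>Off \<open>B\<close> the quotient of the square of \<open>G\<close> by
    \<open>f\<close> has an integrable majorant: on the ball \<open>f\<close> is at least
    \<epsilon>, and beyond it the decay of \<open>G\<close> beats the power in the lower bound for
    \<open>f\<close>.\<close>
  have GD: "(G x)\<^sup>2 \<le> D * cauchy_weight x * f x" if x: "x \<notin> B" "x \<noteq> 0" for x
  proof (cases "norm x \<le> R'")
    case True
    then have "f x \<ge> \<epsilon>" using x by (auto simp: B_def)
    then have "1 \<le> (1 / \<epsilon>) * f x" using \<epsilon> by (simp add: field_simps)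
    also have "\<dots> \<le> (1 / \<epsilon> + 1 / c) * f x" using c pos[OF x(2)] by (intro mult_right_mono) auto
    finally have 1: "1 \<le> (1 / \<epsilon> + 1 / c) * f x" .
    have "(G x)\<^sup>2 = \<bar>G x\<bar> * \<bar>G x\<bar>" by (simp add: power2_eq_square)
    also have "\<dots> \<le> \<bar>G x\<bar> * 1" by (intro mult_left_mono G1) auto
    also have "\<dots> \<le> Cd * cauchy_weight x * 1" using Gd(1) by simp
    also have "\<dots> \<le> Cd * cauchy_weight x * ((1 / \<epsilon> + 1 / c) * f x)"
      by (rule mult_left_mono) (use 1 Cd cauchy_weight_nonneg[of x] in auto)
    finally show ?thesis by (simp add: D_def mult_ac)
  next
    case False
    then have nx: "norm x > k0" "norm x \<ge> 1" using R' by auto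
    have "c \<le> norm x powr \<eta> * f x"
    proof -
      have "c = norm x powr \<eta> * (c * norm x powr (- \<eta>))"
        using nx x(2) by (simp add: powr_minus field_simps)
      also have "\<dots> \<le> norm x powr \<eta> * f x" using low[OF nx(1)] by (intro mult_left_mono) auto
      finally show ?thesis .
    qed
    also have "\<dots> \<le> norm x ^ m * f x"
    proof (intro mult_right_mono)
      have "norm x powr \<eta> \<le> norm x powr real m"
        using nx by (intro powr_mono) (auto simp: m_def real_nat_ceiling_ge)
      then show "norm x powr \<eta> \<le> norm x ^ m" using powr_realpow[of "norm x" m] x(2) by simp
    qed (use pos[OF x(2)] in auto)
    finally have "(G x)\<^sup>2 * c \<le> (G x)\<^sup>2 * (norm x ^ m * f x)" by (intro mult_left_mono) auto
    also have "\<dots> \<le> (Cd * cauchy_weight x) * f x"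
      unfolding mult.assoc[symmetric] using pos[OF x(2)] Gd(2) by (intro mult_right_mono) auto
    finally have "(G x)\<^sup>2 \<le> (Cd * (1 / c)) * cauchy_weight x * f x" using c by (simp add: field_simps)
    also have "\<dots> \<le> D * cauchy_weight x * f x"
      unfolding D_def using Cd \<epsilon> pos[OF x(2)] cauchy_weight_nonneg by (intro mult_right_mono mult_left_mono) auto
    finally show ?thesis .
  qed
  define h where "h = (\<integral>x. cauchy_weight x \<partial>(lborel :: (real^'d) measure))"
  have h: "h \<ge> 0" unfolding h_def by (intro integral_nonneg_AE) (simp add: cauchy_weight_nonneg)
  define Q where "Q = sqrt (D * h)"
  have Q: "Q \<ge> 0" using D h by (simp add: Q_def)
  have main: "norm (\<phi> x) \<le> (L * (2 * Q) / g0) * norm x * L2_norm F \<phi>"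
    if \<phi>: "\<phi> \<in> e_span (Pi_cube T)" and x: "x \<in> cball 0 R" for \<phi> x
  proof -
    define N0 where "N0 = L2_norm F \<phi>"
    have N0: "N0 \<ge> 0" unfolding N0_def by (rule L2_norm_nonneg)
    have [measurable]: "\<phi> \<in> borel_measurable borel" by (rule e_span_measurable[OF \<phi>])
    obtain b where b: "b > 0" "\<And>x. norm (\<phi> x) \<le> b" using e_span_bounded[OF \<phi>] by metis
    define I where "I = (\<integral>x. norm (\<phi> x) * \<bar>G x\<bar> \<partial>lborel)"
    have Ii: "integrable lborel (\<lambda>x. norm (\<phi> x) * \<bar>G x\<bar>)"
      by (rule Bochner_Integration.integrable_bound[OF integrable_mult_right[OF integrable_abs[OF Gi], of b]])
         (use b in \<open>auto simp: abs_mult intro!: mult_right_mono\<close>)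
    have rep: "has_bochner_integral lborel (\<lambda>x. \<phi> x * complex_of_real (G x * V (l - x))) (\<phi> l * complex_of_real (G l))" for l
      unfolding G_def V_def by (rule e_span_reproduced[OF \<phi>]) (use \<delta> T in \<open>auto simp: a_def\<close>)
    have sup_bound: "norm (\<phi> l) * g0 \<le> v * I" if "norm l \<le> R'" for l
    proof -
      have "norm (\<phi> l) * g0 \<le> norm (\<phi> l) * \<bar>G l\<bar>"
        using Glow[OF that] by (intro mult_left_mono) auto
      also have "\<dots> = norm (\<integral>x. \<phi> x * complex_of_real (G x * V (l - x)) \<partial>lborel)"
        using rep[of l] by (simp add: has_bochner_integral_iff norm_mult)
      also have "\<dots> \<le> (\<integral>x. v * (norm (\<phi> x) * \<bar>G x\<bar>) \<partial>lborel)"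
      proof (rule Bochner_Integration.integral_norm_bound_integral)
        fix x
        have "norm (\<phi> x * complex_of_real (G x * V (l - x))) = (norm (\<phi> x) * \<bar>G x\<bar>) * \<bar>V (l - x)\<bar>"
          by (simp add: norm_mult abs_mult)
        also have "\<dots> \<le> (norm (\<phi> x) * \<bar>G x\<bar>) * v" by (intro mult_left_mono Vb) auto
        finally show "norm (\<phi> x * complex_of_real (G x * V (l - x))) \<le> v * (norm (\<phi> x) * \<bar>G x\<bar>)"
          by (simp add: mult.commute)
      qed (use rep[of l] Ii in \<open>auto simp: has_bochner_integral_iff\<close>)
      also have "\<dots> = v * I" by (simp add: I_def)
      finally show ?thesis .
    qed
    \<comment> \<open>The maximum is attained and therefore finite, which is what allows it to be
      absorbed.\<close>
    have "compact (cball (0::real^'d) R')" "cball (0::real^'d) R' \<noteq> {}" using R' by auto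
    moreover have "continuous_on (cball 0 R') (\<lambda>x. norm (\<phi> x))"
      by (intro continuous_on_norm e_span_continuous[OF \<phi>])
    ultimately obtain x0 where x0: "x0 \<in> cball 0 R'" "\<And>y. y \<in> cball 0 R' \<Longrightarrow> norm (\<phi> y) \<le> norm (\<phi> x0)"
      using continuous_attains_sup by metis
    define M where "M = norm (\<phi> x0)"
    \<comment> \<open>Off \<open>B\<close> the product of \<open>p\<close> and \<open>q\<close>
      dominates |\<phi>| |G|. The L^2 norm of \<open>p\<close> for Lebesgue measure is that of
      \<phi> for \<open>F\<close>, and \<open>q\<close> does not depend on \<phi>.\<close>
    define p where "p x = ennreal (norm (\<phi> x) * sqrt (f x))" for x
    define q where "q x = ennreal (sqrt (D * cauchy_weight x))" for x :: "real^'d"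
    have [measurable]: "p \<in> borel_measurable borel" "q \<in> borel_measurable borel"
      unfolding p_def q_def by measurable
    have ne0: "AE x in lborel. x \<noteq> (0::real^'d)" by (rule AE_lborel_singleton)
    have p2: "(\<integral>\<^sup>+x. (p x)\<^sup>2 \<partial>lborel) = ennreal (N0\<^sup>2)"
    proof -
      have "(\<integral>\<^sup>+x. (p x)\<^sup>2 \<partial>lborel) = (\<integral>\<^sup>+x. ennreal (f x) * ennreal ((norm (\<phi> x))\<^sup>2) \<partial>lborel)"
      proof (rule nn_integral_cong_AE)
        show "AE x in lborel. (p x)\<^sup>2 = ennreal (f x) * ennreal ((norm (\<phi> x))\<^sup>2)"
          using ne0
        proof eventually_elim
          case (elim x)
          then have "f x > 0" by (rule pos)
          then show ?case
            by (simp add: p_def ennreal_power ennreal_mult[symmetric] power_mult_distrib mult.commute)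
        qed
      qed
      also have "\<dots> = (\<integral>\<^sup>+x. ennreal ((norm (\<phi> x))\<^sup>2) \<partial>F)"
        unfolding F(1) by (rule nn_integral_density[symmetric]) measurable
      also have "\<dots> = ennreal (N0\<^sup>2)"
        unfolding N0_def by (rule L2_norm_sq_nn[OF e_span_L2[OF F(2) \<phi>]])
      finally show ?thesis .
    qed
    have q2: "(\<integral>\<^sup>+x. (q x)\<^sup>2 \<partial>lborel) = ennreal (D * h)"
    proof -
      have "(\<integral>\<^sup>+x. (q x)\<^sup>2 \<partial>lborel) = (\<integral>\<^sup>+x. ennreal (D * cauchy_weight x) \<partial>(lborel :: (real^'d) measure))"
        using D by (intro nn_integral_cong) (simp add: q_def ennreal_power cauchy_weight_nonneg)
      also have "\<dots> = ennreal (\<integral>x. D * cauchy_weight x \<partial>(lborel :: (real^'d) measure))"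
        using D by (intro nn_integral_eq_integral integrable_mult_right cauchy_weight_integrable) (simp add: cauchy_weight_nonneg)
      finally show ?thesis by (simp add: h_def)
    qed
    have pq: "(\<integral>\<^sup>+x. p x * q x \<partial>lborel) \<le> ennreal (N0 * Q)"
    proof -
      have "(\<integral>\<^sup>+x. p x * q x \<partial>lborel)\<^sup>2 \<le> (\<integral>\<^sup>+x. (p x)\<^sup>2 \<partial>lborel) * (\<integral>\<^sup>+x. (q x)\<^sup>2 \<partial>lborel)"
        by (rule Cauchy_Schwarz_nn_integral) auto
      also have "\<dots> = (ennreal (N0 * Q))\<^sup>2"
        unfolding p2 q2 using N0 D h by (simp add: ennreal_mult[symmetric] ennreal_power Q_def power_mult_distrib)
      finally have *: "(\<integral>\<^sup>+x. p x * q x \<partial>lborel)\<^sup>2 \<le> (ennreal (N0 * Q))\<^sup>2" .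
      show ?thesis
      proof (cases "\<integral>\<^sup>+x. p x * q x \<partial>lborel" rule: ennreal_cases)
        case (real r)
        then have "r\<^sup>2 \<le> (N0 * Q)\<^sup>2" using * N0 Q by (simp add: ennreal_power)
        then have "r \<le> N0 * Q" by (rule power2_le_imp_le) (use N0 Q in simp)
        then show ?thesis using real by (simp add: ennreal_leI)
      next
        case top
        then show ?thesis using * N0 Q by (simp add: ennreal_power ennreal_mult_eq_top_iff power2_eq_square top_unique)
      qed
    qed
    have "ennreal I = (\<integral>\<^sup>+x. ennreal (norm (\<phi> x) * \<bar>G x\<bar>) \<partial>lborel)"
      unfolding I_def by (rule nn_integral_eq_integral[symmetric, OF Ii]) simp
    also have "\<dots> \<le> (\<integral>\<^sup>+x. ennreal M * indicator B x + p x * q x \<partial>lborel)"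
    proof (rule nn_integral_mono_AE)
      show "AE x in lborel. ennreal (norm (\<phi> x) * \<bar>G x\<bar>) \<le> ennreal M * indicator B x + p x * q x"
        using ne0
      proof eventually_elim
        case (elim x)
        show ?case
        proof (cases "x \<in> B")
          case True
          then have "norm (\<phi> x) * \<bar>G x\<bar> \<le> M * 1"
            unfolding M_def using x0 by (intro mult_mono G1) (auto simp: B_def)
          then show ?thesis using True by (auto intro!: add_increasing2 ennreal_leI)
        next
          case False
          have "\<bar>G x\<bar> \<le> sqrt (D * cauchy_weight x * f x)"
            using GD[OF False elim] by (intro real_le_rsqrt) simp
          then have "norm (\<phi> x) * \<bar>G x\<bar> \<le> norm (\<phi> x) * (sqrt (f x) * sqrt (D * cauchy_weight x))"
            by (intro mult_left_mono) (auto simp: real_sqrt_mult mult.commute)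
          then show ?thesis using False D pos[OF elim]
            by (simp add: p_def q_def ennreal_mult[symmetric] cauchy_weight_nonneg mult.assoc ennreal_leI)
        qed
      qed
    qed
    also have "\<dots> = ennreal M * emeasure lborel B + (\<integral>\<^sup>+x. p x * q x \<partial>lborel)"
      by (subst nn_integral_add) (auto simp: nn_integral_cmult_indicator)
    also have "\<dots> \<le> ennreal M * ennreal (measure lborel B) + ennreal (N0 * Q)"
      using pq Bfin by (intro add_mono) (auto simp: emeasure_eq_ennreal_measure less_top)
    also have "\<dots> = ennreal (M * measure lborel B + N0 * Q)"
      using N0 Q by (simp add: ennreal_mult[symmetric] M_def)
    finally have I1: "I \<le> M * measure lborel B + N0 * Q"
      using N0 Q by (subst (asm) ennreal_le_iff) (auto simp: M_def)
    have mB: "measure lborel B \<le> g0 / (2 * v)" using \<epsilon> by (simp add: B_def)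
    have "M * g0 \<le> v * I" unfolding M_def using sup_bound x0(1) by auto
    also have I3: "I \<le> M * (g0 / (2 * v)) + N0 * Q"
      using I1 mult_left_mono[OF mB, of M] by (simp add: M_def)
    finally have "M * g0 \<le> v * (M * (g0 / (2 * v)) + N0 * Q)" using v by simp
    also have "\<dots> = M * g0 / 2 + v * (N0 * Q)" using v by (simp add: distrib_left)
    \<comment> \<open>The bound on the measure of \<open>B\<close> makes its share at most half of
      the left-hand side, so it can be subtracted.\<close>
    finally have "M * g0 / (2 * v) \<le> N0 * Q" using v by (simp add: field_simps)
    with I3 have "I \<le> 2 * (N0 * Q)" unfolding times_divide_eq_right by linarith
    then have I2: "I \<le> 2 * Q * N0" by (simp only: mult_ac)
    have xR: "norm x \<le> R'" using x R' by auto
    have "norm (\<phi> x) * g0 \<le> norm (\<phi> x) * \<bar>G x\<bar>"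
      using Glow[OF xR] by (intro mult_left_mono) auto
    \<comment> \<open>Subtracting the formula at 0 changes nothing, as \<phi> vanishes there, but
      brings in a difference of kernel values.\<close>
    also have "\<dots> = norm (\<phi> x * complex_of_real (G x) - \<phi> 0 * complex_of_real (G 0))"
      using e_span_zero[OF \<phi>] by (simp add: norm_mult)
    also have "\<dots> = norm (\<integral>y. \<phi> y * complex_of_real (G y * V (x - y)) - \<phi> y * complex_of_real (G y * V (0 - y)) \<partial>lborel)"
      using has_bochner_integral_diff[OF rep[of x] rep[of 0]] by (simp add: has_bochner_integral_iff)
    also have "\<dots> \<le> (\<integral>y. (L * norm x) * (norm (\<phi> y) * \<bar>G y\<bar>) \<partial>lborel)"
    proof (rule Bochner_Integration.integral_norm_bound_integral)
      fix y
      have "\<phi> y * complex_of_real (G y * V (x - y)) - \<phi> y * complex_of_real (G y * V (0 - y)) =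
         \<phi> y * complex_of_real (G y * (V (x - y) - V (0 - y)))" by (simp add: algebra_simps)
      then have "norm (\<phi> y * complex_of_real (G y * V (x - y)) - \<phi> y * complex_of_real (G y * V (0 - y))) =
         (norm (\<phi> y) * \<bar>G y\<bar>) * \<bar>V (x - y) - V (0 - y)\<bar>" by (simp only: norm_mult abs_mult norm_of_real mult.assoc)
      also have "\<dots> \<le> (norm (\<phi> y) * \<bar>G y\<bar>) * (L * norm x)"
        using VL[of "x - y" "0 - y"] by (intro mult_left_mono) auto
      finally show "norm (\<phi> y * complex_of_real (G y * V (x - y)) - \<phi> y * complex_of_real (G y * V (0 - y)))
         \<le> (L * norm x) * (norm (\<phi> y) * \<bar>G y\<bar>)" by (simp only: mult.commute)
    qed (use rep[of x] rep[of 0] Ii in \<open>auto simp: has_bochner_integral_iff\<close>)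
    also have "\<dots> = (L * norm x) * I" by (simp add: I_def)
    also have "\<dots> \<le> (L * norm x) * (2 * Q * N0)" using L I2 by (intro mult_left_mono) auto
    finally show ?thesis using g0 by (simp add: field_simps N0_def)
  qed
  show ?thesis
    by (intro exI[of _ "L * (2 * Q) / g0"] conjI ballI main) (use L Q g0 in auto)
qed

section \<open>Simultaneous diagonalization\<close>

text \<open>Coefficient vectors are total functions of which only the values on \<open>S\<close>
  matter, so the linearity rules need no carrier.\<close>

definition quad_form :: "'i set \<Rightarrow> ('i \<Rightarrow> 'i \<Rightarrow> real) \<Rightarrow> ('i \<Rightarrow> real) \<Rightarrow> ('i \<Rightarrow> real) \<Rightarrow> real" where
  "quad_form S R a b = (\<Sum>s\<in>S. \<Sum>t\<in>S. a s * b t * R s t)"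

lemma quad_form_add_left: "quad_form S R (\<lambda>s. a s + a' s) b = quad_form S R a b + quad_form S R a' b"
  by (simp add: quad_form_def sum.distrib distrib_right)

lemma quad_form_add_right: "quad_form S R a (\<lambda>s. b s + b' s) = quad_form S R a b + quad_form S R a b'"
  by (simp add: quad_form_def sum.distrib distrib_right distrib_left)

lemma quad_form_scale_left: "quad_form S R (\<lambda>s. c * a s) b = c * quad_form S R a b"
  by (simp add: quad_form_def sum_distrib_left mult.assoc)

lemma quad_form_scale_right: "quad_form S R a (\<lambda>s. c * b s) = c * quad_form S R a b"
  by (simp add: quad_form_def sum_distrib_left mult_ac)

lemma quad_form_zero_left: "quad_form S R (\<lambda>s. 0) b = 0"
  by (simp add: quad_form_def)

lemma quad_form_sum_left: "quad_form S R (\<lambda>s. \<Sum>k\<in>K. x k * u k s) b = (\<Sum>k\<in>K. x k * quad_form S R (u k) b)"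
proof (cases "finite K")
  case True
  then show ?thesis
    by (induction K) (simp_all add: quad_form_zero_left quad_form_add_left quad_form_scale_left)
qed (simp add: quad_form_def)

lemma quad_form_commute:
  assumes "\<And>s t. s \<in> S \<Longrightarrow> t \<in> S \<Longrightarrow> R s t = R t s"
  shows "quad_form S R a b = quad_form S R b a"
  unfolding quad_form_def by (subst sum.swap) (auto intro!: sum.cong simp: assms mult_ac)

lemma quad_form_sum_right: "quad_form S R a (\<lambda>s. \<Sum>k\<in>K. x k * u k s) = (\<Sum>k\<in>K. x k * quad_form S R a (u k))"
proof (cases "finite K")
  case True
  then show ?thesis
    by (induction K) (simp_all add: quad_form_add_right quad_form_scale_right, simp add: quad_form_def)
qed (simp add: quad_form_def)

text \<open>The unit vector at \<open>t\<close> minus its expansion in the \<open>b k\<close>. When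
  the covariance form of a Gaussian field vanishes on it, the variable at \<open>t\<close> is almost
  surely the combination, with coefficients \<open>c t k\<close>, of the variables belonging to the
  \<open>b k\<close>.\<close>

abbreviation residual :: "nat \<Rightarrow> ('i \<Rightarrow> nat \<Rightarrow> real) \<Rightarrow> (nat \<Rightarrow> 'i \<Rightarrow> real) \<Rightarrow> 'i \<Rightarrow> 'i \<Rightarrow> real" where
  "residual n c b t \<equiv> \<lambda>s. (if s = t then 1 else 0) - (\<Sum>k<n. c t k * b k s)"

section \<open>Eigenvectors of a real symmetric matrix\<close>

definition dot :: "nat \<Rightarrow> (nat \<Rightarrow> real) \<Rightarrow> (nat \<Rightarrow> real) \<Rightarrow> real" where
  "dot n v w = (\<Sum>i<n. v i * w i)"

lemma dot_commute: "dot n v w = dot n w v"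
  by (simp add: dot_def mult.commute)

lemma dot_add: "dot n (\<lambda>i. v i + w i) u = dot n v u + dot n w u" "dot n u (\<lambda>i. v i + w i) = dot n u v + dot n u w"
  by (simp_all add: dot_def sum.distrib algebra_simps)

lemma dot_diff: "dot n (\<lambda>i. v i - w i) u = dot n v u - dot n w u" "dot n u (\<lambda>i. v i - w i) = dot n u v - dot n u w"
  by (simp_all add: dot_def sum_subtractf algebra_simps)

lemma dot_scale: "dot n (\<lambda>i. c * v i) u = c * dot n v u" "dot n u (\<lambda>i. c * v i) = c * dot n u v"
  by (simp_all add: dot_def sum_distrib_left mult_ac)

lemma dot_cong: "(\<And>i. i < n \<Longrightarrow> v i = v' i) \<Longrightarrow> (\<And>i. i < n \<Longrightarrow> w i = w' i) \<Longrightarrow> dot n v w = dot n v' w'"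
  by (simp add: dot_def)

lemma dot_sum_right: fixes b :: "nat \<Rightarrow> nat \<Rightarrow> real" shows "dot n u (\<lambda>i. \<Sum>k<m. c k * b k i) = (\<Sum>k<m. c k * dot n u (b k))"
  unfolding dot_def sum_distrib_left by (subst sum.swap) (simp add: mult_ac)

lemma dot_sum_left: fixes b :: "nat \<Rightarrow> nat \<Rightarrow> real" shows "dot n (\<lambda>i. \<Sum>k<m. c k * b k i) u = (\<Sum>k<m. c k * dot n (b k) u)"
  using dot_sum_right[of n u c b m] by (simp add: dot_commute)

lemma dot_nonneg: "dot n v v \<ge> 0"
  unfolding dot_def by (intro sum_nonneg) auto

lemma dot_eq_0: "dot n v v = 0 \<Longrightarrow> i < n \<Longrightarrow> v i = 0"
  unfolding dot_def by (subst (asm) sum_nonneg_eq_0_iff) auto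

abbreviation unit_vec :: "nat \<Rightarrow> nat \<Rightarrow> real" where
  "unit_vec i \<equiv> (\<lambda>j. if j = i then 1 else 0)"

lemma dot_unit: "i < n \<Longrightarrow> dot n v (unit_vec i) = v i"
  by (simp add: dot_def if_distrib cong: if_cong)

text \<open>\<open>r\<close> is the part of a unit vector orthogonal to the family. Its squared
  length serves twice: if positive, it yields a direction for the next eigenvector; if zero for
  every unit vector, the family is complete.\<close>

lemma orthonormal_residual:
  fixes b :: "nat \<Rightarrow> nat \<Rightarrow> real"
  assumes on: "\<And>k l. k < m \<Longrightarrow> l < m \<Longrightarrow> dot n (b k) (b l) = (if k = l then 1 else 0)" and i: "i < n"
  defines "r \<equiv> \<lambda>j. unit_vec i j - (\<Sum>k<m. b k i * b k j)"
  shows "\<And>l. l < m \<Longrightarrow> dot n (b l) r = 0" "dot n r r = 1 - (\<Sum>k<m. (b k i)\<^sup>2)"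
proof -
  show *: "dot n (b l) r = 0" if l: "l < m" for l
  proof -
    have "dot n (b l) r = b l i - (\<Sum>k<m. b k i * (if l = k then 1 else 0))"
      using on l by (simp add: r_def dot_diff dot_sum_right dot_unit[OF i])
    also have "(\<Sum>k<m. b k i * (if l = k then 1 else 0)) = (\<Sum>k<m. if k = l then b l i else 0)"
      by (intro sum.cong) auto
    also have "b l i - \<dots> = 0" using l by simp
    finally show ?thesis .
  qed
  have "dot n r r = dot n (unit_vec i) r - dot n (\<lambda>j. \<Sum>k<m. b k i * b k j) r"
    unfolding r_def by (subst dot_diff(1)) simp
  also have "dot n (\<lambda>j. \<Sum>k<m. b k i * b k j) r = 0"
    unfolding dot_sum_left by (intro sum.neutral) (use * in auto)
  also have "dot n (unit_vec i) r = r i"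
    using dot_unit[OF i, of r] by (simp add: dot_commute)
  also have "r i = 1 - (\<Sum>k<m. (b k i)\<^sup>2)" by (simp add: r_def power2_eq_square)
  finally show "dot n r r = 1 - (\<Sum>k<m. (b k i)\<^sup>2)" by simp
qed

text \<open>The trace of the complementary projection. It replaces dimension arguments: it is
  positive as long as fewer than \<open>n\<close> vectors have been chosen, and 0 for
  \<open>n\<close> vectors.\<close>

lemma sum_orthonormal_residual:
  fixes b :: "nat \<Rightarrow> nat \<Rightarrow> real"
  assumes on: "\<And>k l. k < m \<Longrightarrow> l < m \<Longrightarrow> dot n (b k) (b l) = (if k = l then 1 else 0)"
  shows "(\<Sum>i<n. 1 - (\<Sum>k<m. (b k i)\<^sup>2)) = real n - real m"
proof -
  have "(\<Sum>i<n. \<Sum>k<m. (b k i)\<^sup>2) = (\<Sum>k<m. dot n (b k) (b k))"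
    unfolding dot_def by (subst sum.swap) (simp add: power2_eq_square)
  then show ?thesis using on by (simp add: sum_subtractf)
qed

text \<open>Entries below \<open>n\<close> are bounded by 1 and the others are 0, so the set is
  closed in a compact product of intervals and points.\<close>

lemma compact_sphere:
  fixes b :: "nat \<Rightarrow> nat \<Rightarrow> real"
  shows "compact {v :: nat \<Rightarrow> real. (\<forall>i\<ge>n. v i = 0) \<and> dot n v v = 1 \<and> (\<forall>k<m. dot n (b k) v = 0)}"
proof -
  define K where "K = (\<Pi>\<^sub>E i\<in>UNIV. if i < n then {-1..1::real} else {0})"
  have "compact K"
    using compactin_PiE[of "\<lambda>_. euclidean" UNIV "\<lambda>i. if i < n then {-1..1::real} else {0}"]
    by (auto simp: K_def euclidean_product_topology)
  moreover have "closed {v :: nat \<Rightarrow> real. dot n v v = 1 \<and> (\<forall>k<m. dot n (b k) v = 0)}"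
    unfolding dot_def
    by (intro closed_Collect_conj closed_Collect_all closed_Collect_imp open_Collect_const closed_Collect_eq
       continuous_intros continuous_on_product_coordinates)
  moreover have "{v. (\<forall>i\<ge>n. v i = 0) \<and> dot n v v = 1 \<and> (\<forall>k<m. dot n (b k) v = 0)} =
     K \<inter> {v. dot n v v = 1 \<and> (\<forall>k<m. dot n (b k) v = 0)}"
  proof -
    have "v i \<in> {-1..1}" if "dot n v v = 1" "i < n" for v i
    proof -
      have "(v i)\<^sup>2 \<le> dot n v v"
        unfolding dot_def power2_eq_square by (rule member_le_sum) (use that in auto)
      then have "\<bar>v i\<bar> \<le> 1" using that by (simp add: abs_square_le_1)
      then show ?thesis by auto
    qed
    then show ?thesis by (auto simp: K_def PiE_UNIV_domain Pi_iff split: if_splits)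
  qed
  ultimately show ?thesis by (simp add: compact_Int_closed)
qed

text \<open>The first-order condition at a maximum, obtained from small variations instead of a
  derivative.\<close>

lemma linear_le_quadratic_imp_zero:
  fixes p q :: real
  assumes "\<And>s. 2 * s * p \<le> s\<^sup>2 * q"
  shows "p = 0"
proof (rule ccontr)
  assume p: "p \<noteq> 0"
  \<comment> \<open>Chosen so that \<open>s^2 * (|q| + 1) = s * p\<close>; the assumption then gives
    \<open>s * p \<le> 0\<close>, although \<open>s * p\<close> has the sign of
    \<open>p^2\<close>.\<close>
  define s where "s = p / (\<bar>q\<bar> + 1)"
  have "2 * s * p \<le> s\<^sup>2 * q" by (rule assms)
  also have "\<dots> \<le> s\<^sup>2 * (\<bar>q\<bar> + 1)" by (intro mult_left_mono) auto
  also have "\<dots> = s * p" by (simp add: s_def power2_eq_square)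
  finally have "s * p \<le> 0" by (simp add: mult.commute)
  moreover have "s * p = p\<^sup>2 / (\<bar>q\<bar> + 1)" by (simp add: s_def power2_eq_square)
  moreover have "p\<^sup>2 / (\<bar>q\<bar> + 1) > 0" using p by (intro divide_pos_pos) auto
  ultimately show False by simp
qed

text \<open>The next eigenvector maximizes the quadratic form on the unit sphere orthogonal to the previous
  ones. The dimension varies, so vectors are sequences vanishing from \<open>n\<close> on, with the product topology.\<close>

lemma symmetric_partial_eigenbasis:
  fixes A :: "nat \<Rightarrow> nat \<Rightarrow> real"
  assumes sym: "\<And>i j. i < n \<Longrightarrow> j < n \<Longrightarrow> A i j = A j i" and "m \<le> n"
  defines "mv \<equiv> \<lambda>v j. \<Sum>i<n. A j i * v i"
  shows "\<exists>b lam. (\<forall>k<m. \<forall>l<m. dot n (b k) (b l) = (if k = l then 1 else 0)) \<and>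
     (\<forall>k<m. \<forall>j<n. mv (b k) j = lam k * b k j)"
  using \<open>m \<le> n\<close>
proof (induction m)
  case (Suc m)
  then obtain b lam where on: "\<And>k l. k < m \<Longrightarrow> l < m \<Longrightarrow> dot n (b k) (b l) = (if k = l then 1 else 0)"
    and ev: "\<And>k j. k < m \<Longrightarrow> j < n \<Longrightarrow> mv (b k) j = lam k * b k j"
    by (metis Suc_leD)
  have mv_add: "mv (\<lambda>i. v i + w i) = (\<lambda>j. mv v j + mv w j)" for v w
    by (simp add: mv_def sum.distrib algebra_simps)
  have mv_scale: "mv (\<lambda>i. c * v i) = (\<lambda>j. c * mv v j)" for v c
    by (simp add: mv_def sum_distrib_left mult_ac)
  have mv_sym: "dot n (mv v) w = dot n v (mv w)" for v w
    unfolding dot_def mv_def sum_distrib_left sum_distrib_right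
    by (subst sum.swap) (auto intro!: sum.cong simp: sym)
  define C where "C = {v :: nat \<Rightarrow> real. (\<forall>i\<ge>n. v i = 0) \<and> dot n v v = 1 \<and> (\<forall>k<m. dot n (b k) v = 0)}"
  have normalise: "\<exists>s. s \<noteq> 0 \<and> (\<lambda>i. if i < n then s * w i else 0) \<in> C \<and> s\<^sup>2 * dot n w w = 1"
    if w: "dot n w w > 0" "\<And>k. k < m \<Longrightarrow> dot n (b k) w = 0" for w
  proof -
    define s where "s = 1 / sqrt (dot n w w)"
    have s: "s\<^sup>2 * dot n w w = 1" "s \<noteq> 0" using w by (simp_all add: s_def power_divide)
    have "dot n u (\<lambda>i. if i < n then s * w i else 0) = dot n u (\<lambda>i. s * w i)"
      "dot n (\<lambda>i. if i < n then s * w i else 0) u = dot n (\<lambda>i. s * w i) u" for u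
      by (auto intro!: dot_cong)
    then have "(\<lambda>i. if i < n then s * w i else 0) \<in> C"
      using w s(1) unfolding C_def by (simp add: dot_scale power2_eq_square mult.assoc)
    with s show ?thesis by blast
  qed
  have ne: "C \<noteq> {}"
  proof -
    \<comment> \<open>Fewer than \<open>n\<close> vectors leave some unit vector with nonzero
      residual; scaled, it is a point of the sphere \<open>C\<close>.\<close>
    have "(\<Sum>i<n. 1 - (\<Sum>k<m. (b k i)\<^sup>2)) > 0"
      using sum_orthonormal_residual[OF on] Suc.prems by simp
    then obtain i where i: "i < n" "1 - (\<Sum>k<m. (b k i)\<^sup>2) > 0"
      by (meson lessThan_iff not_less sum_nonpos)
    let ?r = "\<lambda>j. unit_vec i j - (\<Sum>k<m. b k i * b k j)"
    have "dot n ?r ?r > 0" "\<And>k. k < m \<Longrightarrow> dot n (b k) ?r = 0"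
      using orthonormal_residual[OF on i(1)] i(2) by auto
    from normalise[OF this] show ?thesis by blast
  qed
  have cont: "continuous_on C (\<lambda>v. dot n v (mv v))"
    unfolding dot_def mv_def
    by (intro continuous_intros continuous_on_subset[OF continuous_on_product_coordinates]) auto
  have "compact C" unfolding C_def by (rule compact_sphere)
  from continuous_attains_sup[OF this ne cont]
  obtain v where v: "v \<in> C" "\<And>w. w \<in> C \<Longrightarrow> dot n w (mv w) \<le> dot n v (mv v)" by blast
  define mu where "mu = dot n v (mv v)"
  have vv: "dot n v v = 1" "\<And>k. k < m \<Longrightarrow> dot n (b k) v = 0" using v(1) by (auto simp: C_def)
  \<comment> \<open>By homogeneity the maximality of \<open>v\<close> extends from \<open>C\<close>
    to all vectors orthogonal to the earlier eigenvectors.\<close>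
  have bound: "dot n w (mv w) \<le> mu * dot n w w" if w: "\<And>k. k < m \<Longrightarrow> dot n (b k) w = 0" for w
  proof (cases "dot n w w = 0")
    case True
    then have "dot n w (mv w) = dot n (\<lambda>_. 0) (mv w)"
      by (intro dot_cong) (auto dest: dot_eq_0)
    then show ?thesis using True by (simp add: dot_def)
  next
    case False
    then have pos: "dot n w w > 0" using dot_nonneg[of n w] by linarith
    obtain s where s: "s \<noteq> 0" "(\<lambda>i. if i < n then s * w i else 0) \<in> C" "s\<^sup>2 * dot n w w = 1"
      using normalise[OF pos w] by blast
    let ?w = "\<lambda>i. if i < n then s * w i else 0"
    have "dot n ?w (mv ?w) = dot n (\<lambda>i. s * w i) (mv (\<lambda>i. s * w i))"
      by (intro dot_cong) (auto simp: mv_def)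
    also have "\<dots> = s\<^sup>2 * dot n w (mv w)" by (simp add: mv_scale dot_scale power2_eq_square)
    finally have "s\<^sup>2 * dot n w (mv w) \<le> mu" using v(2)[OF s(2)] by (simp add: mu_def)
    also have "mu = s\<^sup>2 * (mu * dot n w w)" using s(3) by (simp add: algebra_simps)
    finally show ?thesis using s(1) by simp
  qed
  \<comment> \<open>The defect of the eigenvector equation. Being orthogonal to the earlier
    eigenvectors it is an admissible variation of \<open>v\<close>, and the first-order condition
    along it forces its length to be 0.\<close>
  define u where "u = (\<lambda>j. mv v j + (- mu) * v j)"
  have ub: "dot n (b k) u = 0" if k: "k < m" for k
  proof -
    have "dot n (b k) (mv v) = dot n (mv (b k)) v" by (rule mv_sym[symmetric])
    also have "\<dots> = dot n (\<lambda>j. lam k * b k j) v" using k by (intro dot_cong) (auto simp: ev)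
    finally have "dot n (b k) (mv v) = 0" using k vv by (simp add: dot_scale)
    then show ?thesis using k vv unfolding u_def dot_add dot_scale by simp
  qed
  have uv: "dot n v u = 0" unfolding u_def dot_add dot_scale using vv by (simp add: mu_def)
  have "dot n u (mv v) = 0"
  proof (rule linear_le_quadratic_imp_zero)
    fix s
    have "dot n (\<lambda>i. v i + s * u i) (mv (\<lambda>i. v i + s * u i)) \<le> mu * dot n (\<lambda>i. v i + s * u i) (\<lambda>i. v i + s * u i)"
      by (rule bound) (simp add: dot_add dot_scale vv ub)
    moreover have "dot n v (mv u) = dot n u (mv v)" by (metis mv_sym dot_commute)
    moreover have "dot n u v = 0" using uv by (simp add: dot_commute)
    ultimately have "mu + 2 * s * dot n u (mv v) + s\<^sup>2 * dot n u (mv u) \<le> mu * (1 + s\<^sup>2 * dot n u u)"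
      using vv uv by (simp add: mv_add mv_scale dot_add dot_scale mu_def[symmetric] power2_eq_square algebra_simps)
    then show "2 * s * dot n u (mv v) \<le> s\<^sup>2 * (mu * dot n u u - dot n u (mv u))"
      by (simp add: algebra_simps)
  qed
  moreover have "dot n u (mv v) = dot n u u"
  proof -
    have "dot n u u = dot n u (mv v) + (- mu) * dot n u v"
      by (subst (2) u_def) (simp only: dot_add dot_scale)
    then show ?thesis using uv by (simp add: dot_commute)
  qed
  ultimately have "dot n u u = 0" by simp
  then have mvv: "mv v j = mu * v j" if "j < n" for j
    using dot_eq_0[of n u j] that by (simp add: u_def)
  have vb: "dot n v (b k) = 0" if "k < m" for k
    using vv(2)[OF that] dot_commute[of n v "b k"] by simp
  have on': "dot n ((b(m := v)) k) ((b(m := v)) l) = (if k = l then 1 else 0)" if "k < Suc m" "l < Suc m" for k l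
    using that on[of k l] vv vb by (cases "k = m"; cases "l = m") auto
  have ev': "mv ((b(m := v)) k) j = (lam(m := mu)) k * (b(m := v)) k j" if "k < Suc m" "j < n" for k j
    using that ev[of k j] mvv by (cases "k = m") auto
  show ?case using on' ev' by blast
qed simp

text \<open>The third relation, completeness, holds because the residuals of the unit vectors have
  nonnegative squared lengths with sum \<open>n - n = 0\<close>.\<close>

lemma symmetric_eigenbasis:
  fixes A :: "nat \<Rightarrow> nat \<Rightarrow> real"
  assumes sym: "\<And>i j. i < n \<Longrightarrow> j < n \<Longrightarrow> A i j = A j i"
  obtains b lam where
    "\<And>k l. k < n \<Longrightarrow> l < n \<Longrightarrow> (\<Sum>i<n. b k i * b l i) = (if k = l then 1 else 0)"
    "\<And>k l. k < n \<Longrightarrow> l < n \<Longrightarrow> (\<Sum>i<n. \<Sum>j<n. b k i * b l j * A i j) = (if k = l then lam k else 0)"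
    "\<And>i j. i < n \<Longrightarrow> j < n \<Longrightarrow> (\<Sum>k<n. b k i * b k j) = (if i = j then 1 else 0)"
proof -
  have "\<exists>b lam. (\<forall>k<n. \<forall>l<n. dot n (b k) (b l) = (if k = l then 1 else 0)) \<and>
     (\<forall>k<n. \<forall>j<n. (\<Sum>i<n. A j i * b k i) = lam k * b k j)"
    by (rule symmetric_partial_eigenbasis) (auto intro: sym)
  then obtain b lam
    where bl: "\<forall>k<n. \<forall>l<n. dot n (b k) (b l) = (if k = l then 1 else 0)"
      "\<forall>k<n. \<forall>j<n. (\<Sum>i<n. A j i * b k i) = lam k * b k j"
    by (elim exE conjE)
  have on: "\<And>k l. k < n \<Longrightarrow> l < n \<Longrightarrow> dot n (b k) (b l) = (if k = l then 1 else 0)"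
    using bl(1) by blast
  have ev: "(\<Sum>i<n. A j i * b k i) = lam k * b k j" if "k < n" "j < n" for k j
    using bl(2) that by blast
  have 2: "(\<Sum>i<n. \<Sum>j<n. b k i * b l j * A i j) = (if k = l then lam k else 0)" if "k < n" "l < n" for k l
  proof -
    have "(\<Sum>i<n. \<Sum>j<n. b k i * b l j * A i j) = (\<Sum>i<n. b k i * (\<Sum>j<n. A i j * b l j))"
      by (simp add: sum_distrib_left mult_ac)
    also have "\<dots> = (\<Sum>i<n. lam l * (b k i * b l i))"
      using ev that by (intro sum.cong) auto
    also have "\<dots> = lam l * dot n (b k) (b l)" by (simp add: dot_def sum_distrib_left)
    finally show ?thesis using on[OF that] by simp
  qed
  have 3: "(\<Sum>k<n. b k i * b k j) = (if i = j then 1 else 0)" if "i < n" "j < n" for i j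
  proof -
    let ?r = "\<lambda>i j. unit_vec i j - (\<Sum>k<n. b k i * b k j)"
    have res: "dot n (?r i) (?r i) = 1 - (\<Sum>k<n. (b k i)\<^sup>2)" if "i < n" for i
      by (rule orthonormal_residual(2)[OF on that])
    have nn: "1 - (\<Sum>k<n. (b k i)\<^sup>2) \<ge> 0" if "i < n" for i
      using res[OF that] dot_nonneg[of n "?r i"] by simp
    have "(\<Sum>i<n. 1 - (\<Sum>k<n. (b k i)\<^sup>2)) = 0"
      using sum_orthonormal_residual[OF on] by simp
    then have "\<forall>i\<in>{..<n}. 1 - (\<Sum>k<n. (b k i)\<^sup>2) = 0"
      using nn by (subst (asm) sum_nonneg_eq_0_iff) auto
    then have "dot n (?r i) (?r i) = 0" using res[OF \<open>i < n\<close>] \<open>i < n\<close> by simp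
    from dot_eq_0[OF this \<open>j < n\<close>] show ?thesis by auto
  qed
  show ?thesis by (rule that[of b lam]) (use on 2 3 in \<open>auto simp: dot_def\<close>)
qed

text \<open>A unit vector whose residual is null is discarded, otherwise its normalized residual is
  appended. Residuals are required to be null for the form, not zero, since the field variables may
  be linearly dependent.\<close>

lemma gram_schmidt_form:
  assumes "finite U" and sym: "\<And>s t. s \<in> S \<Longrightarrow> t \<in> S \<Longrightarrow> R s t = R t s"
    and psd: "\<And>a. quad_form S R a a \<ge> 0"
  shows "\<exists>(n::nat) u c. (\<forall>k<n. \<forall>l<n. quad_form S R (u k) (u l) = (if k = l then 1 else (0::real))) \<and>
    (\<forall>t\<in>U. quad_form S R (residual n c u t) (residual n c u t) = 0)"
  using assms(1)
proof (induction U)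
  case empty
  show ?case by (intro exI[of _ 0]) auto
next
  case (insert t U)
  from insert.IH obtain n :: nat and u c where
    *: "\<forall>k<n. \<forall>l<n. quad_form S R (u k) (u l) = (if k = l then 1 else (0::real))"
    and **: "\<forall>t\<in>U. quad_form S R (residual n c u t) (residual n c u t) = 0"
    by (elim exE conjE)
  have on: "quad_form S R (u k) (u l) = (if k = l then 1 else 0)" if "k < n" "l < n" for k l
    using * that by blast
  have res: "quad_form S R (residual n c u t) (residual n c u t) = 0" if "t \<in> U" for t
    using ** that by blast
  define e where "e s = (if s = t then 1 else (0::real))" for s
  define d where "d k = quad_form S R e (u k)" for k
  define r where "r s = e s - (\<Sum>k<n. d k * u k s)" for s
  show ?case
  proof (cases "quad_form S R r r = 0")
    case True
    have "(\<lambda>s. (if s = t then 1 else 0) - (\<Sum>k<n. d k * u k s)) = r"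
      by (auto simp: r_def e_def)
    with True on res insert.hyps show ?thesis
      by (intro exI[of _ n] exI[of _ u] exI[of _ "c(t := d)"]) (auto simp: fun_upd_def)
  next
    case False
    define q where "q = sqrt (quad_form S R r r)"
    have q: "q > 0" "q * q = quad_form S R r r" using False psd[of r] by (auto simp: q_def)
    define w where "w = (\<lambda>s. (1/q) * r s)"
    have ru: "quad_form S R r (u l) = 0" if "l < n" for l
    proof -
      have "quad_form S R r (u l) = quad_form S R (\<lambda>s. e s + (\<Sum>k<n. (- d k) * u k s)) (u l)"
        by (simp add: r_def[abs_def] sum_negf)
      also have "\<dots> = d l + (\<Sum>k<n. - d k * quad_form S R (u k) (u l))"
        unfolding quad_form_add_left quad_form_sum_left by (simp add: d_def)
      also have "(\<Sum>k<n. - d k * quad_form S R (u k) (u l)) = (\<Sum>k<n. if k = l then - d k else 0)"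
        using that on by (intro sum.cong) auto
      also have "d l + \<dots> = 0" using that by simp
      finally show ?thesis .
    qed
    have wu: "quad_form S R w (u l) = 0" if "l < n" for l
      unfolding w_def quad_form_scale_left ru[OF that] by simp
    have uw: "quad_form S R (u l) w = 0" if "l < n" for l
      using wu[OF that] quad_form_commute[of S R w "u l", OF sym] by simp
    have ww: "quad_form S R w w = 1"
      using q(1) unfolding w_def quad_form_scale_left quad_form_scale_right q(2)[symmetric] by simp
    define u' where "u' = u(n := w)"
    \<comment> \<open>Expansions found earlier get coefficient 0 at the new vector; that of
      \<open>t\<close> gets the length \<open>q\<close>, so its residual is exactly 0.\<close>
    define c' where "c' = (\<lambda>t' k. if t' = t then (if k = n then q else d k) else if k = n then 0 else c t' k)"
    have su: "(\<Sum>k<Suc n. c' t' k * u' k s) = (\<Sum>k<n. (if t' = t then d k else c t' k) * u k s) + (if t' = t then r s else 0)" for t' s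
      using q(1) by (auto simp: c'_def u'_def w_def)
    have "quad_form S R (u' k) (u' l) = (if k = l then 1 else 0)" if "k < Suc n" "l < Suc n" for k l
      using that on wu uw ww by (cases "k = n"; cases "l = n") (auto simp: u'_def)
    moreover have "quad_form S R (\<lambda>s. (if s = t' then 1 else 0) - (\<Sum>k<Suc n. c' t' k * u' k s))
       (\<lambda>s. (if s = t' then 1 else 0) - (\<Sum>k<Suc n. c' t' k * u' k s)) = 0" if "t' \<in> insert t U" for t'
    proof (cases "t' = t")
      case True
      have "(if s = t' then 1 else 0) - (\<Sum>k<Suc n. c' t' k * u' k s) = 0" for s
        unfolding su using True by (simp add: r_def e_def)
      then show ?thesis by (simp add: quad_form_def)
    next
      case False
      then have eq: "(\<Sum>k<Suc n. c' t' k * u' k s) = (\<Sum>k<n. c t' k * u k s)" for s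
        unfolding su by simp
      show ?thesis unfolding eq using res[of t'] that False by blast
    qed
    ultimately show ?thesis by blast
  qed
qed

text \<open>In an orthonormal system for \<open>R0\<close> the form \<open>R1\<close> becomes a
  symmetric matrix. Rotation by its eigenbasis preserves orthonormality for \<open>R0\<close>, and
  completeness of the eigenbasis keeps the expansions, hence the residuals, unchanged.\<close>

lemma simultaneous_diagonalization:
  assumes "finite S"
    and sym0: "\<And>s t. s \<in> S \<Longrightarrow> t \<in> S \<Longrightarrow> R0 s t = R0 t s"
    and sym1: "\<And>s t. s \<in> S \<Longrightarrow> t \<in> S \<Longrightarrow> R1 s t = R1 t s"
    and psd: "\<And>a. quad_form S R0 a a \<ge> 0"
  obtains n :: nat and b c lam where
    "\<And>k l. k < n \<Longrightarrow> l < n \<Longrightarrow> quad_form S R0 (b k) (b l) = (if k = l then 1 else 0)"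
    "\<And>k l. k < n \<Longrightarrow> l < n \<Longrightarrow> quad_form S R1 (b k) (b l) = (if k = l then lam k else 0)"
    "\<And>t. t \<in> S \<Longrightarrow> quad_form S R0 (residual n c b t) (residual n c b t) = 0"
proof -
  have "\<exists>(n::nat) u c. (\<forall>k<n. \<forall>l<n. quad_form S R0 (u k) (u l) = (if k = l then 1 else (0::real))) \<and>
    (\<forall>t\<in>S. quad_form S R0 (residual n c u t) (residual n c u t) = 0)"
    by (rule gram_schmidt_form[OF assms(1) _ psd]) (rule sym0)
  then obtain n :: nat and u c where
    *: "\<forall>k<n. \<forall>l<n. quad_form S R0 (u k) (u l) = (if k = l then 1 else (0::real))"
    and **: "\<forall>t\<in>S. quad_form S R0 (residual n c u t) (residual n c u t) = 0"
    by (elim exE conjE)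
  have on: "quad_form S R0 (u k) (u l) = (if k = l then 1 else 0)" if "k < n" "l < n" for k l
    using * that by blast
  have res: "quad_form S R0 (residual n c u t) (residual n c u t) = 0" if "t \<in> S" for t
    using ** that by blast
  obtain \<beta> lam where \<beta>: "\<And>k l. k < n \<Longrightarrow> l < n \<Longrightarrow> (\<Sum>i<n. \<beta> k i * \<beta> l i) = (if k = l then 1 else (0::real))"
    "\<And>k l. k < n \<Longrightarrow> l < n \<Longrightarrow> (\<Sum>i<n. \<Sum>j<n. \<beta> k i * \<beta> l j * quad_form S R1 (u i) (u j)) = (if k = l then lam k else 0)"
    "\<And>i j. i < n \<Longrightarrow> j < n \<Longrightarrow> (\<Sum>k<n. \<beta> k i * \<beta> k j) = (if i = j then 1 else 0)"
  proof (rule symmetric_eigenbasis[of n "\<lambda>i j. quad_form S R1 (u i) (u j)"])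
    show "quad_form S R1 (u i) (u j) = quad_form S R1 (u j) (u i)" for i j
      by (rule quad_form_commute) (rule sym1)
  qed (rule that)
  define b where "b k = (\<lambda>s. \<Sum>i<n. \<beta> k i * u i s)" for k
  have form: "quad_form S R (b k) (b l) = (\<Sum>i<n. \<Sum>j<n. \<beta> k i * \<beta> l j * quad_form S R (u i) (u j))" for R k l
    by (simp add: b_def quad_form_sum_left quad_form_sum_right sum_distrib_left mult_ac)
  have ub: "(\<Sum>k<n. \<beta> k i * b k s) = u i s" if "i < n" for i s
  proof -
    have "(\<Sum>k<n. \<beta> k i * b k s) = (\<Sum>j<n. (\<Sum>k<n. \<beta> k i * \<beta> k j) * u j s)"
      unfolding b_def sum_distrib_left sum_distrib_right by (subst sum.swap) (simp add: mult_ac)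
    also have "\<dots> = (\<Sum>j<n. if i = j then u j s else 0)" using that \<beta>(3) by (intro sum.cong) auto
    finally show ?thesis using that by simp
  qed
  define c' where "c' t k = (\<Sum>i<n. c t i * \<beta> k i)" for t k
  have c': "(\<Sum>k<n. c' t k * b k s) = (\<Sum>i<n. c t i * u i s)" for t s
  proof -
    have "(\<Sum>k<n. c' t k * b k s) = (\<Sum>i<n. c t i * (\<Sum>k<n. \<beta> k i * b k s))"
      unfolding c'_def sum_distrib_left sum_distrib_right by (subst sum.swap) (simp add: mult_ac)
    then show ?thesis using ub by simp
  qed
  show ?thesis
  proof (rule that[of n b lam c'])
    fix k l assume kl: "k < n" "l < n"
    have "(\<Sum>i<n. \<Sum>j<n. \<beta> k i * \<beta> l j * quad_form S R0 (u i) (u j)) = (\<Sum>i<n. \<Sum>j<n. if i = j then \<beta> k i * \<beta> l j else 0)"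
      using on by (intro sum.cong) auto
    then show "quad_form S R0 (b k) (b l) = (if k = l then 1 else 0)"
      unfolding form using \<beta>(1)[OF kl] by simp
    show "quad_form S R1 (b k) (b l) = (if k = l then lam k else 0)"
      unfolding form by (rule \<beta>(2)[OF kl])
  qed (use res c' in simp)
qed

section \<open>Mutual absolute continuity on product spaces\<close>

text \<open>Induction over the generation of the sigma-algebra. A single member of \<open>C\<close>
  has to approximate under both measures, because the two will be compared only on such
  sets.\<close>

lemma sigma_sets_approximation:
  assumes P: "finite_measure P" "sets P = sigma_sets \<Omega> G" and Q: "finite_measure Q" "sets Q = sigma_sets \<Omega> G"
    and sub: "C \<subseteq> sigma_sets \<Omega> G" "G \<subseteq> C" "{} \<in> C" "G \<subseteq> Pow \<Omega>"
    and compl: "\<And>B. B \<in> C \<Longrightarrow> \<Omega> - B \<in> C" and un: "\<And>A B. A \<in> C \<Longrightarrow> B \<in> C \<Longrightarrow> A \<union> B \<in> C"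
    and A: "A \<in> sigma_sets \<Omega> G" and "\<epsilon> > 0"
  shows "\<exists>B\<in>C. measure P ((A - B) \<union> (B - A)) < \<epsilon> \<and> measure Q ((A - B) \<union> (B - A)) < \<epsilon>"
  using A \<open>\<epsilon> > 0\<close>
proof (induction arbitrary: \<epsilon> rule: sigma_sets.induct)
  case (Basic a)
  then show ?case using sub by (intro bexI[of _ a]) auto
next
  case Empty
  then show ?case using sub by (intro bexI[of _ "{}"]) auto
next
  case (Compl a)
  then obtain B where B: "B \<in> C" "measure P ((a - B) \<union> (B - a)) < \<epsilon>" "measure Q ((a - B) \<union> (B - a)) < \<epsilon>" by blast
  have "a \<subseteq> \<Omega>" "B \<subseteq> \<Omega>"
    using sigma_sets_into_sp[OF sub(4)] Compl(1) B(1) sub(1) by blast+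
  then have "((\<Omega> - a) - (\<Omega> - B)) \<union> ((\<Omega> - B) - (\<Omega> - a)) = (a - B) \<union> (B - a)" by auto
  then show ?case using B compl by (intro bexI[of _ "\<Omega> - B"]) auto
next
  case (Union a)
  interpret P: finite_measure P by (rule P)
  interpret Q: finite_measure Q by (rule Q)
  define U where "U n = (\<Union>i<n. a i)" for n :: nat
  have am: "a i \<in> sets P" "a i \<in> sets Q" for i using Union(1) P Q by auto
  have Um: "U n \<in> sets P" "U n \<in> sets Q" for n unfolding U_def using am by auto
  have inc: "incseq U" by (auto simp: incseq_def U_def intro: less_le_trans)
  have UU: "(\<Union>n. U n) = (\<Union>i. a i)" by (auto simp: U_def)
  have "(\<lambda>n. measure P (U n)) \<longlonglongrightarrow> measure P (\<Union>i. a i)"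
    using P.finite_Lim_measure_incseq[of U] Um inc UU by auto
  then have "eventually (\<lambda>n. measure P (U n) > measure P (\<Union>i. a i) - \<epsilon>/2) sequentially"
    using Union.prems by (intro order_tendstoD) auto
  moreover have "(\<lambda>n. measure Q (U n)) \<longlonglongrightarrow> measure Q (\<Union>i. a i)"
    using Q.finite_Lim_measure_incseq[of U] Um inc UU by auto
  then have "eventually (\<lambda>n. measure Q (U n) > measure Q (\<Union>i. a i) - \<epsilon>/2) sequentially"
    using Union.prems by (intro order_tendstoD) auto
  ultimately have "eventually (\<lambda>n. measure P (U n) > measure P (\<Union>i. a i) - \<epsilon>/2 \<and> measure Q (U n) > measure Q (\<Union>i. a i) - \<epsilon>/2) sequentially"
    by (rule eventually_conj)
  then obtain N where N: "measure P (U N) > measure P (\<Union>i. a i) - \<epsilon>/2" "measure Q (U N) > measure Q (\<Union>i. a i) - \<epsilon>/2"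
    by (auto simp: eventually_sequentially)
  \<comment> \<open>Half of \<epsilon> is spent on cutting the union off at \<open>N\<close>, the
    other half is shared by the first \<open>N\<close> sets; the \<open>+ 1\<close> covers
    \<open>N = 0\<close>.\<close>
  define \<epsilon>' where "\<epsilon>' = \<epsilon> / (2 * (real N + 1))"
  have e': "\<epsilon>' > 0" using Union.prems by (simp add: \<epsilon>'_def)
  have "\<forall>i. \<exists>B\<in>C. measure P ((a i - B) \<union> (B - a i)) < \<epsilon>' \<and> measure Q ((a i - B) \<union> (B - a i)) < \<epsilon>'"
    using Union.IH e' by blast
  then obtain B where B: "\<And>i. B i \<in> C" "\<And>i. measure P ((a i - B i) \<union> (B i - a i)) < \<epsilon>'" "\<And>i. measure Q ((a i - B i) \<union> (B i - a i)) < \<epsilon>'"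
    by metis
  define V where "V n = (\<Union>i<n. B i)" for n :: nat
  have VC: "V n \<in> C" for n
    by (induction n) (auto simp: V_def lessThan_Suc sub(3) intro!: un B)
  have Bm: "B i \<in> sets P" "B i \<in> sets Q" for i using B(1) sub(1) P Q by auto
  have bound: "measure R (((\<Union>i. a i) - V N) \<union> (V N - (\<Union>i. a i))) < \<epsilon>"
    if R: "finite_measure R" and aR: "\<And>i. a i \<in> sets R" and BR: "\<And>i. B i \<in> sets R"
     and NR: "measure R (U N) > measure R (\<Union>i. a i) - \<epsilon>/2" and eR: "\<And>i. measure R ((a i - B i) \<union> (B i - a i)) < \<epsilon>'" for R
  proof -
    interpret finite_measure R by (rule R)
    have [measurable]: "U N \<in> sets R" "V N \<in> sets R" "(\<Union>i. a i) \<in> sets R" using aR BR by (auto simp: U_def V_def)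
    have "((\<Union>i. a i) - V N) \<union> (V N - (\<Union>i. a i)) \<subseteq> ((\<Union>i. a i) - U N) \<union> (\<Union>i<N. (a i - B i) \<union> (B i - a i))"
      by (auto simp: U_def V_def)
    then have "measure R (((\<Union>i. a i) - V N) \<union> (V N - (\<Union>i. a i))) \<le> measure R (((\<Union>i. a i) - U N) \<union> (\<Union>i<N. (a i - B i) \<union> (B i - a i)))"
      using aR BR by (intro finite_measure_mono) (auto intro!: sets.Un sets.Diff sets.finite_UN)
    also have "\<dots> \<le> measure R ((\<Union>i. a i) - U N) + measure R (\<Union>i<N. (a i - B i) \<union> (B i - a i))"
      using aR BR by (intro measure_Un_le) auto
    also have "measure R ((\<Union>i. a i) - U N) = measure R (\<Union>i. a i) - measure R (U N)"
      by (rule finite_measure_Diff) (use aR in \<open>auto simp: U_def\<close>)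
    also have "measure R (\<Union>i<N. (a i - B i) \<union> (B i - a i)) \<le> (\<Sum>i<N. measure R ((a i - B i) \<union> (B i - a i)))"
      using aR BR by (intro measure_UNION_le) auto
    also have "\<dots> \<le> (\<Sum>i<N. \<epsilon>')" using eR by (intro sum_mono less_imp_le) auto
    also have "\<dots> \<le> \<epsilon>/2" using e' Union.prems by (simp add: \<epsilon>'_def field_simps)
    finally show ?thesis using NR by simp
  qed
  show ?case
    using bound[OF P(1) am(1) Bm(1) N(1) B(2)] bound[OF Q(1) am(2) Bm(2) N(2) B(3)] VC by blast
qed

lemma PiM_cylinder_approximation:
  assumes P: "finite_measure P" "sets P = sets (PiM I M)" and Q: "finite_measure Q" "sets Q = sets (PiM I M)"
    and A: "A \<in> sets (PiM I M)" and e: "\<epsilon> > 0"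
  obtains J B where "finite J" "J \<subseteq> I" "B \<in> sets (PiM J M)"
    "measure P ((A - prod_emb I M J B) \<union> (prod_emb I M J B - A)) < \<epsilon>"
    "measure Q ((A - prod_emb I M J B) \<union> (prod_emb I M J B - A)) < \<epsilon>"
proof -
  define C where "C = {prod_emb I M J B | J B. finite J \<and> J \<subseteq> I \<and> B \<in> sets (PiM J M)}"
  have "\<exists>B\<in>C. measure P ((A - B) \<union> (B - A)) < \<epsilon> \<and> measure Q ((A - B) \<union> (B - A)) < \<epsilon>"
  proof (rule sigma_sets_approximation[OF P(1) P(2)[unfolded sets_PiM] Q(1) Q(2)[unfolded sets_PiM]])
    show "C \<subseteq> sigma_sets (\<Pi>\<^sub>E i\<in>I. space (M i)) (prod_algebra I M)"
      unfolding sets_PiM[symmetric] C_def by auto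
    show "prod_algebra I M \<subseteq> C"
    proof
      fix X assume "X \<in> prod_algebra I M"
      then show "X \<in> C"
      proof (rule prod_algebraE)
        fix J E assume "X = prod_emb I M J (\<Pi>\<^sub>E j\<in>J. E j)" "finite J" "J \<subseteq> I" "\<And>i. i \<in> J \<Longrightarrow> E i \<in> sets (M i)"
        then show "X \<in> C" unfolding C_def using sets_PiM_I_finite[of J E M] by blast
      qed
    qed
    show "{} \<in> C" unfolding C_def by (intro CollectI exI[of _ "{}"]) auto
    show "prod_algebra I M \<subseteq> Pow (\<Pi>\<^sub>E i\<in>I. space (M i))" by (rule prod_algebra_sets_into_space)
    show "(\<Pi>\<^sub>E i\<in>I. space (M i)) - B \<in> C" if BC: "B \<in> C" for B
    proof -
      obtain J B' where J: "B = prod_emb I M J B'" "finite J" "J \<subseteq> I" "B' \<in> sets (PiM J M)" using BC by (auto simp: C_def)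
      have "(\<Pi>\<^sub>E i\<in>I. space (M i)) - B = prod_emb I M J (space (PiM J M) - B')"
        unfolding J(1) using subsetD[OF J(3)] by (auto simp: prod_emb_iff space_PiM PiE_iff intro: extensional_arb)
      then show ?thesis using J unfolding C_def by blast
    qed
    show "B1 \<union> B2 \<in> C" if B: "B1 \<in> C" "B2 \<in> C" for B1 B2
    proof -
      obtain J1 B1' where J1: "B1 = prod_emb I M J1 B1'" "finite J1" "J1 \<subseteq> I" "B1' \<in> sets (PiM J1 M)" using B(1) by (auto simp: C_def)
      obtain J2 B2' where J2: "B2 = prod_emb I M J2 B2'" "finite J2" "J2 \<subseteq> I" "B2' \<in> sets (PiM J2 M)" using B(2) by (auto simp: C_def)
      have "B1 \<union> B2 = prod_emb I M (J1 \<union> J2) (prod_emb (J1 \<union> J2) M J1 B1' \<union> prod_emb (J1 \<union> J2) M J2 B2')"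
        using J1 J2 by (simp add: prod_emb_Un)
      moreover have "prod_emb (J1 \<union> J2) M J1 B1' \<union> prod_emb (J1 \<union> J2) M J2 B2' \<in> sets (PiM (J1 \<union> J2) M)"
        using J1 J2 by (intro sets.Un measurable_prod_emb) auto
      ultimately show ?thesis unfolding C_def using J1(2,3) J2(2,3) by blast
    qed
    show "A \<in> sigma_sets (\<Pi>\<^sub>E i\<in>I. space (M i)) (prod_algebra I M)" using A unfolding sets_PiM .
  qed (rule e)
  then show ?thesis using that unfolding C_def by blast
qed

section \<open>Divergence and uniform absolute continuity\<close>

lemma divergence_tail_small:
  fixes J \<eta> :: real
  assumes "J \<ge> 0" "\<eta> > 0"
  obtains m where "m > 1" "J / ((1 - 1 / m) * ln m) < \<eta>"
proof -
  \<comment> \<open>With \<open>m\<close> at least 2 and \<open>ln m \<ge> l\<close> the denominator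
    is at least \<open>l / 2\<close>, so \<open>2 * J / l < \<eta>\<close> is wanted; the
    \<open>+ 1\<close> makes this strict and keeps \<open>l\<close> positive for
    \<open>J = 0\<close>.\<close>
  define l where "l = 2 * J / \<eta> + 1"
  define m where "m = max 2 (exp l)"
  have l: "l > 0" using assms by (simp add: l_def add_nonneg_pos)
  have lm: "ln m \<ge> l"
    by (metis exp_gt_zero ln_exp ln_le_cancel_iff m_def max.cobounded2 max.strict_coboundedI2)
  have "m \<ge> 2" by (simp add: m_def)
  then have "1 / m \<le> 1 / 2" by (intro divide_left_mono) auto
  then have "(1/2) * l \<le> (1 - 1 / m) * ln m" using lm l by (intro mult_mono) auto
  then have "J / ((1 - 1 / m) * ln m) \<le> J / ((1/2) * l)" using assms l by (intro divide_left_mono mult_pos_pos) (use \<open>m \<ge> 2\<close> in \<open>auto intro: less_le_trans[OF _ lm] simp: field_simps\<close>)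
  also have "\<dots> < \<eta>" using assms l by (simp add: l_def field_simps)
  finally show ?thesis using that[of m] \<open>m \<ge> 2\<close> by auto
qed

text \<open>The order of choices matters: \<open>m\<close> is fixed first to make the remainder
  small, and only then is the null set approximated by a cylinder, closely enough that
  \<open>m\<close> times the error is still small.\<close>

lemma absolutely_continuous_PiM_of_cylinders:
  assumes P: "finite_measure P" "sets P = sets (PiM I M)" and Q: "finite_measure Q" "sets Q = sets (PiM I M)"
    and J: "J \<ge> 0"
    and bound: "\<And>m S B. m > 1 \<Longrightarrow> finite S \<Longrightarrow> S \<subseteq> I \<Longrightarrow> B \<in> sets (PiM S M) \<Longrightarrow>
       measure Q (prod_emb I M S B) \<le> m * measure P (prod_emb I M S B) + J / ((1 - 1 / m) * ln m)"
  shows "absolutely_continuous P Q"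
  unfolding absolutely_continuous_def
proof
  interpret P: finite_measure P by (rule P)
  interpret Q: finite_measure Q by (rule Q)
  fix A assume "A \<in> null_sets P"
  then have A: "A \<in> sets (PiM I M)" "measure P A = 0" using P by (auto simp: measure_def null_sets_def)
  have "measure Q A \<le> 0 + e" if e: "e > 0" for e :: real
  proof -
    have "e / 2 > 0" using e by simp
    from divergence_tail_small[OF J this] obtain m where m: "m > 1" "J / ((1 - 1 / m) * ln m) < e / 2" by metis
    define \<epsilon> where "\<epsilon> = e / (2 * (m + 1))"
    have \<epsilon>: "\<epsilon> > 0" using e m by (simp add: \<epsilon>_def)
    obtain S B where S: "finite S" "S \<subseteq> I" "B \<in> sets (PiM S M)"
      "measure P ((A - prod_emb I M S B) \<union> (prod_emb I M S B - A)) < \<epsilon>"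
      "measure Q ((A - prod_emb I M S B) \<union> (prod_emb I M S B - A)) < \<epsilon>"
      using PiM_cylinder_approximation[OF P Q A(1) \<epsilon>] by metis
    define E where "E = prod_emb I M S B"
    have E: "E \<in> sets (PiM I M)" using S by (auto simp: E_def)
    have "measure Q A \<le> measure Q (E \<union> ((A - E) \<union> (E - A)))"
      using A E Q by (intro Q.finite_measure_mono) auto
    also have "\<dots> \<le> measure Q E + measure Q ((A - E) \<union> (E - A))"
      using A E Q by (intro measure_Un_le) auto
    also have "\<dots> \<le> (m * measure P E + J / ((1 - 1 / m) * ln m)) + \<epsilon>"
      using bound[OF m(1) S(1-3)] S(5) by (simp add: E_def)
    also have "measure P E \<le> measure P (A \<union> ((A - E) \<union> (E - A)))"
      using A E P by (intro P.finite_measure_mono) auto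
    also have "\<dots> \<le> measure P A + measure P ((A - E) \<union> (E - A))"
      using A E P by (intro measure_Un_le) auto
    also have "\<dots> \<le> \<epsilon>" using A S(4) by (simp add: E_def)
    finally have "measure Q A \<le> m * \<epsilon> + J / ((1 - 1 / m) * ln m) + \<epsilon>" using m by simp
    also have "\<dots> \<le> (m + 1) * \<epsilon> + e / 2" using m by (simp add: distrib_right)
    also have "(m + 1) * \<epsilon> = e / 2" using m unfolding \<epsilon>_def by (simp add: divide_simps)
    finally show ?thesis by simp
  qed
  then have "measure Q A \<le> 0" by (rule field_le_epsilon)
  then show "A \<in> null_sets Q"
    using A Q by (auto simp: null_sets_def Q.emeasure_eq_measure measure_le_0_iff)
qed

text \<open>The integrand \<open>(h - 1) ln h\<close> of the symmetrized divergence is nonnegative; up to the factor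
  \<open>(1 - 1 / m) ln m\<close> it dominates \<open>h\<close> where \<open>h > m\<close> and \<open>1\<close> where \<open>h < 1 / m\<close>.\<close>

lemma divergence_bound:
  assumes M: "prob_space M" and hm[measurable]: "h \<in> borel_measurable M" and hpos: "\<And>x. h x > 0"
    and N: "N = density M (\<lambda>x. ennreal (h x))" "prob_space N"
    and LM: "integrable M (\<lambda>x. ln (h x))" and LN: "integrable N (\<lambda>x. ln (h x))"
    and J: "(\<integral>x. ln (h x) \<partial>N) - (\<integral>x. ln (h x) \<partial>M) \<le> J" and m: "m > 1" and B: "B \<in> sets M"
  shows "measure N B \<le> m * measure M B + J / ((1 - 1 / m) * ln m)"
    and "measure M B \<le> m * measure N B + J / ((1 - 1 / m) * ln m)"
    and "J \<ge> 0"
proof -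
  interpret M: prob_space M by (rule M)
  interpret N: prob_space N by (rule N)
  have [measurable]: "B \<in> sets M" by (rule B)
  \<comment> \<open>\<open>N\<close> has density \<open>h\<close>, so the integral of
    \<open>D\<close> under \<open>M\<close> is the difference of the two expectations of
    \<open>ln (h x)\<close>.\<close>
  define D where "D x = (h x - 1) * ln (h x)" for x
  have hL: "integrable M (\<lambda>x. h x *\<^sub>R ln (h x))" and hL': "(\<integral>x. ln (h x) \<partial>N) = (\<integral>x. h x *\<^sub>R ln (h x) \<partial>M)"
    using LN integrable_density[of "\<lambda>x. ln (h x)" M h] integral_density[of "\<lambda>x. ln (h x)" M h] hpos
    unfolding N(1) by (auto simp: less_imp_le)
  have Di: "integrable M D" and DJ: "(\<integral>x. D x \<partial>M) \<le> J"
    using hL LM J hL' unfolding D_def left_diff_distrib by auto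
  have D0: "D x \<ge> 0" for x
    unfolding D_def using hpos[of x] by (cases "h x \<ge> 1") (auto intro: mult_nonneg_nonneg mult_nonpos_nonpos)
  have "0 \<le> (\<integral>x. D x \<partial>M)" by (rule integral_nonneg_AE) (simp add: D0)
  then show J0: "J \<ge> 0" using DJ by simp
  define t where "t = (1 - 1 / m) * ln m"
  have t: "t > 0" using m by (simp add: t_def)
  have one: "(\<integral>\<^sup>+x. ennreal (h x) \<partial>M) = 1"
    using N.emeasure_space_1 unfolding N(1) by (simp add: emeasure_density cong: nn_integral_cong)
  have hi: "integrable M h"
    using one hpos by (intro integrableI_nonneg) (auto intro: less_imp_le)
  have NB: "measure N B = (\<integral>x. h x * indicator B x \<partial>M)"
  proof -
    have "measure N B = (\<integral>x. indicator B x \<partial>N)" using B by (simp add: N(1))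
    also have "\<dots> = (\<integral>x. h x *\<^sub>R indicator B x \<partial>M)"
      unfolding N(1) using hpos by (subst integral_density) (auto intro: less_imp_le)
    finally show ?thesis by simp
  qed
  have MB: "measure M B = (\<integral>x. indicator B x \<partial>M)" using B by simp
  have ib: "integrable M (\<lambda>x. indicator B x :: real)" by (simp add: M.emeasure_eq_measure)
  have hb: "integrable M (\<lambda>x. h x * indicator B x)"
    by (rule Bochner_Integration.integrable_bound[OF hi]) (auto simp: indicator_def)
  have i1: "integrable M (\<lambda>x. m * indicator B x + D x / t)"
    by (intro Bochner_Integration.integrable_add integrable_mult_right ib integrable_divide Di)
  have i2: "integrable M (\<lambda>x. m * (h x * indicator B x) + D x / t)"
    by (intro Bochner_Integration.integrable_add integrable_mult_right hb integrable_divide Di)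
  have k1: "h x * indicator B x \<le> m * indicator B x + D x / t" for x
  proof (cases "h x \<le> m")
    case True
    moreover have "D x / t \<ge> 0" using D0[of x] t by simp
    ultimately show ?thesis by (auto simp: indicator_def)
  next
    case False
    have "h x * t = (h x - h x / m) * ln m" by (simp add: t_def algebra_simps)
    also have "\<dots> \<le> (h x - 1) * ln (h x)"
      using False m hpos[of x] by (intro mult_mono) (auto simp: field_simps)
    finally have "h x \<le> D x / t" using t by (simp add: D_def field_simps)
    then show ?thesis using False m D0[of x] t by (auto simp: indicator_def)
  qed
  have "(\<integral>x. h x * indicator B x \<partial>M) \<le> (\<integral>x. m * indicator B x + D x / t \<partial>M)"
    by (rule Bochner_Integration.integral_mono[OF hb i1 k1])
  then have "measure N B \<le> (\<integral>x. m * indicator B x + D x / t \<partial>M)"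
    by (simp only: NB)
  also have "\<dots> = m * measure M B + (\<integral>x. D x \<partial>M) / t"
    unfolding MB using ib Di by simp
  also have "\<dots> \<le> m * measure M B + J / t" using DJ t by (simp add: divide_right_mono)
  finally show "measure N B \<le> m * measure M B + J / ((1 - 1 / m) * ln m)" by (simp add: t_def)
  have k2: "indicator B x \<le> m * (h x * indicator B x) + D x / t" for x
  proof (cases "h x \<ge> 1 / m")
    case True
    then have "1 \<le> m * h x" using m by (simp add: field_simps)
    then show ?thesis using D0[of x] t by (auto simp: indicator_def intro: add_increasing2)
  next
    case False
    have "ln m \<le> - ln (h x)"
    proof -
      have "ln (h x) \<le> ln (1 / m)" using False hpos[of x] m by (subst ln_le_cancel_iff) auto
      then show ?thesis using m by (simp add: ln_div)
    qed
    moreover have "1 / m \<le> 1" "ln m \<ge> 0" using m by auto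
    ultimately have "t \<le> (1 - h x) * (- ln (h x))"
      unfolding t_def using False by (intro mult_mono) linarith+
    also have "\<dots> = D x" by (simp add: D_def algebra_simps)
    finally have "1 \<le> D x / t" using t by simp
    moreover have "0 \<le> m * (h x * indicator B x)" using m hpos[of x] by simp
    ultimately show ?thesis by (auto simp: indicator_def)
  qed
  have "(\<integral>x. indicator B x \<partial>M) \<le> (\<integral>x. m * (h x * indicator B x) + D x / t \<partial>M)"
    by (rule Bochner_Integration.integral_mono[OF ib i2 k2])
  then have "measure M B \<le> (\<integral>x. m * (h x * indicator B x) + D x / t \<partial>M)"
    by (simp only: MB)
  also have "\<dots> = m * measure N B + (\<integral>x. D x \<partial>M) / t"
    using hb Di by (simp add: NB)
  also have "\<dots> \<le> m * measure N B + J / t" using DJ t by (simp add: divide_right_mono)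
  finally show "measure M B \<le> m * measure N B + J / ((1 - 1 / m) * ln m)" by (simp add: t_def)
qed

section \<open>Joint laws from characteristic functions\<close>

text \<open>With \<open>g\<close>, normalized, as density the law of \<open>Z\<close> has the
  characteristic function of \<open>N\<close>, and Levy's uniqueness theorem applies. A weight with
  integral 0 vanishes almost surely, and then both sides are 0.\<close>

lemma (in prob_space) weighted_law_unique:
  fixes g Z :: "'a \<Rightarrow> real"
  assumes N: "real_distribution N" and [measurable]: "g \<in> borel_measurable M" "Z \<in> borel_measurable M"
    and g: "\<And>w. 0 \<le> g w" "\<And>w. g w \<le> b"
    and char: "\<And>a. (\<integral>w. complex_of_real (g w) * iexp (a * Z w) \<partial>M) = complex_of_real (\<integral>w. g w \<partial>M) * char N a"
    and A: "A \<in> sets borel"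
  shows "(\<integral>w. g w * indicator A (Z w) \<partial>M) = (\<integral>w. g w \<partial>M) * measure N A"
proof -
  interpret N: real_distribution N by (rule N)
  have gi: "integrable M g" by (rule integrable_const_bound[of _ b]) (use g in auto)
  define z where "z = (\<integral>w. g w \<partial>M)"
  have z0: "z \<ge> 0" unfolding z_def by (intro integral_nonneg_AE) (simp add: g)
  show ?thesis
  proof (cases "z = 0")
    case True
    then have "AE w in M. g w = 0"
      using integral_nonneg_eq_0_iff_AE[OF gi] g by (auto simp: z_def)
    then have "(\<integral>w. g w * indicator A (Z w) \<partial>M) = (\<integral>w. 0 \<partial>M)"
      using A by (intro integral_cong_AE) auto
    then show ?thesis using True by (simp add: z_def)
  next
    case False
    then have z: "z > 0" using z0 by simp
    define M' where "M' = density M (\<lambda>w. ennreal (g w / z))"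
    have "emeasure M' (space M') = (\<integral>\<^sup>+w. ennreal (g w / z) \<partial>M)"
      unfolding M'_def by (subst emeasure_density) (auto cong: nn_integral_cong)
    also have "\<dots> = ennreal (\<integral>w. g w / z \<partial>M)"
      using gi g z by (intro nn_integral_eq_integral) auto
    also have "\<dots> = 1" using z by (simp add: z_def)
    finally have "prob_space M'" by (rule prob_spaceI)
    then interpret M': prob_space M' .
    have [measurable_cong]: "sets M' = sets M" by (simp add: M'_def)
    have Zm: "Z \<in> borel_measurable M'" by measurable
    have "real_distribution (distr M' borel Z)"
      by (rule M'.real_distribution_distr[OF Zm])
    moreover have "char (distr M' borel Z) = char N"
    proof
      fix a
      have "char (distr M' borel Z) a = (\<integral>w. iexp (a * Z w) \<partial>M')"
        unfolding char_def by (subst integral_distr) auto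
      also have "\<dots> = (\<integral>w. (g w / z) *\<^sub>R iexp (a * Z w) \<partial>M)"
        unfolding M'_def using g z by (subst integral_density) auto
      also have "\<dots> = (\<integral>w. complex_of_real (1 / z) * (complex_of_real (g w) * iexp (a * Z w)) \<partial>M)"
        by (intro Bochner_Integration.integral_cong) (auto simp: scaleR_conv_of_real)
      also have "\<dots> = complex_of_real (1 / z) * (complex_of_real z * char N a)"
        unfolding integral_mult_right_zero char z_def ..
      also have "\<dots> = char N a" using z by simp
      finally show "char (distr M' borel Z) a = char N a" .
    qed
    ultimately have eq: "distr M' borel Z = N" by (rule Levy_uniqueness[OF _ N])
    have "measure N A = measure M' (Z -` A \<inter> space M')"
      unfolding eq[symmetric] using A by (subst measure_distr) auto
    also have "\<dots> = (\<integral>w. indicator (Z -` A \<inter> space M') w \<partial>M')"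
      using A by simp
    also have "\<dots> = (\<integral>w. (g w / z) *\<^sub>R indicator (Z -` A \<inter> space M') w \<partial>M)"
      unfolding M'_def using g z A by (subst integral_density) (auto simp: space_density)
    also have "\<dots> = (\<integral>w. (1 / z) * (g w * indicator A (Z w)) \<partial>M)"
      by (intro Bochner_Integration.integral_cong) (auto simp: indicator_def M'_def)
    also have "\<dots> = (\<integral>w. g w * indicator A (Z w) \<partial>M) / z" by simp
    finally show ?thesis using z by (simp add: z_def field_simps)
  qed
qed

text \<open>Uniqueness on the real line is enough when coordinates are converted one at a time from
  exponentials to indicators. After \<open>k\<close> conversions the exponential involves only the
  coordinates from \<open>k\<close> on, which is why \<open>b\<close> vanishes below
  \<open>k\<close>.\<close>

lemma (in prob_space) partial_joint_law_of_char:
  fixes Y :: "nat \<Rightarrow> 'a \<Rightarrow> real"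
  assumes N: "\<And>i. i < n \<Longrightarrow> real_distribution (N i)" and Y[measurable]: "\<And>i. i < n \<Longrightarrow> Y i \<in> borel_measurable M"
    and char: "\<And>b. (\<integral>w. iexp (\<Sum>i<n. b i * Y i w) \<partial>M) = (\<Prod>i<n. char (N i) (b i))"
    and A[measurable]: "\<And>i. i < n \<Longrightarrow> A i \<in> sets borel" and "k \<le> n" and "\<And>i. i < k \<Longrightarrow> b i = 0"
  shows "(\<integral>w. complex_of_real (\<Prod>i<k. indicator (A i) (Y i w)) * iexp (\<Sum>i<n. b i * Y i w) \<partial>M) =
    complex_of_real (\<Prod>i<k. measure (N i) (A i)) * (\<Prod>i<n. char (N i) (b i))"
  using assms(5,6)
proof (induction k arbitrary: b)
  case 0
  then show ?case using char by simp
next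
  case (Suc k)
  define W where "W w = (\<Prod>i<k. indicator (A i) (Y i w) :: real)" for w
  have Wm[measurable]: "W \<in> borel_measurable M"
    unfolding W_def using Suc.prems(1) by (intro borel_measurable_prod borel_measurable_indicator') auto
  have W01: "0 \<le> W w" "W w \<le> 1" for w
    unfolding W_def by (auto intro!: prod_nonneg prod_le_1)
  have W2: "W w \<le> 2" for w using W01(2)[of w] by simp
  have IH: "(\<integral>w. complex_of_real (W w) * iexp (\<Sum>i<n. b i * Y i w) \<partial>M) =
    complex_of_real (\<Prod>i<k. measure (N i) (A i)) * (\<Prod>i<n. char (N i) (b i))" if "\<And>i. i < k \<Longrightarrow> b i = 0" for b
    unfolding W_def using Suc.IH[of b] that Suc.prems(1) by simp
  have kn: "k < n" using Suc.prems by simp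
  interpret Nk: real_distribution "N k" by (rule N[OF kn])
  define P where "P = complex_of_real (\<Prod>i<k. measure (N i) (A i))"
  define ch where "ch a = char (N k) a" for a
  define S where "S w = (\<Sum>i<n. b i * Y i w)" for w
  define c where "c b = (\<Prod>i<n. char (N i) (b i))" for b
  have [measurable]: "S \<in> borel_measurable M" "Y k \<in> borel_measurable M"
    unfolding S_def using Y kn by auto
  have bk: "b i = 0" if "i \<le> k" for i using Suc.prems(2) that by simp
  have zero: "c (\<lambda>_. 0) = 1" unfolding c_def
    by (intro prod.neutral) (use N in \<open>auto simp: real_distribution.char_zero\<close>)
  \<comment> \<open>Since \<open>b k = 0\<close>, the frequency of coordinate \<open>k\<close> is
    free and may be set to \<open>a\<close>. The scaling \<open>s\<close> will be 0, 1 or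
    -1.\<close>
  have E: "(\<integral>w. complex_of_real (W w) * iexp (s * S w + a * Y k w) \<partial>M) = P * (c (\<lambda>i. s * b i) * ch a)" for s a
  proof -
    let ?b = "(\<lambda>i. s * b i)(k := a)"
    have "(\<Sum>i<n. ?b i * Y i w) = s * S w + a * Y k w" for w
    proof -
      have "(\<Sum>i<n. ?b i * Y i w) = (\<Sum>i<n. s * (b i * Y i w) + (if i = k then a * Y k w else 0))"
        using bk[of k] by (intro sum.cong) auto
      also have "\<dots> = s * S w + a * Y k w"
        using kn by (simp add: sum.distrib S_def sum_distrib_left)
      finally show ?thesis .
    qed
    moreover have "(\<Prod>i<n. char (N i) (?b i)) = c (\<lambda>i. s * b i) * ch a"
    proof -
      have "(\<Prod>i<n. char (N i) (?b i)) = (\<Prod>i<n. char (N i) (s * b i) * (if i = k then ch a else 1))"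
        using bk[of k] Nk.char_zero by (intro prod.cong) (auto simp: ch_def)
      also have "\<dots> = c (\<lambda>i. s * b i) * ch a" using kn by (simp add: prod.distrib c_def)
      finally show ?thesis .
    qed
    ultimately show ?thesis using IH[of ?b] bk by (simp add: P_def)
  qed
  have int: "integrable M (\<lambda>w. complex_of_real (W w) * iexp (s * S w + a * Y k w))" for s a
    by (rule integrable_const_bound[of _ 1]) (use W01 in \<open>auto simp: norm_mult\<close>)
  \<comment> \<open>The phase \<theta> treats the real and the imaginary part of the exponential
    together: they are the cosines with \<theta> equal to 0 and \<open>pi / 2\<close>.\<close>
  have cosE: "(\<integral>w. W w * cos (S w - \<theta>) * indicator (A k) (Y k w) \<partial>M) = (\<integral>w. W w * cos (S w - \<theta>) \<partial>M) * measure (N k) (A k)" for \<theta>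
  proof -
    define z where "z = exp (- (\<i> * complex_of_real \<theta>))"
    define z' where "z' = exp (\<i> * complex_of_real \<theta>)"
    have cos_eq: "complex_of_real (cos (S w - \<theta>)) = (z * iexp (S w) + z' * iexp (- S w)) / 2" for w
      by (simp add: z_def z'_def cos_of_real[symmetric] cos_exp_eq exp_add[symmetric] algebra_simps)
    \<comment> \<open>Levy's theorem needs a nonnegative weight, whence the summand \<open>1\<close>.\<close>
    define g where "g w = W w * (1 + cos (S w - \<theta>))" for w
    have [measurable]: "g \<in> borel_measurable M" unfolding g_def by measurable
    have gW: "0 \<le> g w" "g w \<le> 2" for w
    proof -
      have c: "0 \<le> 1 + cos (S w - \<theta>)" "1 + cos (S w - \<theta>) \<le> 2"
        using cos_ge_minus_one[of "S w - \<theta>"] cos_le_one[of "S w - \<theta>"] by linarith+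
      show "0 \<le> g w" unfolding g_def by (rule mult_nonneg_nonneg[OF W01(1) c(1)])
      have "g w \<le> 1 * 2" unfolding g_def by (intro mult_mono W01 c) auto
      then show "g w \<le> 2" by simp
    qed
    define K where "K = P * (1 + (z / 2) * c (\<lambda>i. 1 * b i) + (z' / 2) * c (\<lambda>i. -1 * b i))"
    have gE: "(\<integral>w. complex_of_real (g w) * iexp (a * Y k w) \<partial>M) = K * ch a" for a
    proof -
      have "complex_of_real (g w) * iexp (a * Y k w) = complex_of_real (W w) * iexp (0 * S w + a * Y k w) +
         (z / 2) * (complex_of_real (W w) * iexp (1 * S w + a * Y k w)) +
         (z' / 2) * (complex_of_real (W w) * iexp (-1 * S w + a * Y k w))" for w
        unfolding g_def of_real_mult of_real_add cos_eq
          by (simp add: distrib_left add_divide_distrib algebra_simps) (simp add: exp_add exp_diff exp_minus field_simps)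
      then have "(\<integral>w. complex_of_real (g w) * iexp (a * Y k w) \<partial>M) =
         P * (c (\<lambda>i. 0 * b i) * ch a) + (z / 2) * (P * (c (\<lambda>i. 1 * b i) * ch a)) + (z' / 2) * (P * (c (\<lambda>i. -1 * b i) * ch a))"
        unfolding E[symmetric] using int[of 0 a] int[of 1 a] int[of "-1" a] by simp
      then show ?thesis using zero by (simp add: K_def algebra_simps)
    qed
    have gi: "integrable M g" by (rule integrable_const_bound[of _ 2]) (use gW in auto)
    have K: "complex_of_real (\<integral>w. g w \<partial>M) = K"
      using gE[of 0] Nk.char_zero by (simp add: ch_def)
    have 1: "(\<integral>w. g w * indicator (A k) (Y k w) \<partial>M) = (\<integral>w. g w \<partial>M) * measure (N k) (A k)"
      by (rule weighted_law_unique[OF N[OF kn] _ _ gW]) (use gE K A kn in \<open>auto simp: ch_def\<close>)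
    have 2: "(\<integral>w. W w * indicator (A k) (Y k w) \<partial>M) = (\<integral>w. W w \<partial>M) * measure (N k) (A k)"
    proof (rule weighted_law_unique[OF N[OF kn] _ _ W01])
      fix a
      have "(\<integral>w. complex_of_real (W w) * iexp (a * Y k w) \<partial>M) = P * ch a" for a
        using E[of 0 a] zero by simp
      note this[of a] this[of 0]
      then show "(\<integral>w. complex_of_real (W w) * iexp (a * Y k w) \<partial>M) = complex_of_real (\<integral>w. W w \<partial>M) * char (N k) a"
        using Nk.char_zero by (simp add: ch_def)
    qed (use A kn in auto)
    have i: "integrable M W" "integrable M (\<lambda>w. W w * indicator (A k) (Y k w))" "integrable M (\<lambda>w. g w * indicator (A k) (Y k w))"
      using gW W01 W2 A[OF kn] by (auto intro!: integrable_const_bound[of _ 2] simp: indicator_def)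
    \<comment> \<open>Both \<open>g\<close> and \<open>W\<close> are nonnegative weights, and their
      difference is the signed weight in question.\<close>
    have "(\<integral>w. W w * cos (S w - \<theta>) * indicator (A k) (Y k w) \<partial>M) = (\<integral>w. g w * indicator (A k) (Y k w) - W w * indicator (A k) (Y k w) \<partial>M)"
      by (intro Bochner_Integration.integral_cong) (auto simp: g_def algebra_simps)
    also have "\<dots> = ((\<integral>w. g w \<partial>M) - (\<integral>w. W w \<partial>M)) * measure (N k) (A k)"
      using i 1 2 by (simp add: left_diff_distrib)
    also have "(\<integral>w. g w \<partial>M) - (\<integral>w. W w \<partial>M) = (\<integral>w. g w - W w \<partial>M)" using gi i by simp
    also have "\<dots> = (\<integral>w. W w * cos (S w - \<theta>) \<partial>M)"
      by (intro Bochner_Integration.integral_cong) (auto simp: g_def algebra_simps)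
    finally show ?thesis .
  qed
  let ?I = "\<lambda>w. indicator (A k) (Y k w) :: real"
  have Im[measurable]: "?I \<in> borel_measurable M" using A[OF kn] by measurable
  have split: "complex_of_real v * iexp (S w) = complex_of_real (v * cos (S w - 0)) + \<i> * complex_of_real (v * cos (S w - pi/2))" for v w
    by (simp add: exp_Euler cos_of_real sin_of_real cos_diff algebra_simps)
  have icos: "integrable M (\<lambda>w. W w * cos (S w - \<theta>) * ?I w)" "integrable M (\<lambda>w. W w * cos (S w - \<theta>))" for \<theta>
  proof -
    have Wc: "norm (W w * cos (S w - \<theta>)) \<le> 1" for w
      using W01[of w] by (simp add: abs_mult mult_le_one)
    then have "norm (W w * cos (S w - \<theta>) * ?I w) \<le> 1" for w
      by (cases "Y k w \<in> A k") auto
    then show "integrable M (\<lambda>w. W w * cos (S w - \<theta>) * ?I w)"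
      by (intro integrable_const_bound[of _ 1] AE_I2 borel_measurable_times Im) measurable
    show "integrable M (\<lambda>w. W w * cos (S w - \<theta>))"
      using Wc by (intro integrable_const_bound[of _ 1] AE_I2) measurable
  qed
  have "(\<integral>w. complex_of_real (W w * ?I w) * iexp (S w) \<partial>M) =
     (\<integral>w. complex_of_real (W w * cos (S w - 0) * ?I w) + \<i> * complex_of_real (W w * cos (S w - pi/2) * ?I w) \<partial>M)"
    unfolding split by (intro Bochner_Integration.integral_cong) (auto simp: mult_ac)
  also have "\<dots> = complex_of_real (\<integral>w. W w * cos (S w - 0) * ?I w \<partial>M) + \<i> * complex_of_real (\<integral>w. W w * cos (S w - pi/2) * ?I w \<partial>M)"
    using icos(1)[of 0] icos(1)[of "pi/2"] by (simp del: of_real_mult)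
  also have "\<dots> = (complex_of_real (\<integral>w. W w * cos (S w - 0) \<partial>M) + \<i> * complex_of_real (\<integral>w. W w * cos (S w - pi/2) \<partial>M)) * complex_of_real (measure (N k) (A k))"
    unfolding cosE by (simp add: algebra_simps)
  also have "complex_of_real (\<integral>w. W w * cos (S w - 0) \<partial>M) + \<i> * complex_of_real (\<integral>w. W w * cos (S w - pi/2) \<partial>M)
     = (\<integral>w. complex_of_real (W w) * iexp (S w) \<partial>M)"
    unfolding split using icos(2)[of 0] icos(2)[of "pi/2"] by (simp del: of_real_mult)
  also have "\<dots> = P * c b" using E[of 1 0] Nk.char_zero by (simp add: ch_def)
  finally show ?case
    by (simp add: W_def S_def P_def c_def lessThan_Suc mult_ac)
qed

lemma (in prob_space) joint_law_of_char:
  fixes Y :: "nat \<Rightarrow> 'a \<Rightarrow> real"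
  assumes N: "\<And>i. real_distribution (N i)" and Y: "\<And>i. i < n \<Longrightarrow> Y i \<in> borel_measurable M"
    and char: "\<And>b. (\<integral>w. iexp (\<Sum>i<n. b i * Y i w) \<partial>M) = (\<Prod>i<n. char (N i) (b i))"
  shows "distr M (\<Pi>\<^sub>M i\<in>{..<n}. borel) (\<lambda>w. \<lambda>i\<in>{..<n}. Y i w) = PiM {..<n} N"
proof -
  have pN: "prob_space (N i)" and sN: "sets (N i) = sets borel" for i
    using N[of i] by (auto simp: real_distribution_def real_distribution_axioms_def)
  interpret product_sigma_finite N
    by (rule product_sigma_finite.intro) (rule prob_space_imp_sigma_finite[OF pN])
  have m: "(\<lambda>w. \<lambda>i\<in>{..<n}. Y i w) \<in> measurable M (\<Pi>\<^sub>M i\<in>{..<n}. borel)"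
    by (intro measurable_restrict Y) auto
  show ?thesis
  proof (rule PiM_eqI)
    show "sets (distr M (\<Pi>\<^sub>M i\<in>{..<n}. borel) (\<lambda>w. \<lambda>i\<in>{..<n}. Y i w)) = sets (PiM {..<n} N)"
      by (simp add: sN cong: sets_PiM_cong)
    fix A assume "\<And>i. i \<in> {..<n} \<Longrightarrow> A i \<in> sets (N i)"
    then have A: "A i \<in> sets borel" if "i < n" for i using that sN by auto
    \<comment> \<open>With all coordinates converted and all frequencies 0, only the probability of
      a rectangle is left.\<close>
    have "complex_of_real (\<integral>w. (\<Prod>i<n. indicator (A i) (Y i w)) \<partial>M) = complex_of_real (\<Prod>i<n. measure (N i) (A i))"
      using partial_joint_law_of_char[where n=n and N=N and Y=Y and A=A and k=n and b="\<lambda>_. 0", OF N Y char A]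
      by (simp add: real_distribution.char_zero[OF N] del: of_real_prod)
    then have 1: "(\<integral>w. (\<Prod>i<n. indicator (A i) (Y i w)) \<partial>M) = (\<Prod>i<n. measure (N i) (A i))"
      using of_real_eq_iff by blast
    let ?E = "(\<lambda>w. \<lambda>i\<in>{..<n}. Y i w) -` (Pi\<^sub>E {..<n} A) \<inter> space M"
    have E: "?E \<in> sets M" using A by (intro measurable_sets[OF m] sets_PiM_I_finite) auto
    have "(\<Prod>i<n. indicator (A i) (Y i w)) = (indicator ?E w :: real)" if "w \<in> space M" for w
    proof (cases "\<forall>i<n. Y i w \<in> A i")
      case True
      then show ?thesis using that by (auto simp: PiE_iff)
    next
      case False
      then obtain i where "i < n" "Y i w \<notin> A i" by auto
      then have "(\<Prod>i<n. indicator (A i) (Y i w)) = (0::real)" by (intro prod_zero bexI[of _ i]) auto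
      moreover have "w \<notin> ?E" using \<open>i < n\<close> \<open>Y i w \<notin> A i\<close> by (auto simp: PiE_iff)
      ultimately show ?thesis by simp
    qed
    then have "(\<integral>w. (\<Prod>i<n. indicator (A i) (Y i w) :: real) \<partial>M) = (\<integral>w. indicator ?E w \<partial>M)"
      by (intro Bochner_Integration.integral_cong) auto
    also have "\<dots> = measure M ?E" using E by simp
    finally have "emeasure M ?E = ennreal (\<Prod>i<n. measure (N i) (A i))" using 1 by (simp add: emeasure_eq_measure)
    also have "\<dots> = (\<Prod>i<n. emeasure (N i) (A i))"
      using pN by (simp add: prod_ennreal finite_measure.emeasure_eq_measure prob_space.finite_measure)
    finally show "emeasure (distr M (\<Pi>\<^sub>M i\<in>{..<n}. borel) (\<lambda>w. \<lambda>i\<in>{..<n}. Y i w)) (Pi\<^sub>E {..<n} A) = (\<Prod>i\<in>{..<n}. emeasure (N i) (A i))"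
      using A by (subst emeasure_distr[OF m]) auto
  qed simp
qed

section \<open>Finite-dimensional laws of Gaussian fields\<close>

abbreviation normal_law :: "real \<Rightarrow> real measure" where
  "normal_law \<sigma> \<equiv> density lborel (\<lambda>x. ennreal (normal_density 0 \<sigma> x))"

lemma (in prob_space) normal_iexp:
  assumes \<sigma>: "\<sigma> > 0" and D: "distributed M lborel Y (normal_density 0 \<sigma>)"
  shows "(\<integral>w. iexp (a * Y w) \<partial>M) = complex_of_real (exp (- ((\<sigma> * a)\<^sup>2) / 2))"
proof -
  have Z: "distributed M lborel (\<lambda>x. (Y x - 0) / \<sigma>) std_normal_density"
    using D unfolding normal_standard_normal_convert[OF \<sigma>] .
  then have d: "distr M lborel (\<lambda>x. (Y x - 0) / \<sigma>) = std_normal_distribution"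
    by (rule distributed_distr_eq_density)
  have m: "(\<lambda>x. (Y x - 0) / \<sigma>) \<in> measurable M lborel" by (rule distributed_measurable[OF Z])
  have "char std_normal_distribution (\<sigma> * a) = (\<integral>w. iexp ((\<sigma> * a) * ((Y w - 0) / \<sigma>)) \<partial>M)"
    unfolding char_def d[symmetric] by (rule integral_distr[OF m]) measurable
  also have "\<dots> = (\<integral>w. iexp (a * Y w) \<partial>M)"
    using \<sigma> by (intro Bochner_Integration.integral_cong) auto
  finally show ?thesis by (simp add: char_std_normal_distribution)
qed

lemma (in prob_space) normal_second_moment:
  assumes \<sigma>: "\<sigma> > 0" and D: "distributed M lborel Y (normal_density 0 \<sigma>)"
  shows "integrable M (\<lambda>w. (Y w)\<^sup>2)" "(\<integral>w. (Y w)\<^sup>2 \<partial>M) = \<sigma>\<^sup>2"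
proof -
  show "integrable M (\<lambda>w. (Y w)\<^sup>2)"
    using integrable_normal_moment[OF \<sigma>, of 0 2] distributed_integrable[OF D, of "\<lambda>x. x\<^sup>2"] by simp
  show "(\<integral>w. (Y w)\<^sup>2 \<partial>M) = \<sigma>\<^sup>2"
    using normal_distributed_variance[OF \<sigma> D] normal_distributed_expectation[OF \<sigma> D] by simp
qed

lemma (in prob_space) centered_gaussian_moments:
  assumes "centered_gaussian M Y"
  shows "integrable M (\<lambda>w. (Y w)\<^sup>2)"
    and "(\<integral>w. iexp (Y w) \<partial>M) = complex_of_real (exp (- (\<integral>w. (Y w)\<^sup>2 \<partial>M) / 2))"
proof -
  have [measurable]: "Y \<in> borel_measurable M" using assms by (simp add: centered_gaussian_def)
  consider "AE w in M. Y w = 0" | \<sigma> where "\<sigma> > 0" "distributed M lborel Y (normal_density 0 \<sigma>)"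
    using assms by (auto simp: centered_gaussian_def)
  then have "integrable M (\<lambda>w. (Y w)\<^sup>2) \<and> (\<integral>w. iexp (Y w) \<partial>M) = complex_of_real (exp (- (\<integral>w. (Y w)\<^sup>2 \<partial>M) / 2))"
  proof cases
    case 1
    have "integrable M (\<lambda>w. (Y w)\<^sup>2) \<longleftrightarrow> integrable M (\<lambda>w. 0::real)"
      by (rule integrable_cong_AE) (use 1 in auto)
    moreover have "(\<integral>w. (Y w)\<^sup>2 \<partial>M) = (\<integral>w. 0 \<partial>M)"
      by (rule integral_cong_AE) (use 1 in auto)
    moreover have "(\<integral>w. iexp (Y w) \<partial>M) = (\<integral>w. 1 \<partial>M)"
      by (rule integral_cong_AE) (use 1 in auto)
    ultimately show ?thesis by (simp add: prob_space)
  next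
    case 2
    then show ?thesis using normal_iexp[OF 2, of 1] normal_second_moment[OF 2] by simp
  qed
  then show "integrable M (\<lambda>w. (Y w)\<^sup>2)"
    and "(\<integral>w. iexp (Y w) \<partial>M) = complex_of_real (exp (- (\<integral>w. (Y w)\<^sup>2 \<partial>M) / 2))" by auto
qed

lemma normal_law_real_distribution: "\<sigma> > 0 \<Longrightarrow> real_distribution (normal_law \<sigma>)"
  using prob_space_normal_density[of \<sigma> 0] by (auto simp: real_distribution_def real_distribution_axioms_def)

lemma char_normal_law:
  assumes \<sigma>: "\<sigma> > 0"
  shows "char (normal_law \<sigma>) a = complex_of_real (exp (- ((\<sigma> * a)\<^sup>2) / 2))"
proof -
  interpret prob_space "normal_law \<sigma>" by (rule prob_space_normal_density[OF \<sigma>])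
  have "distr (normal_law \<sigma>) lborel (\<lambda>x. x) = normal_law \<sigma>"
    by (rule measure_eqI) (auto simp: emeasure_distr)
  then have "distributed (normal_law \<sigma>) lborel (\<lambda>x. x) (normal_density 0 \<sigma>)"
    by (simp add: distributed_def)
  from normal_iexp[OF \<sigma> this, of a] show ?thesis by (simp add: char_def)
qed

section \<open>Likelihood ratios of centered normal laws\<close>

lemma normal_density_ratio:
  assumes "\<sigma> > 0"
  shows "ln (normal_density 0 \<sigma> x / normal_density 0 1 x) = - ln \<sigma> + x\<^sup>2 / 2 * (1 - 1 / \<sigma>\<^sup>2)"
proof -
  have "normal_density 0 \<sigma> x / normal_density 0 1 x = (1 / \<sigma>) * exp (x\<^sup>2 / 2 * (1 - 1 / \<sigma>\<^sup>2))"
    using assms by (simp add: normal_density_def real_sqrt_mult exp_diff[symmetric] exp_minus_inverse field_simps flip: exp_add)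
  then show ?thesis using assms by (simp add: ln_mult ln_div)
qed

text \<open>Product measures are determined by rectangles, on which the integral of the product of
  the ratios factorizes.\<close>

lemma PiM_normal_law_density:
  fixes n :: nat
  assumes \<sigma>: "\<And>k. \<sigma> k > 0"
  shows "PiM {..<n} (\<lambda>k. normal_law (\<sigma> k)) =
    density (PiM {..<n} (\<lambda>_. normal_law 1)) (\<lambda>x. ennreal (\<Prod>k<n. normal_density 0 (\<sigma> k) (x k) / normal_density 0 1 (x k)))"
    (is "_ = density ?P ?h")
proof -
  interpret N: product_sigma_finite "\<lambda>k. normal_law (\<sigma> k)"
    by (rule product_sigma_finite.intro) (intro prob_space_imp_sigma_finite prob_space_normal_density \<sigma>)
  interpret N1: product_sigma_finite "\<lambda>k::nat. normal_law 1"
    by (rule product_sigma_finite.intro) (intro prob_space_imp_sigma_finite prob_space_normal_density zero_less_one)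
  show ?thesis
  proof (rule N.PiM_eqI[symmetric])
    show "sets (density ?P ?h) = sets (PiM {..<n} (\<lambda>k. normal_law (\<sigma> k)))"
      by (simp cong: sets_PiM_cong)
    fix A assume A: "\<And>i. i \<in> {..<n} \<Longrightarrow> A i \<in> sets (normal_law (\<sigma> i))"
    define r where "r k x = normal_density 0 (\<sigma> k) x / normal_density 0 1 x" for k x
    have rpos: "r k x \<ge> 0" for k x by (simp add: r_def)
    have [measurable]: "r k \<in> borel_measurable borel" for k unfolding r_def by measurable
    have hm: "?h \<in> borel_measurable ?P" unfolding r_def[symmetric] by measurable
    have "emeasure (density ?P ?h) (Pi\<^sub>E {..<n} A) = (\<integral>\<^sup>+x. ?h x * indicator (Pi\<^sub>E {..<n} A) x \<partial>?P)"
      using A by (intro emeasure_density hm) (auto intro!: sets_PiM_I_finite)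
    also have "\<dots> = (\<integral>\<^sup>+x. (\<Prod>k<n. ennreal (r k (x k)) * indicator (A k) (x k)) \<partial>?P)"
    proof (rule nn_integral_cong)
      fix x assume x: "x \<in> space ?P"
      have "(\<Prod>k<n. indicator (A k) (x k)) = (indicator (Pi\<^sub>E {..<n} A) x :: ennreal)"
      proof (cases "\<forall>k<n. x k \<in> A k")
        case True
        then show ?thesis using x by (auto simp: PiE_iff space_PiM)
      next
        case False
        then obtain k where "k < n" "x k \<notin> A k" by auto
        then have "(\<Prod>k<n. indicator (A k) (x k)) = (0::ennreal)" by (intro prod_zero bexI[of _ k]) auto
        moreover have "x \<notin> Pi\<^sub>E {..<n} A" using \<open>k < n\<close> \<open>x k \<notin> A k\<close> by (auto simp: PiE_iff)
        ultimately show ?thesis by simp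
      qed
      then show "?h x * indicator (Pi\<^sub>E {..<n} A) x = (\<Prod>k<n. ennreal (r k (x k)) * indicator (A k) (x k))"
        by (simp add: prod.distrib prod_ennreal rpos flip: r_def)
    qed
    also have "\<dots> = (\<Prod>k<n. \<integral>\<^sup>+x. ennreal (r k x) * indicator (A k) x \<partial>normal_law 1)"
      by (rule N1.product_nn_integral_prod) (use A in auto)
    also have "\<dots> = (\<Prod>k<n. emeasure (normal_law (\<sigma> k)) (A k))"
    proof (rule prod.cong[OF refl])
      fix k assume k: "k \<in> {..<n}"
      have Ak[measurable]: "A k \<in> sets borel" using A[OF k] by simp
      have "(\<integral>\<^sup>+x. ennreal (r k x) * indicator (A k) x \<partial>normal_law 1) =
        (\<integral>\<^sup>+x. ennreal (normal_density 0 1 x) * (ennreal (r k x) * indicator (A k) x) \<partial>lborel)"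
        by (rule nn_integral_density) auto
      also have "\<dots> = (\<integral>\<^sup>+x. ennreal (normal_density 0 (\<sigma> k) x) * indicator (A k) x \<partial>lborel)"
      proof (rule nn_integral_cong)
        fix x :: real
        have "normal_density 0 1 x > 0" by (rule normal_density_pos) simp
        then have "normal_density 0 1 x * r k x = normal_density 0 (\<sigma> k) x" by (simp add: r_def)
        then show "ennreal (normal_density 0 1 x) * (ennreal (r k x) * indicator (A k) x) = ennreal (normal_density 0 (\<sigma> k) x) * indicator (A k) x"
          by (simp add: mult.assoc[symmetric] ennreal_mult[symmetric] rpos)
      qed
      also have "\<dots> = emeasure (normal_law (\<sigma> k)) (A k)"
        by (rule emeasure_density[symmetric]) auto
      finally show "(\<integral>\<^sup>+x. ennreal (r k x) * indicator (A k) x \<partial>normal_law 1) = emeasure (normal_law (\<sigma> k)) (A k)" .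
    qed
    finally show "emeasure (density ?P ?h) (Pi\<^sub>E {..<n} A) = (\<Prod>k\<in>{..<n}. emeasure (normal_law (\<sigma> k)) (A k))" .
  qed simp
qed

section \<open>Second moments of a field and laws of its combinations\<close>

definition cov :: "'w measure \<Rightarrow> ('i \<Rightarrow> 'w \<Rightarrow> real) \<Rightarrow> 'i \<Rightarrow> 'i \<Rightarrow> real" where
  "cov M X s t = (\<integral>w. X s w * X t w \<partial>M)"

lemma field_combination_gaussian:
  "centered_gaussian_field M X \<Longrightarrow> finite S \<Longrightarrow> centered_gaussian M (\<lambda>w. \<Sum>t\<in>S. a t * X t w)"
  by (simp add: centered_gaussian_field_def)

lemma field_measurable:
  assumes "centered_gaussian_field M X"
  shows "X t \<in> borel_measurable M"
  using field_combination_gaussian[OF assms, of "{t}" "\<lambda>_. 1"] by (simp add: centered_gaussian_def)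

lemma field_product_integrable:
  assumes X: "centered_gaussian_field M X"
  shows "integrable M (\<lambda>w. X s w * X t w)"
proof -
  interpret prob_space M using X by (simp add: centered_gaussian_field_def)
  have sq: "integrable M (\<lambda>w. (X t w)\<^sup>2)" for t
    using centered_gaussian_moments(1)[OF field_combination_gaussian[OF X, of "{t}" "\<lambda>_. 1"]] by simp
  show ?thesis
  proof (rule Bochner_Integration.integrable_bound)
    show "integrable M (\<lambda>w. (X s w)\<^sup>2 + (X t w)\<^sup>2)" by (intro Bochner_Integration.integrable_add sq)
    show "(\<lambda>w. X s w * X t w) \<in> borel_measurable M"
      by (intro borel_measurable_times field_measurable[OF X])
    have "\<bar>a * b\<bar> \<le> a\<^sup>2 + b\<^sup>2" for a b :: real
    proof -
      have "2 * \<bar>a\<bar> * \<bar>b\<bar> \<le> a\<^sup>2 + b\<^sup>2" using sum_squares_bound[of "\<bar>a\<bar>" "\<bar>b\<bar>"] by simp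
      moreover have "0 \<le> \<bar>a\<bar> * \<bar>b\<bar>" by simp
      ultimately show ?thesis unfolding abs_mult by linarith
    qed
    then show "AE w in M. norm (X s w * X t w) \<le> norm ((X s w)\<^sup>2 + (X t w)\<^sup>2)" by simp
  qed
qed

lemma field_quad_form:
  assumes X: "centered_gaussian_field M X"
  shows "quad_form S (cov M X) a b = (\<integral>w. (\<Sum>s\<in>S. a s * X s w) * (\<Sum>t\<in>S. b t * X t w) \<partial>M)"
proof -
  have "(\<integral>w. (\<Sum>s\<in>S. a s * X s w) * (\<Sum>t\<in>S. b t * X t w) \<partial>M) = (\<integral>w. (\<Sum>s\<in>S. \<Sum>t\<in>S. (a s * b t) * (X s w * X t w)) \<partial>M)"
    by (simp add: sum_product mult_ac)
  also have "\<dots> = (\<Sum>s\<in>S. \<Sum>t\<in>S. (a s * b t) * cov M X s t)"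
    by (simp add: field_product_integrable[OF X] cov_def)
  finally show ?thesis by (simp add: quad_form_def)
qed

lemma cov_commute: "cov M X s t = cov M X t s"
  by (simp add: cov_def mult.commute)

lemma field_quad_form_nonneg:
  assumes X: "centered_gaussian_field M X"
  shows "quad_form S (cov M X) a a \<ge> 0"
  unfolding field_quad_form[OF X] by (intro integral_nonneg_AE) simp

lemma field_iexp:
  assumes X: "centered_gaussian_field M X" and S: "finite S"
  shows "(\<integral>w. iexp (\<Sum>s\<in>S. a s * X s w) \<partial>M) = complex_of_real (exp (- quad_form S (cov M X) a a / 2))"
proof -
  interpret prob_space M using X by (simp add: centered_gaussian_field_def)
  have "centered_gaussian M (\<lambda>w. \<Sum>s\<in>S. a s * X s w)" by (rule field_combination_gaussian[OF X S])
  from centered_gaussian_moments(2)[OF this] show ?thesis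
    unfolding field_quad_form[OF X] by (simp add: power2_eq_square)
qed

lemma field_null_combination:
  assumes X: "centered_gaussian_field M X" and S: "finite S" and z: "quad_form S (cov M X) a a = 0"
  shows "AE w in M. (\<Sum>s\<in>S. a s * X s w) = 0"
proof -
  interpret prob_space M using X by (simp add: centered_gaussian_field_def)
  have "centered_gaussian M (\<lambda>w. \<Sum>s\<in>S. a s * X s w)" by (rule field_combination_gaussian[OF X S])
  from centered_gaussian_moments(1)[OF this]
  have i: "integrable M (\<lambda>w. (\<Sum>s\<in>S. a s * X s w)\<^sup>2)" .
  have "(\<integral>w. (\<Sum>s\<in>S. a s * X s w)\<^sup>2 \<partial>M) = 0"
    using z unfolding field_quad_form[OF X] by (simp add: power2_eq_square)
  then have "AE w in M. (\<Sum>s\<in>S. a s * X s w)\<^sup>2 = 0"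
    using integral_nonneg_eq_0_iff_AE[OF i] by simp
  then show ?thesis by simp
qed

text \<open>A combination of the given combinations is again a Gaussian combination of field
  variables, and orthogonality makes its variance a sum of squares; so the joint characteristic
  function factorizes.\<close>

lemma orthogonal_combinations_law:
  fixes n :: nat
  assumes X: "centered_gaussian_field M X" and S: "finite S"
    and diag: "\<And>k l. k < n \<Longrightarrow> l < n \<Longrightarrow> quad_form S (cov M X) (b k) (b l) = (if k = l then (\<sigma> k)\<^sup>2 else 0)"
    and \<sigma>: "\<And>k. \<sigma> k > 0"
  shows "distr M (\<Pi>\<^sub>M i\<in>{..<n}. borel) (\<lambda>w. \<lambda>k\<in>{..<n}. \<Sum>s\<in>S. b k s * X s w) = PiM {..<n} (\<lambda>k. normal_law (\<sigma> k))"
proof -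
  interpret prob_space M using X by (simp add: centered_gaussian_field_def)
  show ?thesis
  proof (rule joint_law_of_char)
    show "real_distribution (normal_law (\<sigma> i))" for i by (rule normal_law_real_distribution[OF \<sigma>])
    show "(\<lambda>w. \<Sum>s\<in>S. b i s * X s w) \<in> borel_measurable M" for i
      by (intro borel_measurable_sum borel_measurable_times field_measurable[OF X]) auto
    fix a :: "nat \<Rightarrow> real"
    have eq: "(\<Sum>i<n. a i * (\<Sum>s\<in>S. b i s * X s w)) = (\<Sum>s\<in>S. (\<Sum>i<n. a i * b i s) * X s w)" for w
      unfolding sum_distrib_left sum_distrib_right by (subst sum.swap) (simp add: mult_ac)
    have "quad_form S (cov M X) (\<lambda>s. \<Sum>i<n. a i * b i s) (\<lambda>s. \<Sum>i<n. a i * b i s) =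
      (\<Sum>k<n. \<Sum>l<n. if k = l then (\<sigma> k * a k)\<^sup>2 else 0)"
      unfolding quad_form_sum_left quad_form_sum_right sum_distrib_left
      by (intro sum.cong refl) (auto simp: diag power2_eq_square)
    also have "\<dots> = (\<Sum>k<n. (\<sigma> k * a k)\<^sup>2)" by simp
    finally have q: "quad_form S (cov M X) (\<lambda>s. \<Sum>i<n. a i * b i s) (\<lambda>s. \<Sum>i<n. a i * b i s) = (\<Sum>k<n. (\<sigma> k * a k)\<^sup>2)" .
    have "(\<integral>w. iexp (\<Sum>i<n. a i * (\<Sum>s\<in>S. b i s * X s w)) \<partial>M) = complex_of_real (exp (\<Sum>k<n. - ((\<sigma> k * a k)\<^sup>2) / 2))"
      unfolding eq field_iexp[OF X S] q by (simp add: sum_negf sum_divide_distrib)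
    also have "\<dots> = (\<Prod>k<n. complex_of_real (exp (- ((\<sigma> k * a k)\<^sup>2) / 2)))"
      by (simp only: exp_sum finite_lessThan of_real_prod)
    finally show "(\<integral>w. iexp (\<Sum>i<n. a i * (\<Sum>s\<in>S. b i s * X s w)) \<partial>M) = (\<Prod>i<n. char (normal_law (\<sigma> i)) (a i))"
      by (simp add: char_normal_law[OF \<sigma>])
  qed
qed

text \<open>Null residuals let \<open>C\<close> reconstruct the field on \<open>S\<close> almost
  surely from the combinations. The preimage under \<open>C\<close> depends only on \<open>B\<close>
  and the coefficients, so the same event can be compared under the laws of two fields.\<close>

lemma field_prob_combinations:
  fixes n :: nat
  assumes X: "centered_gaussian_field M X" and S: "finite S"
    and res: "\<And>t. t \<in> S \<Longrightarrow> quad_form S (cov M X) (residual n c b t) (residual n c b t) = 0"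
    and B: "B \<in> sets (\<Pi>\<^sub>M t\<in>S. borel)"
  defines "C \<equiv> \<lambda>y. \<lambda>t\<in>S. \<Sum>k<n. c t k * y k"
  shows "C -` B \<inter> space (\<Pi>\<^sub>M k\<in>{..<n}. borel) \<in> sets (\<Pi>\<^sub>M k\<in>{..<n}. (borel :: real measure))"
    and "measure M {w \<in> space M. (\<lambda>t\<in>S. X t w) \<in> B} =
     measure (distr M (\<Pi>\<^sub>M k\<in>{..<n}. borel) (\<lambda>w. \<lambda>k\<in>{..<n}. \<Sum>s\<in>S. b k s * X s w)) (C -` B \<inter> space (\<Pi>\<^sub>M k\<in>{..<n}. borel))"
proof -
  interpret prob_space M using X by (simp add: centered_gaussian_field_def)
  have Cm: "C \<in> measurable (\<Pi>\<^sub>M k\<in>{..<n}. borel) (\<Pi>\<^sub>M t\<in>S. borel)"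
    unfolding C_def by (intro measurable_restrict borel_measurable_sum borel_measurable_times) measurable
  show E: "C -` B \<inter> space (\<Pi>\<^sub>M k\<in>{..<n}. borel) \<in> sets (\<Pi>\<^sub>M k\<in>{..<n}. (borel :: real measure))"
    by (rule measurable_sets[OF Cm B])
  define Y where "Y w = (\<lambda>k\<in>{..<n}. \<Sum>s\<in>S. b k s * X s w)" for w
  have Ym: "Y \<in> measurable M (\<Pi>\<^sub>M k\<in>{..<n}. borel)"
    unfolding Y_def by (intro measurable_restrict borel_measurable_sum borel_measurable_times field_measurable[OF X]) auto
  have Xm: "(\<lambda>w. \<lambda>t\<in>S. X t w) \<in> measurable M (\<Pi>\<^sub>M t\<in>S. borel)"
    by (intro measurable_restrict field_measurable[OF X])
  have "AE w in M. \<forall>t\<in>S. (\<Sum>s\<in>S. ((if s = t then 1 else 0) - (\<Sum>k<n. c t k * b k s)) * X s w) = 0"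
    using S by (intro AE_finite_allI field_null_combination[OF X S res])
  then have ae: "AE w in M. (\<lambda>t\<in>S. X t w) = C (Y w)"
  proof eventually_elim
    case (elim w)
    have "X t w = (\<Sum>k<n. c t k * Y w k)" if t: "t \<in> S" for t
    proof -
      have "(\<Sum>s\<in>S. ((if s = t then 1 else 0) - (\<Sum>k<n. c t k * b k s)) * X s w) =
        (\<Sum>s\<in>S. if s = t then X s w else 0) - (\<Sum>s\<in>S. \<Sum>k<n. c t k * (b k s * X s w))"
        unfolding sum_subtractf[symmetric] by (intro sum.cong) (auto simp: left_diff_distrib right_diff_distrib sum_distrib_right sum_distrib_left mult_ac)
      also have "(\<Sum>s\<in>S. if s = t then X s w else 0) = X t w" using t S by simp
      also have "(\<Sum>s\<in>S. \<Sum>k<n. c t k * (b k s * X s w)) = (\<Sum>k<n. c t k * Y w k)"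
        by (subst sum.swap) (simp add: Y_def sum_distrib_left)
      finally show ?thesis using elim t by simp
    qed
    then show ?case by (auto simp: C_def)
  qed
  have "measure M {w \<in> space M. (\<lambda>t\<in>S. X t w) \<in> B} = measure M ((\<lambda>w. \<lambda>t\<in>S. X t w) -` B \<inter> space M)"
    by (intro arg_cong[where f = "measure M"]) auto
  also have "\<dots> = measure M ((\<lambda>w. C (Y w)) -` B \<inter> space M)"
    by (rule measure_eq_AE) (use ae measurable_sets[OF Xm B] measurable_sets[OF measurable_compose[OF Ym Cm] B] in auto)
  also have "(\<lambda>w. C (Y w)) -` B \<inter> space M = Y -` (C -` B \<inter> space (\<Pi>\<^sub>M k\<in>{..<n}. borel)) \<inter> space M"
    using measurable_space[OF Ym] by auto
  also have "measure M \<dots> = measure (distr M (\<Pi>\<^sub>M k\<in>{..<n}. borel) Y) (C -` B \<inter> space (\<Pi>\<^sub>M k\<in>{..<n}. borel))"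
    by (rule measure_distr[OF Ym E, symmetric])
  finally show "measure M {w \<in> space M. (\<lambda>t\<in>S. X t w) \<in> B} =
     measure (distr M (\<Pi>\<^sub>M k\<in>{..<n}. borel) (\<lambda>w. \<lambda>k\<in>{..<n}. \<Sum>s\<in>S. b k s * X s w)) (C -` B \<inter> space (\<Pi>\<^sub>M k\<in>{..<n}. borel))"
    unfolding Y_def[abs_def] .
qed

lemma finite_dimensional_divergence_bound:
  fixes J :: real and n :: nat
  assumes X0: "centered_gaussian_field M0 X0" and X1: "centered_gaussian_field M1 X1" and S: "finite S"
    and diag0: "\<And>k l. k < n \<Longrightarrow> l < n \<Longrightarrow> quad_form S (cov M0 X0) (b k) (b l) = (if k = l then 1 else 0)"
    and diag1: "\<And>k l. k < n \<Longrightarrow> l < n \<Longrightarrow> quad_form S (cov M1 X1) (b k) (b l) = (if k = l then lam k else 0)"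
    and lam: "\<And>k. k < n \<Longrightarrow> lam k > 0"
    and res0: "\<And>t. t \<in> S \<Longrightarrow> quad_form S (cov M0 X0) (residual n c b t) (residual n c b t) = 0"
    and res1: "\<And>t. t \<in> S \<Longrightarrow> quad_form S (cov M1 X1) (residual n c b t) (residual n c b t) = 0"
    and J: "(\<Sum>k<n. (lam k - 1)\<^sup>2 / (2 * lam k)) \<le> J"
    and m: "m > 1" and B: "B \<in> sets (\<Pi>\<^sub>M t\<in>S. borel)"
  shows "measure M1 {w \<in> space M1. (\<lambda>t\<in>S. X1 t w) \<in> B} \<le> m * measure M0 {w \<in> space M0. (\<lambda>t\<in>S. X0 t w) \<in> B} + J / ((1 - 1 / m) * ln m)"
    and "measure M0 {w \<in> space M0. (\<lambda>t\<in>S. X0 t w) \<in> B} \<le> m * measure M1 {w \<in> space M1. (\<lambda>t\<in>S. X1 t w) \<in> B} + J / ((1 - 1 / m) * ln m)"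
proof -
  \<comment> \<open>The value 1 from \<open>n\<close> on is a default that keeps the standard
    deviations positive at every index.\<close>
  define \<sigma> where "\<sigma> k = (if k < n then sqrt (lam k) else 1)" for k
  have \<sigma>: "\<sigma> k > 0" for k using lam by (simp add: \<sigma>_def)
  have \<sigma>2: "(\<sigma> k)\<^sup>2 = lam k" if "k < n" for k using lam[OF that] that by (simp add: \<sigma>_def)
  interpret M0: prob_space M0 using X0 by (simp add: centered_gaussian_field_def)
  interpret M1: prob_space M1 using X1 by (simp add: centered_gaussian_field_def)
  define Y0 where "Y0 w = (\<lambda>k\<in>{..<n}. \<Sum>s\<in>S. b k s * X0 s w)" for w
  define Y1 where "Y1 w = (\<lambda>k\<in>{..<n}. \<Sum>s\<in>S. b k s * X1 s w)" for w
  have Y0m: "Y0 \<in> measurable M0 (\<Pi>\<^sub>M k\<in>{..<n}. borel)"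
    unfolding Y0_def by (intro measurable_restrict borel_measurable_sum borel_measurable_times field_measurable[OF X0]) auto
  have Y1m: "Y1 \<in> measurable M1 (\<Pi>\<^sub>M k\<in>{..<n}. borel)"
    unfolding Y1_def by (intro measurable_restrict borel_measurable_sum borel_measurable_times field_measurable[OF X1]) auto
  define \<mu>0 where "\<mu>0 = distr M0 (\<Pi>\<^sub>M k\<in>{..<n}. borel) Y0"
  define \<mu>1 where "\<mu>1 = distr M1 (\<Pi>\<^sub>M k\<in>{..<n}. borel) Y1"
  have l0: "\<mu>0 = PiM {..<n} (\<lambda>k. normal_law 1)"
    unfolding \<mu>0_def Y0_def by (rule orthogonal_combinations_law[OF X0 S]) (auto simp: diag0)
  have l1: "\<mu>1 = PiM {..<n} (\<lambda>k. normal_law (\<sigma> k))"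
    unfolding \<mu>1_def Y1_def by (rule orthogonal_combinations_law[OF X1 S]) (auto simp: diag1 \<sigma>2 \<sigma>)
  define h where "h x = (\<Prod>k<n. normal_density 0 (\<sigma> k) (x k) / normal_density 0 1 (x k))" for x :: "nat \<Rightarrow> real"
  have hpos: "h x > 0" for x
    unfolding h_def by (intro prod_pos) (auto intro!: divide_pos_pos normal_density_pos \<sigma>)
  have dens: "\<mu>1 = density \<mu>0 (\<lambda>x. ennreal (h x))"
    unfolding l1 l0 h_def by (rule PiM_normal_law_density[OF \<sigma>])
  have s0: "sets \<mu>0 = sets (\<Pi>\<^sub>M k\<in>{..<n}. borel)" by (simp add: \<mu>0_def)
  have hm: "h \<in> borel_measurable \<mu>0"
    unfolding h_def measurable_cong_sets[OF s0 refl] by measurable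
  \<comment> \<open>The logarithm is a quadratic polynomial in the coordinates, so its expectations
    need only the second moments given by the two diagonal forms; the terms
    \<open>- ln (\<sigma> k)\<close> cancel in the difference.\<close>
  have lnh: "ln (h x) = (\<Sum>k<n. - ln (\<sigma> k) + (1/2) * (1 - 1 / (\<sigma> k)\<^sup>2) * (x k)\<^sup>2)" for x
  proof -
    have "ln (h x) = (\<Sum>k<n. ln (normal_density 0 (\<sigma> k) (x k) / normal_density 0 1 (x k)))"
      unfolding h_def using normal_density_pos[OF \<sigma>] normal_density_pos[of 1]
      by (intro ln_prod) (auto simp: less_imp_neq[symmetric])
    then show ?thesis by (simp add: normal_density_ratio[OF \<sigma>] mult_ac)
  qed
  have mom0: "integrable \<mu>0 (\<lambda>x. (x k)\<^sup>2)" "(\<integral>x. (x k)\<^sup>2 \<partial>\<mu>0) = 1" if k: "k < n" for k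
  proof -
    have i: "integrable M0 (\<lambda>w. (\<Sum>s\<in>S. b k s * X0 s w)\<^sup>2)"
      using X0 S by (intro M0.centered_gaussian_moments(1)) (simp add: centered_gaussian_field_def)
    have "integrable M0 (\<lambda>w. (Y0 w k)\<^sup>2)" "(\<integral>w. (Y0 w k)\<^sup>2 \<partial>M0) = 1"
      using i diag0[OF k k] k by (auto simp: Y0_def field_quad_form[OF X0] power2_eq_square)
    then show "integrable \<mu>0 (\<lambda>x. (x k)\<^sup>2)" "(\<integral>x. (x k)\<^sup>2 \<partial>\<mu>0) = 1"
      unfolding \<mu>0_def using k by (simp_all add: integrable_distr_eq[OF Y0m] integral_distr[OF Y0m])
  qed
  have mom1: "integrable \<mu>1 (\<lambda>x. (x k)\<^sup>2)" "(\<integral>x. (x k)\<^sup>2 \<partial>\<mu>1) = lam k" if k: "k < n" for k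
  proof -
    have i: "integrable M1 (\<lambda>w. (\<Sum>s\<in>S. b k s * X1 s w)\<^sup>2)"
      using X1 S by (intro M1.centered_gaussian_moments(1)) (simp add: centered_gaussian_field_def)
    have "integrable M1 (\<lambda>w. (Y1 w k)\<^sup>2)" "(\<integral>w. (Y1 w k)\<^sup>2 \<partial>M1) = lam k"
      using i diag1[OF k k] k by (auto simp: Y1_def field_quad_form[OF X1] power2_eq_square)
    then show "integrable \<mu>1 (\<lambda>x. (x k)\<^sup>2)" "(\<integral>x. (x k)\<^sup>2 \<partial>\<mu>1) = lam k"
      unfolding \<mu>1_def using k by (simp_all add: integrable_distr_eq[OF Y1m] integral_distr[OF Y1m])
  qed
  have p0: "prob_space \<mu>0" unfolding \<mu>0_def by (rule M0.prob_space_distr[OF Y0m])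
  have p1: "prob_space \<mu>1" unfolding \<mu>1_def by (rule M1.prob_space_distr[OF Y1m])
  interpret P0: prob_space \<mu>0 by (rule p0)
  interpret P1: prob_space \<mu>1 by (rule p1)
  have L0: "integrable \<mu>0 (\<lambda>x. ln (h x))"
    unfolding lnh using mom0 by (intro Bochner_Integration.integrable_sum Bochner_Integration.integrable_add) auto
  have L1: "integrable \<mu>1 (\<lambda>x. ln (h x))"
    unfolding lnh using mom1 by (intro Bochner_Integration.integrable_sum Bochner_Integration.integrable_add) auto
  have I0: "(\<integral>x. ln (h x) \<partial>\<mu>0) = (\<Sum>k<n. - ln (\<sigma> k) + (1/2) * (1 - 1 / (\<sigma> k)\<^sup>2) * 1)"
    unfolding lnh using mom0 by (subst Bochner_Integration.integral_sum) (auto simp: P0.prob_space)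
  have I1: "(\<integral>x. ln (h x) \<partial>\<mu>1) = (\<Sum>k<n. - ln (\<sigma> k) + (1/2) * (1 - 1 / (\<sigma> k)\<^sup>2) * lam k)"
    unfolding lnh using mom1 by (subst Bochner_Integration.integral_sum) (auto simp: P1.prob_space)
  have "(\<integral>x. ln (h x) \<partial>\<mu>1) - (\<integral>x. ln (h x) \<partial>\<mu>0) = (\<Sum>k<n. (lam k - 1)\<^sup>2 / (2 * lam k))"
    unfolding I0 I1 sum_subtractf[symmetric]
  proof (rule sum.cong[OF refl])
    fix k assume "k \<in> {..<n}"
    then have k: "k < n" by simp
    show "- ln (\<sigma> k) + (1/2) * (1 - 1 / (\<sigma> k)\<^sup>2) * lam k - (- ln (\<sigma> k) + (1/2) * (1 - 1 / (\<sigma> k)\<^sup>2) * 1) = (lam k - 1)\<^sup>2 / (2 * lam k)"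
      unfolding \<sigma>2[OF k] using lam[OF k] by (simp add: field_simps power2_eq_square)
  qed
  then have J': "(\<integral>x. ln (h x) \<partial>\<mu>1) - (\<integral>x. ln (h x) \<partial>\<mu>0) \<le> J" using J by simp
  define E where "E = (\<lambda>y. \<lambda>t\<in>S. \<Sum>k<n. c t k * y k) -` B \<inter> space (\<Pi>\<^sub>M k\<in>{..<n}. borel)"
  have E: "E \<in> sets \<mu>0" unfolding s0 E_def by (rule field_prob_combinations(1)[OF X0 S res0 B])
  have e0: "measure M0 {w \<in> space M0. (\<lambda>t\<in>S. X0 t w) \<in> B} = measure \<mu>0 E"
    unfolding \<mu>0_def Y0_def E_def by (rule field_prob_combinations(2)[OF X0 S res0 B])
  have e1: "measure M1 {w \<in> space M1. (\<lambda>t\<in>S. X1 t w) \<in> B} = measure \<mu>1 E"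
    unfolding \<mu>1_def Y1_def E_def by (rule field_prob_combinations(2)[OF X1 S res1 B])
  show "measure M1 {w \<in> space M1. (\<lambda>t\<in>S. X1 t w) \<in> B} \<le> m * measure M0 {w \<in> space M0. (\<lambda>t\<in>S. X0 t w) \<in> B} + J / ((1 - 1 / m) * ln m)"
    unfolding e0 e1 by (rule divergence_bound(1)[OF p0 hm hpos dens p1 L0 L1 J' m E])
  show "measure M0 {w \<in> space M0. (\<lambda>t\<in>S. X0 t w) \<in> B} \<le> m * measure M1 {w \<in> space M1. (\<lambda>t\<in>S. X1 t w) \<in> B} + J / ((1 - 1 / m) * ln m)"
    unfolding e0 e1 by (rule divergence_bound(2)[OF p0 hm hpos dens p1 L0 L1 J' m E])
qed

lemma field_law_cylinder:
  assumes X: "centered_gaussian_field M X" and S: "S \<subseteq> D" "B \<in> sets (\<Pi>\<^sub>M t\<in>S. borel)"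
  shows "measure (field_law D M X) (prod_emb D (\<lambda>_. borel) S B) = measure M {w \<in> space M. (\<lambda>t\<in>S. X t w) \<in> B}"
proof -
  have m: "(\<lambda>w. \<lambda>t\<in>D. X t w) \<in> measurable M (\<Pi>\<^sub>M t\<in>D. borel)"
    by (intro measurable_restrict field_measurable[OF X])
  have "measure (field_law D M X) (prod_emb D (\<lambda>_. borel) S B) =
    measure M ((\<lambda>w. \<lambda>t\<in>D. X t w) -` prod_emb D (\<lambda>_. borel) S B \<inter> space M)"
    unfolding field_law_def using S by (intro measure_distr[OF m]) auto
  also have "(\<lambda>w. \<lambda>t\<in>D. X t w) -` prod_emb D (\<lambda>_. borel) S B \<inter> space M = {w \<in> space M. (\<lambda>t\<in>S. X t w) \<in> B}"
    using S(1) by (auto simp: prod_emb_iff Int_absorb1)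
  finally show ?thesis .
qed

text \<open>The interface between probability and analysis. \<open>ac\<close> carries null residuals
  over to the second field, \<open>pos\<close> makes the diagonal entries positive, and
  \<open>div\<close> bounds the divergence uniformly over finite sets of times.\<close>

lemma equivalent_on_of_bounded_divergence:
  fixes J :: real
  assumes X0: "centered_gaussian_field M0 X0" and X1: "centered_gaussian_field M1 X1" and J: "J \<ge> 0"
    and ac: "\<And>S a. finite S \<Longrightarrow> S \<subseteq> D \<Longrightarrow> quad_form S (cov M0 X0) a a = 0 \<Longrightarrow> quad_form S (cov M1 X1) a a = 0"
    and pos: "\<And>S a. finite S \<Longrightarrow> S \<subseteq> D \<Longrightarrow> quad_form S (cov M0 X0) a a = 1 \<Longrightarrow> quad_form S (cov M1 X1) a a > 0"
    and div: "\<And>S (n::nat) b lam. finite S \<Longrightarrow> S \<subseteq> D \<Longrightarrow>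
       (\<And>k l. k < n \<Longrightarrow> l < n \<Longrightarrow> quad_form S (cov M0 X0) (b k) (b l) = (if k = l then 1 else 0)) \<Longrightarrow>
       (\<And>k. k < n \<Longrightarrow> quad_form S (cov M1 X1) (b k) (b k) = lam k) \<Longrightarrow>
       (\<Sum>k<n. (lam k - 1)\<^sup>2 / (2 * lam k)) \<le> J"
  shows "equivalent_on D M0 X0 M1 X1"
proof -
  have bound: "measure M1 {w \<in> space M1. (\<lambda>t\<in>S. X1 t w) \<in> B} \<le> m * measure M0 {w \<in> space M0. (\<lambda>t\<in>S. X0 t w) \<in> B} + J / ((1 - 1 / m) * ln m) \<and>
     measure M0 {w \<in> space M0. (\<lambda>t\<in>S. X0 t w) \<in> B} \<le> m * measure M1 {w \<in> space M1. (\<lambda>t\<in>S. X1 t w) \<in> B} + J / ((1 - 1 / m) * ln m)"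
    if m: "m > 1" and S: "finite S" "S \<subseteq> D" and B: "B \<in> sets (\<Pi>\<^sub>M t\<in>S. borel)" for m S B
  proof (rule simultaneous_diagonalization[of S "cov M0 X0" "cov M1 X1"])
    fix n :: nat and b c lam
    assume 0: "\<And>k l. k < n \<Longrightarrow> l < n \<Longrightarrow> quad_form S (cov M0 X0) (b k) (b l) = (if k = l then 1 else 0)"
      and 1: "\<And>k l. k < n \<Longrightarrow> l < n \<Longrightarrow> quad_form S (cov M1 X1) (b k) (b l) = (if k = l then lam k else 0)"
      and 2: "\<And>t. t \<in> S \<Longrightarrow> quad_form S (cov M0 X0) (residual n c b t) (residual n c b t) = 0"
    have lam: "lam k > 0" if "k < n" for k
      using pos[OF S, of "b k"] 0[OF that that] 1[OF that that] by simp
    have 3: "quad_form S (cov M1 X1) (residual n c b t) (residual n c b t) = 0" if "t \<in> S" for t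
      by (rule ac[OF S 2[OF that]])
    have J': "(\<Sum>k<n. (lam k - 1)\<^sup>2 / (2 * lam k)) \<le> J"
      by (rule div[OF S, of n b lam]) (auto simp: 0 1)
    show ?thesis
      using finite_dimensional_divergence_bound[OF X0 X1 S(1) 0 1 lam 2 3 J' m B] by simp
  qed (use S field_quad_form_nonneg[OF X0] in \<open>auto simp: cov_commute\<close>)
  have law: "finite_measure (field_law D M X)" "sets (field_law D M X) = sets (\<Pi>\<^sub>M t\<in>D. (borel :: real measure))"
    if X: "centered_gaussian_field M X" for M :: "'x measure" and X
  proof -
    interpret prob_space M using X by (simp add: centered_gaussian_field_def)
    have "prob_space (field_law D M X)"
      unfolding field_law_def by (intro prob_space_distr measurable_restrict field_measurable[OF X])
    then show "finite_measure (field_law D M X)" by (rule prob_space.finite_measure)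
    show "sets (field_law D M X) = sets (\<Pi>\<^sub>M t\<in>D. (borel :: real measure))" by (simp add: field_law_def)
  qed
  show ?thesis
    unfolding equivalent_on_def
  proof
    show "absolutely_continuous (field_law D M0 X0) (field_law D M1 X1)"
      by (rule absolutely_continuous_PiM_of_cylinders[OF law[OF X0] law[OF X1] J])
        (use bound in \<open>auto simp: field_law_cylinder[OF X0] field_law_cylinder[OF X1]\<close>)
    show "absolutely_continuous (field_law D M1 X1) (field_law D M0 X0)"
      by (rule absolutely_continuous_PiM_of_cylinders[OF law[OF X1] law[OF X0] J])
        (use bound in \<open>auto simp: field_law_cylinder[OF X0] field_law_cylinder[OF X1]\<close>)
  qed
qed

section \<open>Bessel inequalities and the reproducing kernel\<close>

lemma L2_inner_sum_left:
  assumes "finite I" "\<And>i. i \<in> I \<Longrightarrow> \<phi> i \<in> L2_fun F" "\<psi> \<in> L2_fun F"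
  shows "L2_inner F (\<lambda>x. \<Sum>i\<in>I. c i * \<phi> i x) \<psi> = (\<Sum>i\<in>I. c i * L2_inner F (\<phi> i) \<psi>)"
proof -
  have "L2_inner F (\<lambda>x. \<Sum>i\<in>I. c i * \<phi> i x) \<psi> = (\<integral>x. (\<Sum>i\<in>I. c i * (\<phi> i x * cnj (\<psi> x))) \<partial>F)"
    by (simp add: L2_inner_def sum_distrib_right mult.assoc)
  also have "\<dots> = (\<Sum>i\<in>I. \<integral>x. c i * (\<phi> i x * cnj (\<psi> x)) \<partial>F)"
    by (intro Bochner_Integration.integral_sum integrable_mult_right L2_mult_integrable assms)
  finally show ?thesis by (simp add: L2_inner_def)
qed

lemma L2_inner_commute: "L2_inner F \<psi> \<phi> = cnj (L2_inner F \<phi> \<psi>)"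
  unfolding L2_inner_def Bochner_Integration.integral_cnj[symmetric] by (simp add: mult.commute)

lemma L2_inner_sum_right:
  assumes "finite I" "\<And>i. i \<in> I \<Longrightarrow> \<phi> i \<in> L2_fun F" "\<psi> \<in> L2_fun F"
  shows "L2_inner F \<psi> (\<lambda>x. \<Sum>i\<in>I. c i * \<phi> i x) = (\<Sum>i\<in>I. cnj (c i) * L2_inner F \<psi> (\<phi> i))"
  using L2_inner_sum_left[OF assms] by (simp add: L2_inner_commute[of F \<psi>])

lemma L2_Cauchy_Schwarz:
  assumes "\<phi> \<in> L2_fun F" "\<psi> \<in> L2_fun F"
  shows "norm (L2_inner F \<phi> \<psi>) \<le> L2_norm F \<phi> * L2_norm F \<psi>"
proof -
  have m: "\<phi> \<in> borel_measurable F" "\<psi> \<in> borel_measurable F" using assms by (auto simp: L2_fun_def)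
  have i: "integrable F (\<lambda>x. norm (\<phi> x) * norm (\<psi> x))"
    using L2_mult_integrable[OF assms] by (simp add: norm_mult[symmetric] flip: norm_mult) (metis (no_types, lifting) Bochner_Integration.integrable_cong complex_mod_cnj integrable_norm norm_mult)
  have "norm (L2_inner F \<phi> \<psi>) \<le> (\<integral>x. norm (\<phi> x) * norm (\<psi> x) \<partial>F)"
    unfolding L2_inner_def by (rule order_trans[OF integral_norm_bound]) (simp add: norm_mult)
  moreover have "(\<integral>x. norm (\<phi> x) * norm (\<psi> x) \<partial>F)\<^sup>2 \<le> (L2_norm F \<phi> * L2_norm F \<psi>)\<^sup>2"
  proof -
    have "(\<integral>\<^sup>+x. ennreal (norm (\<phi> x)) * ennreal (norm (\<psi> x)) \<partial>F)\<^sup>2 \<le>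
      (\<integral>\<^sup>+x. (ennreal (norm (\<phi> x)))\<^sup>2 \<partial>F) * (\<integral>\<^sup>+x. (ennreal (norm (\<psi> x)))\<^sup>2 \<partial>F)"
      using m by (intro Cauchy_Schwarz_nn_integral) auto
    also have "(\<integral>\<^sup>+x. (ennreal (norm (\<phi> x)))\<^sup>2 \<partial>F) = ennreal ((L2_norm F \<phi>)\<^sup>2)"
      using L2_norm_sq_nn[OF assms(1)] by (simp add: ennreal_power)
    also have "(\<integral>\<^sup>+x. (ennreal (norm (\<psi> x)))\<^sup>2 \<partial>F) = ennreal ((L2_norm F \<psi>)\<^sup>2)"
      using L2_norm_sq_nn[OF assms(2)] by (simp add: ennreal_power)
    also have "(\<integral>\<^sup>+x. ennreal (norm (\<phi> x)) * ennreal (norm (\<psi> x)) \<partial>F) = ennreal (\<integral>x. norm (\<phi> x) * norm (\<psi> x) \<partial>F)"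
      using nn_integral_eq_integral[OF i] by (simp add: ennreal_mult)
    finally have "ennreal ((\<integral>x. norm (\<phi> x) * norm (\<psi> x) \<partial>F)\<^sup>2) \<le> ennreal ((L2_norm F \<phi> * L2_norm F \<psi>)\<^sup>2)"
      by (simp add: ennreal_power integral_nonneg_AE power_mult_distrib ennreal_mult)
    then show ?thesis by simp
  qed
  then have "(\<integral>x. norm (\<phi> x) * norm (\<psi> x) \<partial>F) \<le> L2_norm F \<phi> * L2_norm F \<psi>"
    by (rule power2_le_imp_le) (simp add: L2_norm_nonneg)
  ultimately show ?thesis by linarith
qed

section \<open>Entire extensions and bounds on evaluation\<close>

lemma e_fun_restricts_entire:
  fixes t :: "real^'d"
  shows "\<exists>\<Phi>. entire \<Phi> \<and> (\<forall>x. e_fun t x = \<Phi> (\<chi> i. complex_of_real (x $ i)))"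
proof -
  \<comment> \<open>The bilinear extension of the inner product with \<open>t\<close>, complex
    linear because \<open>z\<close> is not conjugated.\<close>
  define l where "l z = (\<Sum>i\<in>UNIV. complex_of_real (t $ i) * (z $ i))" for z :: "complex^'d"
  have bl: "bounded_linear l"
    unfolding l_def by (intro bounded_linear_sum bounded_linear_const_mult bounded_linear_vec_nth)
  have d: "((\<lambda>z. exp (\<i> * l z) - 1) has_derivative (\<lambda>v. exp (\<i> * l z) * (\<i> * l v))) (at z)" for z
  proof -
    have "((\<lambda>z. \<i> * l z) has_derivative (\<lambda>v. \<i> * l v)) (at z)"
      by (intro has_derivative_mult_right bounded_linear_imp_has_derivative bl)
    from has_derivative_compose[OF this DERIV_exp[unfolded has_field_derivative_def]]
    have "((\<lambda>z. exp (\<i> * l z)) has_derivative (\<lambda>v. exp (\<i> * l z) * (\<i> * l v))) (at z)" by simp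
    from has_derivative_diff[OF this has_derivative_const[of 1]] show ?thesis by simp
  qed
  have "l (c *s v) = c * l v" for c v
    by (simp add: l_def sum_distrib_left mult_ac)
  then have "entire (\<lambda>z. exp (\<i> * l z) - 1)"
    unfolding entire_def using d by (intro allI exI conjI) (auto simp: mult_ac)
  moreover have "e_fun t x = exp (\<i> * l (\<chi> i. complex_of_real (x $ i))) - 1" for x
    by (simp add: e_fun_def l_def inner_vec_def)
  ultimately show ?thesis by blast
qed

lemma e_span_restricts_entire:
  fixes \<phi> :: "real^'d \<Rightarrow> complex"
  assumes "\<phi> \<in> e_span D" shows "restricts_entire \<phi>"
proof -
  obtain S a where S: "\<phi> = (\<lambda>x. \<Sum>t\<in>S. a t * e_fun t x)" "finite S" using assms by (auto simp: e_span_def)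
  obtain \<Phi> :: "real^'d \<Rightarrow> complex^'d \<Rightarrow> complex" where \<Phi>: "\<And>t. entire (\<Phi> t)" "\<And>t x. e_fun t x = \<Phi> t (\<chi> i. complex_of_real (x $ i))"
    using e_fun_restricts_entire by metis
  have "entire (\<lambda>z. \<Sum>t\<in>S. a t * \<Phi> t z)"
    unfolding entire_def
  proof
    fix z
    have "\<forall>t. \<exists>\<Phi>'. (\<Phi> t has_derivative \<Phi>') (at z) \<and> (\<forall>c v. \<Phi>' (c *s v) = c * \<Phi>' v)"
      using \<Phi>(1) unfolding entire_def by blast
    from choice[OF this] obtain \<Phi>' where
      \<Phi>': "\<And>t. (\<Phi> t has_derivative \<Phi>' t) (at z)" "\<And>t c v. \<Phi>' t (c *s v) = c * \<Phi>' t v"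
      by blast
    have "((\<lambda>z. \<Sum>t\<in>S. a t * \<Phi> t z) has_derivative (\<lambda>v. \<Sum>t\<in>S. a t * \<Phi>' t v)) (at z)"
      by (intro has_derivative_sum has_derivative_mult_right \<Phi>')
    then show "\<exists>\<Phi>'. ((\<lambda>z. \<Sum>t\<in>S. a t * \<Phi> t z) has_derivative \<Phi>') (at z) \<and> (\<forall>c v. \<Phi>' (c *s v) = c * \<Phi>' v)"
      by (intro exI[of _ "\<lambda>v. \<Sum>t\<in>S. a t * \<Phi>' t v"] conjI) (simp_all add: \<Phi>'(2) sum_distrib_left mult_ac)
  qed
  then show ?thesis
    unfolding restricts_entire_def S using \<Phi>(2) by (intro exI[of _ "\<lambda>z. \<Sum>t\<in>S. a t * \<Phi> t z"]) simp
qed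

lemma e_span_subset_L_space:
  assumes "spectral_measure F" "\<phi> \<in> e_span D" shows "\<phi> \<in> L_space D F"
proof -
  have "L2_norm F (\<lambda>x. \<phi> x - \<phi> x) < \<epsilon>" if "\<epsilon> > 0" for \<epsilon>
    using that by (simp add: L2_norm_def L2_inner_def)
  then show ?thesis
    using assms e_span_L2 e_span_restricts_entire unfolding L_space_def by blast
qed

text \<open>The reproducing property applied to \<open>K x\<close> itself identifies its squared
  norm with \<open>Re (K x x)\<close>; Cauchy-Schwarz then bounds evaluation at
  \<open>x\<close>.\<close>

lemma reproducing_kernel_bound:
  assumes F: "spectral_measure F" and K: "reproducing_kernel D F K" and \<phi>: "\<phi> \<in> e_span D"
  shows "norm (\<phi> x) \<le> sqrt (Re (K x x)) * L2_norm F \<phi>" and "Re (K x x) \<ge> 0"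
proof -
  have KL: "K x \<in> L_space D F" and rep: "\<And>\<phi>. \<phi> \<in> L_space D F \<Longrightarrow> L2_inner F \<phi> (K x) = \<phi> x"
    using K by (auto simp: reproducing_kernel_def)
  have "L2_norm F (K x) = sqrt (Re (K x x))"
    unfolding L2_norm_def rep[OF KL] ..
  moreover have "norm (L2_inner F \<phi> (K x)) \<le> L2_norm F \<phi> * L2_norm F (K x)"
    using KL e_span_L2[OF F \<phi>] by (intro L2_Cauchy_Schwarz) (auto simp: L_space_def)
  ultimately show "norm (\<phi> x) \<le> sqrt (Re (K x x)) * L2_norm F \<phi>"
    using rep[OF e_span_subset_L_space[OF F \<phi>]] by (simp add: mult.commute)
  have "Re (K x x) = Re (L2_inner F (K x) (K x))" using rep[OF KL] by simp
  then show "Re (K x x) \<ge> 0" by (simp add: L2_inner_self)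
qed

text \<open>Derived from a norm bound for evaluation on the span alone, so that it serves for the
  reproducing kernel as well as for the bound on compact sets.\<close>

lemma bessel_from_evaluation_bound:
  fixes n :: nat
  assumes F: "spectral_measure F" and c: "c \<ge> 0"
    and ev: "\<And>\<phi>. \<phi> \<in> e_span D \<Longrightarrow> norm (\<phi> x) \<le> c * L2_norm F \<phi>"
    and \<phi>: "\<And>k. k < n \<Longrightarrow> \<phi> k \<in> e_span D"
    and on: "\<And>k l. k < n \<Longrightarrow> l < n \<Longrightarrow> L2_inner F (\<phi> k) (\<phi> l) = (if k = l then 1 else 0)"
  shows "(\<Sum>k<n. (norm (\<phi> k x))\<^sup>2) \<le> c\<^sup>2"
proof -
  define m where "m = (\<Sum>k<n. (norm (\<phi> k x))\<^sup>2)"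
  have m0: "m \<ge> 0" unfolding m_def by (intro sum_nonneg) auto
  \<comment> \<open>The extremal test function: its value at \<open>x\<close> and its squared norm
    both equal \<open>m\<close>, so the bound reads \<open>m \<le> c * sqrt m\<close>.\<close>
  define \<psi> where "\<psi> y = (\<Sum>k<n. cnj (\<phi> k x) * \<phi> k y)" for y
  have \<psi>: "\<psi> \<in> e_span D" unfolding \<psi>_def using \<phi> by (intro e_span_sum) auto
  have L2: "\<phi> k \<in> L2_fun F" if "k \<in> {..<n}" for k using e_span_L2[OF F \<phi>] that by simp
  have \<psi>L2: "\<psi> \<in> L2_fun F" by (rule e_span_L2[OF F \<psi>])
  have \<psi>x: "\<psi> x = complex_of_real m"
    unfolding \<psi>_def m_def of_real_sum complex_norm_square by (simp add: mult.commute)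
  have "L2_inner F \<psi> \<psi> = (\<Sum>k<n. \<Sum>l<n. cnj (\<phi> k x) * (\<phi> l x * L2_inner F (\<phi> k) (\<phi> l)))"
  proof -
    have "L2_inner F \<psi> \<psi> = (\<Sum>k<n. cnj (\<phi> k x) * L2_inner F (\<phi> k) \<psi>)"
      by (subst (1) \<psi>_def[abs_def], rule L2_inner_sum_left) (use L2 \<psi>L2 in auto)
    also have "\<dots> = (\<Sum>k<n. cnj (\<phi> k x) * (\<Sum>l<n. cnj (cnj (\<phi> l x)) * L2_inner F (\<phi> k) (\<phi> l)))"
      unfolding \<psi>_def by (intro sum.cong refl arg_cong2[where f = "(*)"] L2_inner_sum_right) (use L2 in auto)
    finally show ?thesis by (simp add: sum_distrib_left)
  qed
  also have "\<dots> = (\<Sum>k<n. \<Sum>l<n. if k = l then cnj (\<phi> k x) * \<phi> k x else 0)"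
    by (intro sum.cong refl) (auto simp: on)
  also have "\<dots> = complex_of_real m"
    unfolding m_def of_real_sum complex_norm_square by (simp add: mult.commute)
  finally have "L2_norm F \<psi> = sqrt m" by (simp add: L2_norm_def)
  with ev[OF \<psi>] \<psi>x m0 have "m \<le> c * sqrt m" by simp
  then have "sqrt m * sqrt m \<le> c * sqrt m" using m0 by simp
  then have "sqrt m \<le> c"
    using c m0 mult_right_le_imp_le[of "sqrt m" "sqrt m" c] by (cases "m = 0") auto
  then have "(sqrt m)\<^sup>2 \<le> c\<^sup>2" using m0 by (intro power_mono) auto
  then show ?thesis using m0 by (simp add: m_def)
qed

text \<open>The isometry taking the variable at \<open>t\<close> to \<open>e_fun t\<close>. For real
  coefficients the inner product is real, so orthogonality for the covariance becomes orthogonality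
  in complex L^2.\<close>

lemma grf_quad_form:
  assumes X: "stationary_increments_grf F M X" and F: "spectral_measure F" and S: "finite S"
  shows "complex_of_real (quad_form S (cov M X) a b) =
    L2_inner F (\<lambda>x. \<Sum>t\<in>S. complex_of_real (a t) * e_fun t x) (\<lambda>x. \<Sum>t\<in>S. complex_of_real (b t) * e_fun t x)"
proof -
  have cv: "complex_of_real (cov M X s t) = L2_inner F (e_fun s) (e_fun t)" for s t
    using X by (simp add: stationary_increments_grf_def cov_def L2_inner_def)
  have e: "e_fun t \<in> L2_fun F" for t by (rule spectral_e_fun_L2[OF F])
  have "L2_inner F (\<lambda>x. \<Sum>t\<in>S. complex_of_real (a t) * e_fun t x) (\<lambda>x. \<Sum>t\<in>S. complex_of_real (b t) * e_fun t x) =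
    (\<Sum>s\<in>S. complex_of_real (a s) * (\<Sum>t\<in>S. cnj (complex_of_real (b t)) * L2_inner F (e_fun s) (e_fun t)))"
    using S e by (subst L2_inner_sum_left; (intro L2_fun_sum)?; simp add: L2_inner_sum_right)
  then show ?thesis
    unfolding quad_form_def by (simp add: sum_distrib_left mult.assoc flip: cv)
qed

lemma density_L2_norm_sq:
  assumes F: "F = density lborel (\<lambda>x. ennreal (f x))" and [measurable]: "f \<in> borel_measurable borel"
    and \<phi>: "\<phi> \<in> L2_fun F"
  shows "(\<integral>\<^sup>+x. ennreal (f x) * ennreal ((norm (\<phi> x))\<^sup>2) \<partial>lborel) = ennreal ((L2_norm F \<phi>)\<^sup>2)"
proof -
  have "\<phi> \<in> borel_measurable lborel" using \<phi> unfolding L2_fun_def F by simp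
  then have "(\<integral>\<^sup>+x. ennreal (f x) * ennreal ((norm (\<phi> x))\<^sup>2) \<partial>lborel) = (\<integral>\<^sup>+x. ennreal ((norm (\<phi> x))\<^sup>2) \<partial>F)"
    unfolding F by (subst nn_integral_density) auto
  then show ?thesis by (simp only: L2_norm_sq_nn[OF \<phi>])
qed

section \<open>The divergence of the two fields\<close>

text \<open>The lower bound on \<open>lam i\<close> trades the denominator for the factor
  \<open>C^2\<close>, and the 2 in it offsets the one from squaring a sum. For nonnegative
  \<open>l i\<close> the sum of squares is at most the square of the sum.\<close>

lemma sum_deviation_bound:
  fixes lam l h :: "nat \<Rightarrow> real"
  assumes dev: "\<And>i. i < n \<Longrightarrow> \<bar>lam i - 1\<bar> \<le> l i + h i" and l: "\<And>i. i < n \<Longrightarrow> l i \<ge> 0"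
    and A: "(\<Sum>i<n. l i) \<le> A" and B: "(\<Sum>i<n. (h i)\<^sup>2) \<le> B" and C: "\<And>i. i < n \<Longrightarrow> 1 \<le> C\<^sup>2 * lam i"
  shows "(\<Sum>i<n. (lam i - 1)\<^sup>2 / (2 * lam i)) \<le> C\<^sup>2 * (A\<^sup>2 + B)"
proof -
  have lampos: "lam i > 0" if "i < n" for i
    using C[OF that] mult_nonneg_nonpos[of "C\<^sup>2" "lam i"] by (cases "lam i > 0") auto
  have "(\<Sum>i<n. (lam i - 1)\<^sup>2 / (2 * lam i)) \<le> (\<Sum>i<n. C\<^sup>2 * ((l i)\<^sup>2 + (h i)\<^sup>2))"
  proof (rule sum_mono)
    fix i assume "i \<in> {..<n}"
    then have i: "i < n" by simp
    have "(lam i - 1)\<^sup>2 = \<bar>lam i - 1\<bar>\<^sup>2" by simp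
    also have "\<dots> \<le> (l i + h i)\<^sup>2" by (intro power_mono dev i) simp
    also have "\<dots> \<le> 2 * ((l i)\<^sup>2 + (h i)\<^sup>2)"
      using sum_squares_bound[of "l i" "h i"] by (simp add: power2_sum)
    finally have 1: "(lam i - 1)\<^sup>2 \<le> 2 * ((l i)\<^sup>2 + (h i)\<^sup>2)" .
    have "(lam i - 1)\<^sup>2 = (lam i - 1)\<^sup>2 * 1" by simp
    also have "\<dots> \<le> 2 * ((l i)\<^sup>2 + (h i)\<^sup>2) * (C\<^sup>2 * lam i)"
      by (intro mult_mono 1 C i) auto
    finally show "(lam i - 1)\<^sup>2 / (2 * lam i) \<le> C\<^sup>2 * ((l i)\<^sup>2 + (h i)\<^sup>2)"
      using lampos[OF i] by (simp add: divide_le_eq mult_ac)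
  qed
  also have "\<dots> = C\<^sup>2 * ((\<Sum>i<n. (l i)\<^sup>2) + (\<Sum>i<n. (h i)\<^sup>2))"
    by (simp add: sum_distrib_left[symmetric] sum.distrib)
  also have "\<dots> \<le> C\<^sup>2 * (A\<^sup>2 + B)"
  proof (intro mult_left_mono add_mono B)
    have "(\<Sum>i<n. (l i)\<^sup>2) \<le> (\<Sum>i<n. l i * (\<Sum>j<n. l j))"
      unfolding power2_eq_square using l by (intro sum_mono mult_left_mono member_le_sum) auto
    also have "\<dots> = (\<Sum>i<n. l i)\<^sup>2" by (simp add: sum_distrib_right[symmetric] power2_eq_square)
    also have "\<dots> \<le> A\<^sup>2" using A l by (intro power_mono sum_nonneg) auto
    finally show "(\<Sum>i<n. (l i)\<^sup>2) \<le> A\<^sup>2" .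
  qed simp
  finally show ?thesis .
qed

text \<open>On the ball |x|^2 is at most \<open>1 + k^2\<close> times the weight in the definition
  of a spectral measure.\<close>

lemma spectral_low_frequency_mass:
  assumes F: "F = density lborel (\<lambda>x. ennreal (f x))" "spectral_measure F" and fm[measurable]: "f \<in> borel_measurable borel"
  shows "(\<integral>\<^sup>+x. ennreal (f x) * (ennreal (c * (norm x)\<^sup>2) * indicator (cball 0 k) x) \<partial>(lborel :: (real^'d) measure)) < \<infinity>"
proof -
  have fin: "(\<integral>\<^sup>+ x. ennreal ((norm x)\<^sup>2 / (1 + (norm x)\<^sup>2)) \<partial>F) < \<infinity>" using F by (simp add: spectral_measure_def)
  have sF: "sets F = sets borel" by (simp add: F(1))
  have [measurable]: "cball (0::real^'d) k \<in> sets borel" by simp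
  have "(\<integral>\<^sup>+x. ennreal (f x) * (ennreal (c * (norm x)\<^sup>2) * indicator (cball 0 k) x) \<partial>lborel) =
    (\<integral>\<^sup>+x. ennreal (c * (norm x)\<^sup>2) * indicator (cball 0 k) x \<partial>F)"
    unfolding F(1) by (rule nn_integral_density[symmetric]) measurable
  also have "\<dots> \<le> (\<integral>\<^sup>+x. ennreal (\<bar>c\<bar> * (1 + k\<^sup>2)) * ennreal ((norm x)\<^sup>2 / (1 + (norm x)\<^sup>2)) \<partial>F)"
  proof (rule nn_integral_mono)
    fix x :: "real^'d"
    show "ennreal (c * (norm x)\<^sup>2) * indicator (cball 0 k) x \<le> ennreal (\<bar>c\<bar> * (1 + k\<^sup>2)) * ennreal ((norm x)\<^sup>2 / (1 + (norm x)\<^sup>2))"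
    proof (cases "x \<in> cball 0 k")
      case True
      then have "(norm x)\<^sup>2 \<le> k\<^sup>2" by (intro power_mono) auto
      then have "(norm x)\<^sup>2 * (1 + (norm x)\<^sup>2) \<le> (norm x)\<^sup>2 * (1 + k\<^sup>2)" by (intro mult_left_mono) auto
      then have "(norm x)\<^sup>2 \<le> (1 + k\<^sup>2) * ((norm x)\<^sup>2 / (1 + (norm x)\<^sup>2))"
        by (simp add: pos_le_divide_eq add_pos_nonneg mult.commute)
      then have "\<bar>c\<bar> * (norm x)\<^sup>2 \<le> \<bar>c\<bar> * ((1 + k\<^sup>2) * ((norm x)\<^sup>2 / (1 + (norm x)\<^sup>2)))"
        by (rule mult_left_mono) simp
      moreover have "c * (norm x)\<^sup>2 \<le> \<bar>c\<bar> * (norm x)\<^sup>2" by (intro mult_right_mono) auto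
      ultimately have "c * (norm x)\<^sup>2 \<le> (\<bar>c\<bar> * (1 + k\<^sup>2)) * ((norm x)\<^sup>2 / (1 + (norm x)\<^sup>2))"
        unfolding mult.assoc by (rule order_trans[rotated])
      then have "ennreal (c * (norm x)\<^sup>2) \<le> ennreal ((\<bar>c\<bar> * (1 + k\<^sup>2)) * ((norm x)\<^sup>2 / (1 + (norm x)\<^sup>2)))"
        by (rule ennreal_leI)
      also have "\<dots> = ennreal (\<bar>c\<bar> * (1 + k\<^sup>2)) * ennreal ((norm x)\<^sup>2 / (1 + (norm x)\<^sup>2))"
        by (intro ennreal_mult) auto
      finally show ?thesis using True by simp
    qed simp
  qed
  also have "\<dots> = ennreal (\<bar>c\<bar> * (1 + k\<^sup>2)) * (\<integral>\<^sup>+x. ennreal ((norm x)\<^sup>2 / (1 + (norm x)\<^sup>2)) \<partial>F)"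
    by (intro nn_integral_cmult) (simp add: measurable_cong_sets[OF sF refl])
  also have "\<dots> < \<infinity>" using fin by (simp add: ennreal_mult_less_top)
  finally show ?thesis .
qed

lemma divergence_sum_bound:
  fixes f0 f1 :: "real^'d \<Rightarrow> real" and K0 :: "real^'d \<Rightarrow> real^'d \<Rightarrow> complex"
  assumes T: "T > 0" and F0: "spectral_measure F0" and F1: "spectral_measure F1"
    and m[measurable]: "f0 \<in> borel_measurable borel" "f1 \<in> borel_measurable borel"
    and pos: "\<And>x. x \<noteq> 0 \<Longrightarrow> f0 x > 0" "\<And>x. x \<noteq> 0 \<Longrightarrow> f1 x > 0"
    and d0: "F0 = density lborel (\<lambda>x. ennreal (f0 x))" and d1: "F1 = density lborel (\<lambda>x. ennreal (f1 x))"
    and c: "c > 0" and low: "\<And>x. norm x > k0 \<Longrightarrow> f0 x \<ge> c * norm x powr (- \<eta>)"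
    and K: "reproducing_kernel (Pi_cube T) F0 K0"
    and C: "\<And>\<phi>. \<phi> \<in> e_span (Pi_cube T) \<Longrightarrow> L2_norm F0 \<phi> \<le> C * L2_norm F1 \<phi>"
    and fin: "(\<integral>\<^sup>+ x\<in>{x. norm x > k}.
            ennreal (((f1 x - f0 x) / f0 x)\<^sup>2 * Re (K0 x x) * f0 x) \<partial>lborel) < \<infinity>"
  shows "\<exists>J\<ge>0. \<forall>(n::nat) \<phi>. (\<forall>i<n. \<phi> i \<in> e_span (Pi_cube T)) \<longrightarrow>
     (\<forall>i<n. \<forall>j<n. L2_inner F0 (\<phi> i) (\<phi> j) = (if i = j then 1 else 0)) \<longrightarrow>
     (\<Sum>i<n. ((L2_norm F1 (\<phi> i))\<^sup>2 - 1)\<^sup>2 / (2 * (L2_norm F1 (\<phi> i))\<^sup>2)) \<le> J"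
proof -
  have [measurable]: "cball (0::real^'d) k \<in> sets borel" by simp
  have "\<exists>C\<ge>0. \<forall>\<phi>\<in>e_span (Pi_cube T). \<forall>x\<in>cball 0 k. norm (\<phi> x) \<le> C * norm x * L2_norm F0 \<phi>"
  proof (rule e_span_local_bound[where ?k0.0 = k0 and \<eta> = \<eta>, OF less_imp_le[OF T] d0 F0 m(1) _ c])
    show "f0 x > 0" if "x \<noteq> 0" for x by (rule pos(1)[OF that])
    show "f0 x \<ge> c * norm x powr (- \<eta>)" if "norm x > k0" for x by (rule low[OF that])
  qed
  then obtain C1 where C1: "C1 \<ge> 0" "\<And>\<phi> x. \<phi> \<in> e_span (Pi_cube T) \<Longrightarrow> x \<in> cball 0 k \<Longrightarrow> norm (\<phi> x) \<le> C1 * norm x * L2_norm F0 \<phi>"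
    by blast
  define w where "w x = ennreal (C1\<^sup>2 * (norm x)\<^sup>2) * indicator (cball 0 k) x" for x :: "real^'d"
  \<comment> \<open>Nothing compares the two densities at low frequencies, so each contributes its
    full mass.\<close>
  define A where "A = (\<integral>\<^sup>+x. ennreal (f0 x) * w x \<partial>lborel) + (\<integral>\<^sup>+x. ennreal (f1 x) * w x \<partial>lborel)"
  have A: "A < \<infinity>"
    unfolding A_def w_def using spectral_low_frequency_mass[OF d0 F0 m(1)] spectral_low_frequency_mass[OF d1 F1 m(2)] by simp
  define B where "B = (\<integral>\<^sup>+ x\<in>{x. norm x > k}. ennreal (((f1 x - f0 x) / f0 x)\<^sup>2 * Re (K0 x x) * f0 x) \<partial>lborel)"
  have B: "B < \<infinity>" using fin by (simp add: B_def)
  have bound: "(\<Sum>i<n. ((L2_norm F1 (\<phi> i))\<^sup>2 - 1)\<^sup>2 / (2 * (L2_norm F1 (\<phi> i))\<^sup>2)) \<le> C\<^sup>2 * ((enn2real A)\<^sup>2 + enn2real B)"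
    if \<phi>: "\<And>i. i < n \<Longrightarrow> \<phi> i \<in> e_span (Pi_cube T)"
      and on: "\<And>i j. i < n \<Longrightarrow> j < n \<Longrightarrow> L2_inner F0 (\<phi> i) (\<phi> j) = (if i = j then 1 else 0)" for n :: nat and \<phi>
  proof -
    define lam where "lam i = (L2_norm F1 (\<phi> i))\<^sup>2" for i
    have one: "(L2_norm F0 (\<phi> i))\<^sup>2 = 1" if "i < n" for i
      using on[OF that that] by (simp add: L2_norm_def)
    define g where "g i x = ennreal ((norm (\<phi> i x))\<^sup>2)" for i x
    have \<phi>m: "\<phi> i \<in> borel_measurable borel" if "i < n" for i by (rule e_span_measurable[OF \<phi>[OF that]])
    have gm: "g i \<in> borel_measurable borel" if "i < n" for i unfolding g_def using \<phi>m[OF that] by measurable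
    have g0: "(\<integral>\<^sup>+x. ennreal (f0 x) * g i x \<partial>lborel) = 1" if "i < n" for i
      unfolding g_def using density_L2_norm_sq[OF d0 m(1) e_span_L2[OF F0 \<phi>[OF that]]] one[OF that] by simp
    have g1: "(\<integral>\<^sup>+x. ennreal (f1 x) * g i x \<partial>lborel) = ennreal (lam i)" if "i < n" for i
      unfolding g_def lam_def by (rule density_L2_norm_sq[OF d1 m(2) e_span_L2[OF F1 \<phi>[OF that]]])
    have Clam: "1 \<le> C\<^sup>2 * lam i" if "i < n" for i
    proof -
      have "(L2_norm F0 (\<phi> i))\<^sup>2 \<le> (C * L2_norm F1 (\<phi> i))\<^sup>2"
        by (intro power_mono C \<phi> that L2_norm_nonneg)
      then show ?thesis using one[OF that] by (simp add: lam_def power_mult_distrib)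
    qed
    define L where "L i = (\<integral>\<^sup>+x. ennreal (f0 x) * (g i x * indicator (cball 0 k) x) \<partial>lborel) +
       (\<integral>\<^sup>+x. ennreal (f1 x) * (g i x * indicator (cball 0 k) x) \<partial>lborel)" for i
    define H where "H i = (\<integral>\<^sup>+x. ennreal \<bar>f1 x - f0 x\<bar> * (g i x * indicator {x. norm x > k} x) \<partial>lborel)" for i
    have ind: "indicator (cball 0 k) x + indicator {x. norm x > k} x = (1::ennreal)" for x :: "real^'d"
      by (auto simp: indicator_def)
    \<comment> \<open>Two one-sided inequalities stand for the bound on \<open>|lam i - 1|\<close>:
      the integrals are extended reals whose finiteness is established only after summation over
      \<open>i\<close>.\<close>
    have dev1: "ennreal (lam i) \<le> 1 + (L i + H i)" and dev2: "1 \<le> ennreal (lam i) + (L i + H i)" if i: "i < n" for i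
    proof -
      note [measurable] = gm[OF i]
      have split: "(\<integral>\<^sup>+x. u x * g i x \<partial>lborel) = (\<integral>\<^sup>+x. u x * (g i x * indicator (cball 0 k) x) \<partial>lborel) + (\<integral>\<^sup>+x. u x * (g i x * indicator {x. norm x > k} x) \<partial>lborel)"
        if [measurable]: "u \<in> borel_measurable borel" for u
      proof -
        have "u x * g i x = u x * (g i x * indicator (cball 0 k) x) + u x * (g i x * indicator {x. norm x > k} x)" for x
          unfolding distrib_left[symmetric] ind by simp
        then show ?thesis by (simp add: nn_integral_add)
      qed
      have high: "(\<integral>\<^sup>+x. ennreal (v x) * (g i x * indicator {x. norm x > k} x) \<partial>lborel) \<le>
         (\<integral>\<^sup>+x. ennreal (u x) * g i x \<partial>lborel) + (\<integral>\<^sup>+x. ennreal \<bar>v x - u x\<bar> * (g i x * indicator {x. norm x > k} x) \<partial>lborel)"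
        if [measurable]: "u \<in> borel_measurable borel" "v \<in> borel_measurable borel" for u v
      proof -
        have "(\<integral>\<^sup>+x. ennreal (v x) * (g i x * indicator {x. norm x > k} x) \<partial>lborel) \<le>
           (\<integral>\<^sup>+x. ennreal (u x) * g i x + ennreal \<bar>v x - u x\<bar> * (g i x * indicator {x. norm x > k} x) \<partial>lborel)"
        proof (rule nn_integral_mono)
          fix x
          have "ennreal (v x) \<le> ennreal (u x) + ennreal \<bar>v x - u x\<bar>"
          proof (cases "u x \<ge> 0")
            case True
            then show ?thesis by (simp add: ennreal_plus[symmetric] ennreal_leI del: ennreal_plus)
          next
            case False
            then show ?thesis by (intro add_increasing ennreal_leI) auto
          qed
          then have "ennreal (v x) * (g i x * indicator {x. norm x > k} x) \<le> (ennreal (u x) + ennreal \<bar>v x - u x\<bar>) * (g i x * indicator {x. norm x > k} x)"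
            by (rule mult_right_mono) simp
          also have "\<dots> = ennreal (u x) * (g i x * indicator {x. norm x > k} x) + ennreal \<bar>v x - u x\<bar> * (g i x * indicator {x. norm x > k} x)"
            by (rule distrib_right)
          also have "\<dots> \<le> ennreal (u x) * g i x + ennreal \<bar>v x - u x\<bar> * (g i x * indicator {x. norm x > k} x)"
            by (intro add_right_mono mult_left_mono) (auto simp: indicator_def)
          finally show "ennreal (v x) * (g i x * indicator {x. norm x > k} x) \<le> \<dots>" .
        qed
        also have "\<dots> = (\<integral>\<^sup>+x. ennreal (u x) * g i x \<partial>lborel) + (\<integral>\<^sup>+x. ennreal \<bar>v x - u x\<bar> * (g i x * indicator {x. norm x > k} x) \<partial>lborel)"
          by (rule nn_integral_add) measurable
        finally show ?thesis .
      qed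
      have "ennreal (lam i) = (\<integral>\<^sup>+x. ennreal (f1 x) * (g i x * indicator (cball 0 k) x) \<partial>lborel) + (\<integral>\<^sup>+x. ennreal (f1 x) * (g i x * indicator {x. norm x > k} x) \<partial>lborel)"
        unfolding g1[OF i, symmetric] by (rule split) measurable
      also have "\<dots> \<le> L i + (1 + H i)"
        using high[OF m] by (intro add_mono) (simp_all add: L_def H_def g0[OF i])
      finally show "ennreal (lam i) \<le> 1 + (L i + H i)" by (simp add: ac_simps)
      have "1 = (\<integral>\<^sup>+x. ennreal (f0 x) * (g i x * indicator (cball 0 k) x) \<partial>lborel) + (\<integral>\<^sup>+x. ennreal (f0 x) * (g i x * indicator {x. norm x > k} x) \<partial>lborel)"
        unfolding g0[OF i, symmetric] by (rule split) measurable
      also have "\<dots> \<le> L i + (ennreal (lam i) + H i)"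
        using high[OF m(2) m(1)] by (intro add_mono) (simp_all add: L_def H_def g1[OF i] abs_minus_commute)
      finally show "1 \<le> ennreal (lam i) + (L i + H i)" by (simp add: ac_simps)
    qed
    have sumL: "(\<Sum>i<n. L i) \<le> A"
    proof -
      have bessel: "(\<Sum>i<n. g i x * indicator (cball 0 k) x) \<le> w x" for x
      proof (cases "x \<in> cball 0 k")
        case True
        have "(\<Sum>i<n. (norm (\<phi> i x))\<^sup>2) \<le> (C1 * norm x)\<^sup>2"
          by (rule bessel_from_evaluation_bound[OF F0 _ _ \<phi> on]) (use C1 True in auto)
        then show ?thesis using True by (simp add: g_def w_def sum_ennreal power_mult_distrib ennreal_leI)
      qed (simp add: w_def)
      have "(\<Sum>i<n. \<integral>\<^sup>+x. ennreal (u x) * (g i x * indicator (cball 0 k) x) \<partial>lborel) \<le> (\<integral>\<^sup>+x. ennreal (u x) * w x \<partial>lborel)"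
        if [measurable]: "u \<in> borel_measurable borel" for u
      proof -
        have "(\<Sum>i<n. \<integral>\<^sup>+x. ennreal (u x) * (g i x * indicator (cball 0 k) x) \<partial>lborel) = (\<integral>\<^sup>+x. (\<Sum>i<n. ennreal (u x) * (g i x * indicator (cball 0 k) x)) \<partial>lborel)"
        proof (rule nn_integral_sum[symmetric])
          fix i assume "i \<in> {..<n}"
          then have [measurable]: "g i \<in> borel_measurable borel" using gm by simp
          show "(\<lambda>x. ennreal (u x) * (g i x * indicator (cball 0 k) x)) \<in> borel_measurable lborel" by measurable
        qed
        also have "\<dots> \<le> (\<integral>\<^sup>+x. ennreal (u x) * w x \<partial>lborel)"
          unfolding sum_distrib_left[symmetric] by (intro nn_integral_mono mult_left_mono bessel) simp
        finally show ?thesis .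
      qed
      from add_mono[OF this[OF m(1)] this[OF m(2)]] show ?thesis by (simp add: L_def A_def sum.distrib)
    qed
    \<comment> \<open>Splits \<open>|f1 - f0|\<close> times the squared modulus of
      \<open>\<phi> i\<close> so that \<open>q i\<close> has norm 1, while the squares of the
      \<open>p i\<close> sum to at most the integrand of the hypothesis.\<close>
    define p where "p i x = ennreal (\<bar>f1 x - f0 x\<bar> / sqrt (f0 x) * norm (\<phi> i x)) * indicator {x. norm x > k} x" for i x
    define q where "q i x = ennreal (sqrt (f0 x) * norm (\<phi> i x))" for i x
    have pm: "p i \<in> borel_measurable borel" and qm: "q i \<in> borel_measurable borel" if "i < n" for i
    proof -
      note [measurable] = \<phi>m[OF that]
      show "p i \<in> borel_measurable borel" "q i \<in> borel_measurable borel" unfolding p_def q_def by measurable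
    qed
    have ne0: "AE x in lborel. x \<noteq> (0::real^'d)" by (rule AE_lborel_singleton)
    have H2: "(H i)\<^sup>2 \<le> (\<integral>\<^sup>+x. (p i x)\<^sup>2 \<partial>lborel)" if i: "i < n" for i
    proof -
      have "H i = (\<integral>\<^sup>+x. p i x * q i x \<partial>lborel)"
        unfolding H_def
      proof (rule nn_integral_cong_AE)
        show "AE x in lborel. ennreal \<bar>f1 x - f0 x\<bar> * (g i x * indicator {x. norm x > k} x) = p i x * q i x"
          using ne0
        proof eventually_elim
          case (elim x)
          have "\<bar>f1 x - f0 x\<bar> * (norm (\<phi> i x))\<^sup>2 = (\<bar>f1 x - f0 x\<bar> / sqrt (f0 x) * norm (\<phi> i x)) * (sqrt (f0 x) * norm (\<phi> i x))"
            using pos(1)[OF elim] by (simp add: power2_eq_square)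
          then have "ennreal \<bar>f1 x - f0 x\<bar> * ennreal ((norm (\<phi> i x))\<^sup>2) = ennreal (\<bar>f1 x - f0 x\<bar> / sqrt (f0 x) * norm (\<phi> i x)) * ennreal (sqrt (f0 x) * norm (\<phi> i x))"
            using pos(1)[OF elim] by (simp add: ennreal_mult[symmetric])
          then show ?case by (cases "norm x > k") (simp_all add: p_def q_def g_def)
        qed
      qed
      then have "(H i)\<^sup>2 \<le> (\<integral>\<^sup>+x. (p i x)\<^sup>2 \<partial>lborel) * (\<integral>\<^sup>+x. (q i x)\<^sup>2 \<partial>lborel)"
        using Cauchy_Schwarz_nn_integral[of "p i" lborel "q i"] pm[OF i] qm[OF i] by simp
      also have "(\<integral>\<^sup>+x. (q i x)\<^sup>2 \<partial>lborel) = (\<integral>\<^sup>+x. ennreal (f0 x) * g i x \<partial>lborel)"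
      proof (rule nn_integral_cong_AE)
        show "AE x in lborel. (q i x)\<^sup>2 = ennreal (f0 x) * g i x"
          using ne0
        proof eventually_elim
          case (elim x)
          then show ?case using pos(1)[OF elim]
            by (simp add: q_def g_def ennreal_power power_mult_distrib ennreal_mult[symmetric])
        qed
      qed
      also have "\<dots> = 1" by (rule g0[OF i])
      finally show ?thesis by simp
    qed
    have sumH: "(\<Sum>i<n. (H i)\<^sup>2) \<le> B"
    proof -
      have "(\<Sum>i<n. (H i)\<^sup>2) \<le> (\<Sum>i<n. \<integral>\<^sup>+x. (p i x)\<^sup>2 \<partial>lborel)" by (intro sum_mono H2) simp
      also have "\<dots> = (\<integral>\<^sup>+x. (\<Sum>i<n. (p i x)\<^sup>2) \<partial>lborel)"
        using pm by (intro nn_integral_sum[symmetric]) auto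
      also have "\<dots> \<le> B"
        unfolding B_def
      proof (rule nn_integral_mono_AE)
        show "AE x in lborel. (\<Sum>i<n. (p i x)\<^sup>2) \<le> ennreal (((f1 x - f0 x) / f0 x)\<^sup>2 * Re (K0 x x) * f0 x) * indicator {x. norm x > k} x"
          using ne0
        proof eventually_elim
          case (elim x)
          note p0 = pos(1)[OF elim]
          show ?case
          proof (cases "norm x > k")
            case True
            have zero: "(\<lambda>_. 0) \<in> e_span (Pi_cube T)"
              using e_span_sum[of "{}" "\<lambda>i::nat. \<lambda>_. 0" "Pi_cube T"] by simp
            have K0: "Re (K0 x x) \<ge> 0" by (rule reproducing_kernel_bound(2)[OF F0 K zero])
            have "(\<Sum>i<n. (norm (\<phi> i x))\<^sup>2) \<le> (sqrt (Re (K0 x x)))\<^sup>2"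
              by (rule bessel_from_evaluation_bound[OF F0 _ _ \<phi> on]) (use K0 reproducing_kernel_bound(1)[OF F0 K] in auto)
            then have S: "(\<Sum>i<n. (norm (\<phi> i x))\<^sup>2) \<le> Re (K0 x x)" using K0 by simp
            have "(\<Sum>i<n. (p i x)\<^sup>2) = ennreal (\<Sum>i<n. (\<bar>f1 x - f0 x\<bar> / sqrt (f0 x) * norm (\<phi> i x))\<^sup>2)"
              using True p0 by (simp add: p_def ennreal_power sum_ennreal)
            also have "(\<Sum>i<n. (\<bar>f1 x - f0 x\<bar> / sqrt (f0 x) * norm (\<phi> i x))\<^sup>2) = (((f1 x - f0 x) / f0 x)\<^sup>2 * f0 x) * (\<Sum>i<n. (norm (\<phi> i x))\<^sup>2)"
              unfolding sum_distrib_left using p0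
              by (intro sum.cong refl) (simp add: power_mult_distrib power_divide power2_eq_square)
            also have "ennreal \<dots> \<le> ennreal ((((f1 x - f0 x) / f0 x)\<^sup>2 * f0 x) * Re (K0 x x))"
              using p0 by (intro ennreal_leI mult_left_mono S) auto
            finally show ?thesis using True by (simp add: mult_ac)
          qed (simp add: p_def)
        qed
      qed
      finally show ?thesis .
    qed
    have Lfin: "L i < \<infinity>" if "i < n" for i
    proof -
      have "L i \<le> (\<Sum>i<n. L i)" by (rule member_le_sum) (use that in auto)
      then show ?thesis using sumL A by (metis le_less_trans)
    qed
    have Hfin: "H i < \<infinity>" if "i < n" for i
    proof -
      have "(H i)\<^sup>2 \<le> (\<Sum>i<n. (H i)\<^sup>2)" by (rule member_le_sum) (use that in auto)
      then have "(H i)\<^sup>2 < \<infinity>" using sumH B by (metis le_less_trans)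
      then show ?thesis by (auto simp: power2_eq_square ennreal_mult_less_top)
    qed
    have Lr: "L i = ennreal (enn2real (L i))" if "i < n" for i using Lfin[OF that] by (simp add: less_top)
    have Hr: "H i = ennreal (enn2real (H i))" if "i < n" for i using Hfin[OF that] by (simp add: less_top)
    have "(\<Sum>i<n. (lam i - 1)\<^sup>2 / (2 * lam i)) \<le> C\<^sup>2 * ((enn2real A)\<^sup>2 + enn2real B)"
    proof (rule sum_deviation_bound[where l = "\<lambda>i. enn2real (L i)" and h = "\<lambda>i. enn2real (H i)"])
      fix i assume i: "i < n"
      have l0: "lam i \<ge> 0" by (simp add: lam_def)
      have "ennreal (lam i) \<le> ennreal (1 + (enn2real (L i) + enn2real (H i)))"
        using dev1[OF i] by (subst (asm) Lr[OF i], subst (asm) Hr[OF i]) simp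
      then have 1: "lam i \<le> 1 + (enn2real (L i) + enn2real (H i))" by (subst (asm) ennreal_le_iff) auto
      have "ennreal 1 \<le> ennreal (lam i + (enn2real (L i) + enn2real (H i)))"
        using dev2[OF i] l0 by (subst (asm) Lr[OF i], subst (asm) Hr[OF i]) simp
      then have 2: "1 \<le> lam i + (enn2real (L i) + enn2real (H i))" using l0 by (subst (asm) ennreal_le_iff) auto
      show "\<bar>lam i - 1\<bar> \<le> enn2real (L i) + enn2real (H i)" using 1 2 by linarith
      show "enn2real (L i) \<ge> 0" by simp
      show "1 \<le> C\<^sup>2 * lam i" by (rule Clam[OF i])
    next
      have "ennreal (\<Sum>i<n. enn2real (L i)) = (\<Sum>i<n. L i)"
        using Lr by (simp add: sum_ennreal[symmetric])
      then have "ennreal (\<Sum>i<n. enn2real (L i)) \<le> ennreal (enn2real A)" using sumL A by (simp add: less_top)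
      then show "(\<Sum>i<n. enn2real (L i)) \<le> enn2real A" by (subst (asm) ennreal_le_iff) auto
      have "ennreal (\<Sum>i<n. (enn2real (H i))\<^sup>2) = (\<Sum>i<n. (H i)\<^sup>2)"
        using Hr by (simp add: sum_ennreal[symmetric] ennreal_power[symmetric])
      then have "ennreal (\<Sum>i<n. (enn2real (H i))\<^sup>2) \<le> ennreal (enn2real B)" using sumH B by (simp add: less_top)
      then show "(\<Sum>i<n. (enn2real (H i))\<^sup>2) \<le> enn2real B" by (subst (asm) ennreal_le_iff) auto
    qed
    then show ?thesis by (simp add: lam_def)
  qed
  show ?thesis
    by (intro exI[of _ "C\<^sup>2 * ((enn2real A)\<^sup>2 + enn2real B)"] conjI allI impI bound) auto
qed

theorem theorem3p5:
  fixes T :: real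
    and F0 F1 :: "(real^'d) measure"
    and f0 f1 :: "real^'d \<Rightarrow> real"
    and K0 :: "real^'d \<Rightarrow> real^'d \<Rightarrow> complex"
    and M0 :: "'v measure" and X0 :: "real^'d \<Rightarrow> 'v \<Rightarrow> real"
    and M1 :: "'w measure" and X1 :: "real^'d \<Rightarrow> 'w \<Rightarrow> real"
  assumes "T > 0"
    and "spectral_measure F0" and "spectral_measure F1"
    and "f0 \<in> borel_measurable borel" and "f1 \<in> borel_measurable borel"
    and "\<And>x. x \<noteq> 0 \<Longrightarrow> f0 x > 0" and "\<And>x. x \<noteq> 0 \<Longrightarrow> f1 x > 0"
    and "F0 = density lborel (\<lambda>x. ennreal (f0 x))"
    and "F1 = density lborel (\<lambda>x. ennreal (f1 x))"
    and "\<exists>c>0. \<exists>k0>0. \<exists>\<eta>>0. \<forall>x. norm x > k0 \<longrightarrow> f0 x \<ge> c * norm x powr (- \<eta>)"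
    and "reproducing_kernel (Pi_cube T) F0 K0"
    and "\<exists>C>0. \<forall>\<phi>\<in>e_span (Pi_cube T). L2_norm F0 \<phi> \<le> C * L2_norm F1 \<phi>"
    and "\<exists>k>0. (\<integral>\<^sup>+ x\<in>{x. norm x > k}.
            ennreal (((f1 x - f0 x) / f0 x)\<^sup>2 * Re (K0 x x) * f0 x) \<partial>lborel) < \<infinity>"
    and "stationary_increments_grf F0 M0 X0"
    and "stationary_increments_grf F1 M1 X1"
  shows "equivalent_on (Pi_cube T) M0 X0 M1 X1"
proof -
  obtain c k0 \<eta> where c: "c > 0" "\<And>x. norm x > k0 \<Longrightarrow> f0 x \<ge> c * norm x powr (- \<eta>)" using assms(10) by blast
  obtain C where C: "\<And>\<phi>. \<phi> \<in> e_span (Pi_cube T) \<Longrightarrow> L2_norm F0 \<phi> \<le> C * L2_norm F1 \<phi>" using assms(12) by blast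
  obtain k where k: "(\<integral>\<^sup>+ x\<in>{x. norm x > k}. ennreal (((f1 x - f0 x) / f0 x)\<^sup>2 * Re (K0 x x) * f0 x) \<partial>lborel) < \<infinity>"
    using assms(13) by blast
  have "\<exists>J\<ge>0. \<forall>(n::nat) \<phi>. (\<forall>i<n. \<phi> i \<in> e_span (Pi_cube T)) \<longrightarrow>
     (\<forall>i<n. \<forall>j<n. L2_inner F0 (\<phi> i) (\<phi> j) = (if i = j then 1 else 0)) \<longrightarrow>
     (\<Sum>i<n. ((L2_norm F1 (\<phi> i))\<^sup>2 - 1)\<^sup>2 / (2 * (L2_norm F1 (\<phi> i))\<^sup>2)) \<le> J"
  proof (rule divergence_sum_bound[where ?k0.0 = k0 and \<eta> = \<eta> and C = C, OF assms(1-5) _ _ assms(8,9) c(1) _ assms(11) _ k])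
    show "f0 x > 0" "f1 x > 0" if "x \<noteq> 0" for x using assms(6,7) that by auto
    show "f0 x \<ge> c * norm x powr (- \<eta>)" if "norm x > k0" for x by (rule c(2)[OF that])
    show "L2_norm F0 \<phi> \<le> C * L2_norm F1 \<phi>" if "\<phi> \<in> e_span (Pi_cube T)" for \<phi> by (rule C[OF that])
  qed
  then obtain J where J: "J \<ge> 0" "\<And>(n::nat) \<phi>. (\<forall>i<n. \<phi> i \<in> e_span (Pi_cube T)) \<Longrightarrow>
     (\<forall>i<n. \<forall>j<n. L2_inner F0 (\<phi> i) (\<phi> j) = (if i = j then 1 else 0)) \<Longrightarrow>
     (\<Sum>i<n. ((L2_norm F1 (\<phi> i))\<^sup>2 - 1)\<^sup>2 / (2 * (L2_norm F1 (\<phi> i))\<^sup>2)) \<le> J"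
    by blast
  have X0: "centered_gaussian_field M0 X0" and X1: "centered_gaussian_field M1 X1"
    using assms(14,15) by (auto simp: stationary_increments_grf_def)
  define comb where "comb S a = (\<lambda>x. \<Sum>t\<in>S. complex_of_real (a t) * e_fun t x)" for S and a :: "real^'d \<Rightarrow> real"
  have comb: "comb S a \<in> e_span (Pi_cube T)" if "finite S" "S \<subseteq> Pi_cube T" for S a
    unfolding comb_def e_span_def
    by (intro CollectI exI[of _ S] exI[of _ "\<lambda>t. complex_of_real (a t)"] conjI refl that)
  have q0: "complex_of_real (quad_form S (cov M0 X0) a b) = L2_inner F0 (comb S a) (comb S b)" if "finite S" for S a b
    unfolding comb_def by (rule grf_quad_form[OF assms(14,2) that])
  have q1: "complex_of_real (quad_form S (cov M1 X1) a b) = L2_inner F1 (comb S a) (comb S b)" if "finite S" for S a b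
    unfolding comb_def by (rule grf_quad_form[OF assms(15,3) that])
  have n0: "quad_form S (cov M0 X0) a a = (L2_norm F0 (comb S a))\<^sup>2" if "finite S" for S a
    using q0[OF that, of a a] unfolding L2_inner_self L2_norm_sq by (simp only: of_real_eq_iff)
  have n1: "quad_form S (cov M1 X1) a a = (L2_norm F1 (comb S a))\<^sup>2" if "finite S" for S a
    using q1[OF that, of a a] unfolding L2_inner_self L2_norm_sq by (simp only: of_real_eq_iff)
  show ?thesis
  proof (rule equivalent_on_of_bounded_divergence[OF X0 X1 J(1)])
    fix S :: "(real^'d) set" and a :: "real^'d \<Rightarrow> real"
    assume S: "finite S" "S \<subseteq> Pi_cube T"
    note cS = comb[OF S, of a]
    {
      assume "quad_form S (cov M0 X0) a a = 0"
      then have z: "L2_norm F0 (comb S a) = 0" using n0[OF S(1)] by simp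
      note [measurable] = e_span_measurable[OF cS] assms(4)
      have "(\<integral>\<^sup>+x. ennreal (f0 x) * ennreal ((norm (comb S a x))\<^sup>2) \<partial>lborel) = 0"
        using density_L2_norm_sq[OF assms(8,4) e_span_L2[OF assms(2) cS]] z by simp
      then have "AE x in lborel. ennreal (f0 x) * ennreal ((norm (comb S a x))\<^sup>2) = 0"
        by (subst (asm) nn_integral_0_iff_AE) auto
      \<comment> \<open>A null function for \<open>F0\<close> vanishes Lebesgue almost everywhere
        because \<open>f0\<close> is positive off the origin; hence it is null for \<open>F1\<close>
        too.\<close>
      then have "AE x in lborel. comb S a x = 0"
        using AE_lborel_singleton[of 0]
      proof eventually_elim
        case (elim x)
        then show ?case using assms(6)[of x] by simp
      qed
      then have ae: "AE x in lborel. ennreal (f1 x) * ennreal ((norm (comb S a x))\<^sup>2) = 0"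
        by eventually_elim simp
      have "(\<integral>\<^sup>+x. ennreal (f1 x) * ennreal ((norm (comb S a x))\<^sup>2) \<partial>lborel) = (\<integral>\<^sup>+x. 0 \<partial>(lborel :: (real^'d) measure))"
        by (rule nn_integral_cong_AE[OF ae])
      then have "ennreal ((L2_norm F1 (comb S a))\<^sup>2) = 0"
        using density_L2_norm_sq[OF assms(9,5) e_span_L2[OF assms(3) cS]] by simp
      then show "quad_form S (cov M1 X1) a a = 0" using n1[OF S(1)] by simp
    next
      assume "quad_form S (cov M0 X0) a a = 1"
      then have "(L2_norm F0 (comb S a))\<^sup>2 = 1" using n0[OF S(1)] by simp
      then have "L2_norm F0 (comb S a) = 1" using L2_norm_nonneg[of F0] by (simp add: power2_eq_1_iff) (metis L2_norm_nonneg neg_0_le_iff_le not_one_le_zero)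
      \<comment> \<open>Otherwise the comparison of norms would make the norm for \<open>F0\<close>
        equal to 0 instead of 1.\<close>
      then have "L2_norm F1 (comb S a) \<noteq> 0" using C[OF cS] by auto
      then show "quad_form S (cov M1 X1) a a > 0" using n1[OF S(1)] by simp
    }
  next
    fix S :: "(real^'d) set" and n :: nat and b :: "nat \<Rightarrow> real^'d \<Rightarrow> real" and lam
    assume S: "finite S" "S \<subseteq> Pi_cube T"
      and on: "\<And>k l. k < n \<Longrightarrow> l < n \<Longrightarrow> quad_form S (cov M0 X0) (b k) (b l) = (if k = l then 1 else 0)"
      and lam: "\<And>k. k < n \<Longrightarrow> quad_form S (cov M1 X1) (b k) (b k) = lam k"
    \<comment> \<open>\<open>J\<close> was fixed before \<open>S\<close> and \<open>n\<close>; this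
      is the required uniformity in the finite set of times.\<close>
    have "(\<Sum>i<n. ((L2_norm F1 (comb S (b i)))\<^sup>2 - 1)\<^sup>2 / (2 * (L2_norm F1 (comb S (b i)))\<^sup>2)) \<le> J"
      by (rule J(2)) (auto simp: comb[OF S] q0[OF S(1), symmetric] on)
    then show "(\<Sum>k<n. (lam k - 1)\<^sup>2 / (2 * lam k)) \<le> J"
      using lam by (simp add: n1[OF S(1)])
  qed
qed

end
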